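(* Let $N\ge1$ be an integer, $\alpha\in(0,1)$, $d>0$, $a\ge0$, $T>0$, and let $m$ be a natural number with $m>N/2$. Then the problem $$\begin{cases}\partial_t^\alpha u-d\Delta u=au, & x\in\mathbb{R}^N,\ t>0,\\ u(x,0)=\delta,\end{cases}$$ is solved for $t\in[0,T]$ (in the distributional sense, in the class $L^\infty_\alpha([0,T],H^{-m}(\mathbb{R}^N))$) by $$u(x,t):=\mathcal{F}^{-1}\Big(E_\alpha\big((a-4\pi^2d|\xi|^2)t^\alpha\big)\Big),$$ where $\mathcal{F}$ is the Fourier transform in the space variable.
   Context: $E_\alpha(r)=\sum_{k=0}^\infty\frac{r^k}{\Gamma(1+k\alpha)}$ is the Mittag-Leffler function. The Fourier transform is normalized as $\mathcal{F}\varphi(\xi)=\int_{\mathbb{R}^N}\varphi(x)e^{-2\pi i x\cdot\xi}\,dx$ and is extended to tempered distributions. $\delta$ is the Dirac delta in $\mathbb{R}^N$ centered at $0$. $\partial_t^\alpha u(t)=\frac{1}{\Gamma(1-\alpha)}\int_0^t\frac{\dot u(\tau)}{(t-\tau)^\alpha}\,d\tau$ is the Caputo derivative; it enters only through the integral formulation below. $H^{-m}(\mathbb{R}^N)$ is the dual of the Sobolev space $H^m(\mathbb{R}^N)$, with norm $\|v\|_{H^{-m}(\mathbb{R}^N)}=\sup_{\varphi\in H^m(\mathbb{R}^N)\setminus\{0\}}\frac{|\langle v,\varphi\rangle|}{\|\varphi\|_{H^m(\mathbb{R}^N)}}$. We say that $v\in L^\infty_\alpha\big([0,T],H^{-m}(\mathbb{R}^N)\big)$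 if $v(t)\in H^{-m}(\mathbb{R}^N)$ for all $t\in[0,T]$ and $\sup_{t\in[0,T]}t^\alpha\|v(t)\|_{H^{-m}(\mathbb{R}^N)}<+\infty$. A (distributional) solution of the problem is a $u\in L^\infty_\alpha\big([0,T],H^{-m}(\mathbb{R}^N)\big)$ such that, for all $\varphi\in C_0^\infty(\mathbb{R}^N)$ (smooth, compactly supported) and all $t\in[0,T]$, $$\langle u(t),\varphi\rangle=\varphi(0)+\frac{1}{\Gamma(\alpha)}\int_0^t\frac{d\langle u(\tau),\Delta\varphi\rangle+a\langle u(\tau),\varphi\rangle}{(t-\tau)^{1-\alpha}}\,d\tau .$$ *)

theory Defs
  imports "HOL-Analysis.Analysis"
begin

definition mittag_leffler :: "real \<Rightarrow> real \<Rightarrow> real" where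
  "mittag_leffler \<alpha> r = (\<Sum>k. r ^ k / Gamma (1 + real k * \<alpha>))"


subsection \<open>Smooth functions\<close>

text \<open>Mixed partial derivatives are indexed by the list of the coordinate directions in which
  one differentiates; on smooth functions the order of the directions is irrelevant.\<close>

fun partials :: "'a::euclidean_space list \<Rightarrow> ('a \<Rightarrow> complex) \<Rightarrow> 'a \<Rightarrow> complex" where
  "partials [] f = f"
| "partials (b # bs) f = (\<lambda>x. frechet_derivative (partials bs f) (at x) b)"

definition directions :: "nat \<Rightarrow> 'a::euclidean_space list set" where
  "directions m = {bs. set bs \<subseteq> Basis \<and> length bs \<le> m}"

definition smooth :: "('a::euclidean_space \<Rightarrow> complex) \<Rightarrow> bool" where
  "smooth f \<longleftrightarrow> (\<forall>bs. set bs \<subseteq> Basis \<longrightarrow> (\<forall>x. partials bs f differentiable at x))"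

definition laplacian :: "('a::euclidean_space \<Rightarrow> complex) \<Rightarrow> 'a \<Rightarrow> complex" where
  "laplacian f = (\<lambda>x. \<Sum>b\<in>Basis. partials [b, b] f x)"

definition test_functions :: "('a::euclidean_space \<Rightarrow> complex) set" where
  "test_functions = {\<phi>. smooth \<phi> \<and> compact (closure {x. \<phi> x \<noteq> 0})}"


subsection \<open>Tempered distributions and the Fourier transform\<close>

definition schwartz :: "('a::euclidean_space \<Rightarrow> complex) set" where
  "schwartz = {\<phi>. smooth \<phi> \<and>
     (\<forall>k bs. set bs \<subseteq> Basis \<longrightarrow> bdd_above (range (\<lambda>x. norm x ^ k * norm (partials bs \<phi> x))))}"

definition schwartz_seminorm ::
    "nat \<Rightarrow> 'a::euclidean_space list \<Rightarrow> ('a \<Rightarrow> complex) \<Rightarrow> real" where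
  "schwartz_seminorm k bs \<phi> = (SUP x. norm x ^ k * norm (partials bs \<phi> x))"

definition linear_functional_on ::
    "('a \<Rightarrow> complex) set \<Rightarrow> (('a \<Rightarrow> complex) \<Rightarrow> complex) \<Rightarrow> bool" where
  "linear_functional_on V U \<longleftrightarrow>
     (\<forall>\<phi>\<in>V. \<forall>\<psi>\<in>V. U (\<lambda>x. \<phi> x + \<psi> x) = U \<phi> + U \<psi>) \<and>
     (\<forall>c. \<forall>\<phi>\<in>V. U (\<lambda>x. c * \<phi> x) = c * U \<phi>)"

text \<open>Functionals on the Schwartz space are taken to be extensional (\<open>undefined\<close> off the space),
  so that equality of tempered distributions is equality in HOL.  The second condition is
  continuity for the topology generated by the Schwartz seminorms.\<close>

definition tempered_distributions :: "(('a::euclidean_space \<Rightarrow> complex) \<Rightarrow> complex) set" where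
  "tempered_distributions = {U \<in> extensional schwartz. linear_functional_on schwartz U \<and>
     (\<exists>C n. \<forall>\<phi>\<in>schwartz.
        norm (U \<phi>) \<le> C * (\<Sum>k\<le>n. \<Sum>bs\<in>directions n. schwartz_seminorm k bs \<phi>))}"

definition distribution_of ::
    "('a::euclidean_space \<Rightarrow> complex) \<Rightarrow> ('a \<Rightarrow> complex) \<Rightarrow> complex" where
  "distribution_of f = restrict (\<lambda>\<phi>. LINT x|lebesgue. f x * \<phi> x) schwartz"

definition fourier :: "('a::euclidean_space \<Rightarrow> complex) \<Rightarrow> 'a \<Rightarrow> complex" where
  "fourier \<phi> \<xi> = (LINT x|lebesgue. \<phi> x * exp (- 2 * of_real pi * \<i> * of_real (x \<bullet> \<xi>)))"

definition fourier_distribution ::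
    "(('a::euclidean_space \<Rightarrow> complex) \<Rightarrow> complex) \<Rightarrow> ('a \<Rightarrow> complex) \<Rightarrow> complex" where
  "fourier_distribution U = restrict (\<lambda>\<phi>. U (fourier \<phi>)) schwartz"

definition inverse_fourier_distribution ::
    "(('a::euclidean_space \<Rightarrow> complex) \<Rightarrow> complex) \<Rightarrow> ('a \<Rightarrow> complex) \<Rightarrow> complex" where
  "inverse_fourier_distribution = the_inv_into tempered_distributions fourier_distribution"


subsection \<open>Sobolev spaces\<close>

definition square_integrable :: "('a::euclidean_space \<Rightarrow> complex) \<Rightarrow> bool" where
  "square_integrable f \<longleftrightarrow>
     f \<in> borel_measurable lebesgue \<and> integrable lebesgue (\<lambda>x. (norm (f x))\<^sup>2)"

definition L2_norm :: "('a::euclidean_space \<Rightarrow> complex) \<Rightarrow> real" where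
  "L2_norm f = sqrt (LINT x|lebesgue. (norm (f x))\<^sup>2)"

definition has_weak_partials ::
    "'a::euclidean_space list \<Rightarrow> ('a \<Rightarrow> complex) \<Rightarrow> ('a \<Rightarrow> complex) \<Rightarrow> bool" where
  "has_weak_partials bs f g \<longleftrightarrow> (\<forall>\<psi>\<in>test_functions.
     (LINT x|lebesgue. f x * partials bs \<psi> x) = (-1) ^ length bs * (LINT x|lebesgue. g x * \<psi> x))"

text \<open>Elements of the Sobolev space are represented by functions, not by classes modulo null sets.
  The weak derivative selected below is unique only up to a null set, which does not affect its
  \<open>L2_norm\<close>; \<open>sobolev_norm m f = 0\<close> holds iff \<open>f\<close> vanishes almost everywhere.\<close>

definition sobolev :: "nat \<Rightarrow> ('a::euclidean_space \<Rightarrow> complex) set" where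
  "sobolev m = {f. square_integrable f \<and>
     (\<forall>bs\<in>directions m. \<exists>g. square_integrable g \<and> has_weak_partials bs f g)}"

definition weak_partials :: "'a::euclidean_space list \<Rightarrow> ('a \<Rightarrow> complex) \<Rightarrow> 'a \<Rightarrow> complex" where
  "weak_partials bs f = (SOME g. square_integrable g \<and> has_weak_partials bs f g)"

text \<open>The sum runs over all lists of directions, i.e. the squared norm is the sum over \<open>k \<le> m\<close> of the
  squared \<open>L2\<close> norms of the full tensors of \<open>k\<close>-th derivatives.\<close>

definition sobolev_norm :: "nat \<Rightarrow> ('a::euclidean_space \<Rightarrow> complex) \<Rightarrow> real" where
  "sobolev_norm m f = sqrt (\<Sum>bs\<in>directions m. (L2_norm (weak_partials bs f))\<^sup>2)"

definition sobolev_dual :: "nat \<Rightarrow> (('a::euclidean_space \<Rightarrow> complex) \<Rightarrow> complex) set" where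
  "sobolev_dual m = {v. linear_functional_on (sobolev m) v \<and>
     (\<exists>C. \<forall>\<phi>\<in>sobolev m. norm (v \<phi>) \<le> C * sobolev_norm m \<phi>)}"

definition sobolev_dual_norm ::
    "nat \<Rightarrow> (('a::euclidean_space \<Rightarrow> complex) \<Rightarrow> complex) \<Rightarrow> real" where
  "sobolev_dual_norm m v =
     (SUP \<phi>\<in>{\<phi> \<in> sobolev m. sobolev_norm m \<phi> \<noteq> 0}. norm (v \<phi>) / sobolev_norm m \<phi>)"

definition weighted_Linf ::
    "real \<Rightarrow> real \<Rightarrow> nat \<Rightarrow> (real \<Rightarrow> ('a::euclidean_space \<Rightarrow> complex) \<Rightarrow> complex) set" where
  "weighted_Linf \<alpha> T m = {v. (\<forall>t\<in>{0..T}. v t \<in> sobolev_dual m) \<and>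
     bdd_above ((\<lambda>t. t powr \<alpha> * sobolev_dual_norm m (v t)) ` {0..T})}"


subsection \<open>The fractional diffusion problem with initial datum the Dirac delta\<close>

text \<open>Integrability is required explicitly because the Bochner integral of a non-integrable
  function is \<open>0\<close> in HOL.\<close>

definition distributional_solution ::
    "real \<Rightarrow> real \<Rightarrow> real \<Rightarrow> real \<Rightarrow> nat \<Rightarrow>
      (real \<Rightarrow> ('a::euclidean_space \<Rightarrow> complex) \<Rightarrow> complex) \<Rightarrow> bool" where
  "distributional_solution \<alpha> d a T m u \<longleftrightarrow> u \<in> weighted_Linf \<alpha> T m \<and>
     (\<forall>\<phi>\<in>test_functions. \<forall>t\<in>{0..T}.
        (let g = (\<lambda>\<tau>. (of_real d * u \<tau> (laplacian \<phi>) + of_real a * u \<tau> \<phi>)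
                        / of_real ((t - \<tau>) powr (1 - \<alpha>)))
         in set_integrable lebesgue {0..t} g \<and>
            u t \<phi> = \<phi> 0 + of_real (1 / Gamma \<alpha>) * (LINT \<tau>:{0..t}|lebesgue. g \<tau>)))"

end

theory Submission
  imports Defs "HOL-Probability.Probability" "HOL-Computational_Algebra.Polynomial"
begin

text \<open>
  On the Fourier side the problem decouples: for each frequency \<open>\<xi>\<close> it is the scalar equation
  \<open>y = 1 + \<Lambda>(\<xi>) I\<^sup>\<alpha> y\<close>, where \<open>\<Lambda>(\<xi>) = a - 4 \<pi>\<^sup>2 d |\<xi>|\<^sup>2\<close> and \<open>I\<^sup>\<alpha>\<close> is the fractional
  integral of order \<open>\<alpha>\<close>.  Its solution is \<open>E\<^sub>\<alpha>(\<Lambda>(\<xi>) t\<^sup>\<alpha>)\<close>, because \<open>I\<^sup>\<alpha>\<close> acts on each power of the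
  Mittag-Leffler series by an Euler Beta integral (\<open>fractional_integral_mittag_leffler2\<close>,
  \<open>mittag_leffler_volterra\<close>).  On a Schwartz function the solution is
  \<open>u(t) \<phi> = \<integral> E\<^sub>\<alpha>(\<Lambda>(\<xi>) t\<^sup>\<alpha>) (F \<phi>)(\<xi>) d\<xi>\<close>, and the distributional equation is the superposition of
  the scalar ones with weight \<open>F \<phi>\<close> (\<open>volterra_superposition\<close>).  Four things make this rigorous.

  The multiplier \<open>\<xi> \<mapsto> E\<^sub>\<alpha>(\<Lambda>(\<xi>) t\<^sup>\<alpha>)\<close> is bounded, uniformly for \<open>t\<close> in \<open>[0, T]\<close>.  Its argument is
  bounded above, so the point is that \<open>E\<^sub>\<alpha>\<close> is bounded on the negative half-line.  The function
  \<open>y(\<tau>) = E\<^sub>\<alpha>(-\<tau>\<^sup>\<alpha>)\<close> has Caputo derivative \<open>-y\<close>, and a Caputo derivative is nonnegative at a maximum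
  (\<open>caputo_nonneg_at_maximum\<close>), so \<open>|y|\<close> never exceeds \<open>y(0) = 1\<close>
  (\<open>mittag_leffler_nonpos_bound\<close>).

  The Fourier transform maps the Schwartz space onto itself (\<open>fourier_in_schwartz\<close>,
  \<open>fourier_inversion_schwartz\<close>).  It is therefore injective on tempered distributions, and the
  functional above is the inverse transform of the multiplier, which is even in \<open>\<xi>\<close>
  (\<open>inverse_fourier_distribution_even_multiplier\<close>).

  The functional extends to \<open>H\<^sup>m\<close>.  Put \<open>P = \<Sum> |symbol bs|\<^sup>2\<close>, summed over the derivatives of order
  at most \<open>m\<close>.  A multiplier bounded by \<open>M\<close> is \<open>E = \<Sum> w\<^sub>b\<^sub>s symbol bs\<close> with
  \<open>|w\<^sub>b\<^sub>s|\<^sup>2 \<le> M\<^sup>2 / P\<close>, and \<open>1 / P\<close> is integrable precisely when \<open>m > N / 2\<close>.  So \<open>E\<close> pairs the weak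
  derivatives of \<open>\<phi>\<close> with the transforms of square integrable functions (\<open>fourier_pairing\<close>).  The
  transform contracts the \<open>L\<^sup>2\<close> norm (\<open>fourier_bessel_inequality\<close>), and so the functional is bounded
  by the Sobolev norm with a constant that depends on \<open>E\<close> through \<open>M\<close> alone
  (\<open>multiplier_functional_bound\<close>).

  Weak derivatives are determined almost everywhere
  (\<open>fundamental_lemma_calculus_of_variations\<close>).  This makes the extended functional linear although
  the weak derivatives are arbitrarily chosen representatives, and it identifies them with the
  classical derivatives of a Schwartz function.
\<close>

section \<open>The Mittag-Leffler function\<close>

lemma Gamma_plus1_pos: "x > 0 \<Longrightarrow> Gamma (x + 1) = x * Gamma (x::real)"
  by (intro Gamma_plus1) (auto elim!: nonpos_Ints_cases)

text \<open>Gautschi's inequality.  The point \<open>x\<close> is the convex combination of \<open>x + \<alpha>\<close> and \<open>x + \<alpha> - 1\<close> with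
  weights \<open>1 - \<alpha>\<close> and \<open>\<alpha>\<close>, and the Gamma function is log-convex.  It controls the quotients of
  consecutive Mittag-Leffler coefficients.\<close>

lemma Gamma_shift_bound:
  fixes \<alpha> x :: real
  assumes "0 < \<alpha>" "\<alpha> < 1" "x + \<alpha> > 1"
  shows "Gamma x * (x + \<alpha> - 1) powr \<alpha> \<le> Gamma (x + \<alpha>)"
proof -
  have pos: "Gamma (x + \<alpha> - 1) > 0" "Gamma (x + \<alpha>) > 0" "Gamma x > 0"
    using assms by (auto intro!: Gamma_real_pos)
  have step: "Gamma (x + \<alpha>) = (x + \<alpha> - 1) * Gamma (x + \<alpha> - 1)"
    using Gamma_plus1_pos[of "x + \<alpha> - 1"] assms(3) by (simp only: diff_add_cancel diff_gt_0_iff_gt)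
  have "(ln \<circ> Gamma) ((1 - \<alpha>) *\<^sub>R (x + \<alpha>) + \<alpha> *\<^sub>R (x + \<alpha> - 1))
      \<le> (1 - \<alpha>) * (ln \<circ> Gamma) (x + \<alpha>) + \<alpha> * (ln \<circ> Gamma) (x + \<alpha> - 1)"
    by (rule convex_onD[OF log_convex_Gamma_real]) (use assms in auto)
  moreover have "(1 - \<alpha>) *\<^sub>R (x + \<alpha>) + \<alpha> *\<^sub>R (x + \<alpha> - 1) = x"
    by (simp add: algebra_simps)
  moreover have "ln (Gamma (x + \<alpha>)) = ln (x + \<alpha> - 1) + ln (Gamma (x + \<alpha> - 1))"
    unfolding step using pos(1) assms(3) by (intro ln_mult_pos) auto
  ultimately have "ln (Gamma x) + \<alpha> * ln (x + \<alpha> - 1) \<le> ln (Gamma (x + \<alpha>))"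
    by (simp add: algebra_simps)
  then have "exp (ln (Gamma x) + \<alpha> * ln (x + \<alpha> - 1)) \<le> exp (ln (Gamma (x + \<alpha>)))"
    by simp
  then show ?thesis
    using pos assms by (simp add: exp_add powr_def)
qed

text \<open>The two-parameter Mittag-Leffler function.  Fractional integration shifts the second
  parameter, and \<open>E\<^sub>\<alpha>' = E\<^sub>\<alpha>\<^sub>,\<^sub>\<alpha> / \<alpha>\<close>.\<close>

definition mittag_leffler2 :: "real \<Rightarrow> real \<Rightarrow> real \<Rightarrow> real" where
  "mittag_leffler2 \<alpha> p r = (\<Sum>k. r ^ k / Gamma (real k * \<alpha> + p))"

lemma mittag_leffler_eq: "mittag_leffler \<alpha> = mittag_leffler2 \<alpha> 1"
  by (simp add: fun_eq_iff mittag_leffler_def mittag_leffler2_def add.commute)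

lemma mittag_leffler_0: "mittag_leffler \<alpha> 0 = 1"
proof -
  have "(\<Sum>k. 0 ^ k / Gamma (1 + real k * \<alpha>)) = (\<Sum>k\<in>{0}. 0 ^ k / Gamma (1 + real k * \<alpha>))"
    by (rule suminf_finite) auto
  then show ?thesis
    unfolding mittag_leffler_def by simp
qed

lemma summable_mittag_leffler2:
  fixes \<alpha> p r :: real
  assumes "0 < \<alpha>" "\<alpha> < 1" "p > 0"
  shows "summable (\<lambda>k. norm (r ^ k / Gamma (real k * \<alpha> + p)))"
proof -
  define a where "a k = norm (r ^ k / Gamma (real k * \<alpha> + p))" for k
  have pos: "Gamma (real k * \<alpha> + p) > 0" for k
    using assms by (intro Gamma_real_pos add_nonneg_pos) auto
  have "filterlim (\<lambda>k. (real k * \<alpha> + p + \<alpha> - 1) powr \<alpha>) at_top sequentially"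
    using assms by real_asymp
  then have "eventually (\<lambda>k. 2 * \<bar>r\<bar> \<le> (real k * \<alpha> + p + \<alpha> - 1) powr \<alpha>) sequentially"
    by (simp add: filterlim_at_top)
  moreover have "filterlim (\<lambda>k. real k * \<alpha> + p + \<alpha>) at_top sequentially"
    using assms by real_asymp
  then have "eventually (\<lambda>k. real k * \<alpha> + p + \<alpha> > 1) sequentially"
    by (simp add: filterlim_at_top_dense)
  ultimately have "eventually (\<lambda>k. norm (a (Suc k)) \<le> 1/2 * norm (a k)) sequentially"
  proof eventually_elim
    case (elim k)
    have "2 * \<bar>r\<bar> * Gamma (real k * \<alpha> + p) \<le> Gamma (real k * \<alpha> + p) * (real k * \<alpha> + p + \<alpha> - 1) powr \<alpha>"
      using elim(1) pos[of k] by (simp add: mult.commute)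
    also have "\<dots> \<le> Gamma (real k * \<alpha> + p + \<alpha>)"
      by (rule Gamma_shift_bound) (use assms elim in auto)
    finally have *: "2 * \<bar>r\<bar> * Gamma (real k * \<alpha> + p) \<le> Gamma (real (Suc k) * \<alpha> + p)"
      by (simp add: algebra_simps)
    have "\<bar>r\<bar> ^ k * (2 * \<bar>r\<bar> * Gamma (real k * \<alpha> + p)) \<le> \<bar>r\<bar> ^ k * Gamma (real (Suc k) * \<alpha> + p)"
      by (rule mult_left_mono[OF *]) auto
    then show ?case
      using pos[of k] pos[of "Suc k"]
      by (simp add: a_def abs_mult power_abs field_simps)
  qed
  then obtain n where "\<And>k. k \<ge> n \<Longrightarrow> norm (a (Suc k)) \<le> 1/2 * norm (a k)"
    by (auto simp: eventually_sequentially)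
  then show ?thesis
    unfolding a_def[symmetric] by (intro summable_ratio_test[of "1/2" n]) auto
qed

lemma mittag_leffler2_sums:
  fixes \<alpha> p r :: real
  assumes "0 < \<alpha>" "\<alpha> < 1" "p > 0"
  shows "(\<lambda>k. r ^ k / Gamma (real k * \<alpha> + p)) sums mittag_leffler2 \<alpha> p r"
  unfolding mittag_leffler2_def
  using summable_norm_cancel[OF summable_mittag_leffler2[OF assms, of r]] by (rule summable_sums)

lemma mittag_leffler_has_derivative:
  assumes "0 < \<alpha>" "\<alpha> < 1"
  shows "(mittag_leffler \<alpha> has_field_derivative mittag_leffler2 \<alpha> \<alpha> r / \<alpha>) (at r)"
proof -
  define c where "c k = 1 / Gamma (real k * \<alpha> + 1)" for k
  have c: "diffs c k = 1 / Gamma (real k * \<alpha> + \<alpha>) / \<alpha>" for k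
  proof -
    have "Gamma (real (Suc k) * \<alpha> + 1) = real (Suc k) * \<alpha> * Gamma (real (Suc k) * \<alpha>)"
      using assms by (intro Gamma_plus1_pos) auto
    then have "diffs c k = 1 / Gamma (real (Suc k) * \<alpha>) / \<alpha>"
      unfolding diffs_def c_def by (simp del: of_nat_Suc)
    then show ?thesis by (simp add: algebra_simps)
  qed
  have "summable (\<lambda>k. c k * x ^ k)" for x
    using summable_norm_cancel[OF summable_mittag_leffler2[OF assms, of 1 x]] by (simp add: c_def)
  then have "((\<lambda>x. \<Sum>k. c k * x ^ k) has_field_derivative (\<Sum>k. diffs c k * r ^ k)) (at r)"
    by (intro termdiffs_strong_converges_everywhere)
  moreover have "(\<lambda>x. \<Sum>k. c k * x ^ k) = mittag_leffler \<alpha>"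
    by (auto simp: mittag_leffler_def c_def fun_eq_iff add.commute)
  moreover have "(\<lambda>k. diffs c k * r ^ k) sums (mittag_leffler2 \<alpha> \<alpha> r / \<alpha>)"
    using sums_divide[OF mittag_leffler2_sums[of \<alpha> \<alpha> r], of \<alpha>] assms by (simp add: c)
  ultimately show ?thesis by (simp add: sums_iff)
qed

lemma continuous_mittag_leffler:
  assumes "0 < \<alpha>" "\<alpha> < 1"
  shows "continuous_on A (mittag_leffler \<alpha>)"
  by (meson DERIV_isCont assms continuous_at_imp_continuous_on mittag_leffler_has_derivative)

lemma Beta_interval:
  fixes a b t :: real
  assumes "a > 0" "b > 0" "t > 0"
  shows "has_bochner_integral lborel
    (\<lambda>\<tau>. indicator {0..t} \<tau> * (\<tau> powr (a - 1) * (t - \<tau>) powr (b - 1)))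
    (t powr (a + b - 1) * (Gamma a * Gamma b / Gamma (a + b)))"
proof -
  let ?f = "\<lambda>s. indicator {0..1} s * (s powr (a - 1) * (1 - s) powr (b - 1)) :: real"
  have "integrable lborel ?f"
    using integrable_Beta[OF assms(1,2)] by (simp add: set_integrable_def)
  moreover have "integral\<^sup>L lborel ?f = Beta a b"
    using set_borel_integral_eq_integral(2)[OF integrable_Beta[OF assms(1,2)]]
      integral_unique[OF has_integral_Beta_real[OF assms(1,2)]]
    by (simp add: set_lebesgue_integral_def)
  ultimately have "has_bochner_integral lborel ?f (Beta a b)"
    by (simp add: has_bochner_integral_iff)
  then have "has_bochner_integral lborel (\<lambda>x. ?f (x / t)) (Beta a b * t)"
    using assms by (subst (asm) lborel_has_bochner_integral_real_affine_iff[of "1/t" _ _ 0])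
      (auto simp: mult.commute)
  then have "has_bochner_integral lborel (\<lambda>x. t powr (a + b - 2) * ?f (x / t))
      (t powr (a + b - 2) * (Beta a b * t))"
    by (rule has_bochner_integral_mult_right)
  moreover have "t powr (a + b - 2) * ?f (x / t)
      = indicator {0..t} x * (x powr (a - 1) * (t - x) powr (b - 1))" for x
  proof (cases "x \<in> {0..t}")
    case True
    have "x powr (a - 1) = t powr (a - 1) * (x / t) powr (a - 1)"
      using True assms by (simp add: powr_divide)
    moreover have "(t - x) powr (b - 1) = t powr (b - 1) * (1 - x / t) powr (b - 1)"
      using True assms powr_mult[of t "1 - x / t" "b - 1"] by (simp add: right_diff_distrib)
    moreover have "t powr (a + b - 2) = t powr (a - 1) * t powr (b - 1)"
      by (simp add: powr_add[symmetric])
    ultimately show ?thesis using True assms by (simp add: indicator_def field_simps)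
  qed (use assms in \<open>auto simp: indicator_def field_simps\<close>)
  moreover have "t powr (a + b - 2) * (Beta a b * t)
      = t powr (a + b - 1) * (Gamma a * Gamma b / Gamma (a + b))"
    using assms powr_add[of t "a + b - 2" 1] by (simp add: Beta_def)
  ultimately show ?thesis by simp
qed

text \<open>Fractional integration of order \<open>q\<close> raises the second parameter by \<open>q\<close>: every power of \<open>\<tau>\<close> gives
  a Beta integral.  The integrals of the absolute values again form a convergent Mittag-Leffler
  series, so sum and integral can be exchanged.  The choice \<open>p = \<alpha>\<close>, \<open>q = 1 - \<alpha>\<close> computes the Caputo
  derivative of \<open>\<tau> \<mapsto> E\<^sub>\<alpha>(c \<tau>\<^sup>\<alpha>)\<close>, and \<open>p = 1\<close>, \<open>q = \<alpha>\<close> its integral equation.\<close>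

theorem fractional_integral_mittag_leffler2:
  fixes \<alpha> p q c t :: real
  assumes "0 < \<alpha>" "\<alpha> < 1" "p > 0" "q > 0" "t > 0"
  defines "g \<equiv> \<lambda>\<tau>. \<tau> powr (p - 1) * mittag_leffler2 \<alpha> p (c * \<tau> powr \<alpha>) * (t - \<tau>) powr (q - 1)"
  shows "has_bochner_integral lborel (\<lambda>\<tau>. indicator {0..t} \<tau> * g \<tau>)
      (Gamma q * t powr (p + q - 1) * mittag_leffler2 \<alpha> (p + q) (c * t powr \<alpha>))"
proof -
  define f where "f k \<tau> = (c ^ k / Gamma (real k * \<alpha> + p)) *
      (indicator {0..t} \<tau> * (\<tau> powr (real k * \<alpha> + p - 1) * (t - \<tau>) powr (q - 1)))" for k \<tau>
  define J where "J c k = Gamma q * t powr (p + q - 1) *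
      ((c * t powr \<alpha>) ^ k / Gamma (real k * \<alpha> + (p + q)))" for c :: real and k
  have pos: "Gamma (real k * \<alpha> + p) > 0" for k
    using assms by (intro Gamma_real_pos add_nonneg_pos) auto
  have tpow: "t powr (real k * \<alpha> + (p + q) - 1) = t powr (p + q - 1) * (t powr \<alpha>) ^ k" for k
    using assms by (simp add: powr_add[symmetric] powr_power algebra_simps)
  have f: "has_bochner_integral lborel (f k) (J c k)"
    and nf: "has_bochner_integral lborel (\<lambda>\<tau>. norm (f k \<tau>)) (J \<bar>c\<bar> k)" for k
  proof -
    have B: "has_bochner_integral lborel (\<lambda>\<tau>. (b ^ k / Gamma (real k * \<alpha> + p)) *
      (indicator {0..t} \<tau> * (\<tau> powr (real k * \<alpha> + p - 1) * (t - \<tau>) powr (q - 1)))) (J b k)" for b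
    proof -
      have "real k * \<alpha> + p > 0" using assms by (simp add: add_nonneg_pos)
      from has_bochner_integral_mult_right[OF Beta_interval[OF this \<open>q > 0\<close> \<open>t > 0\<close>],
          of "b ^ k / Gamma (real k * \<alpha> + p)"]
      moreover have "(b ^ k / Gamma (real k * \<alpha> + p)) * (t powr (real k * \<alpha> + p + q - 1) *
          (Gamma (real k * \<alpha> + p) * Gamma q / Gamma (real k * \<alpha> + p + q))) = J b k"
        unfolding add.assoc tpow J_def power_mult_distrib using pos[of k] by simp
      ultimately show ?thesis by simp
    qed
    show "has_bochner_integral lborel (f k) (J c k)"
      using B[of c] by (simp add: f_def[abs_def])
    show "has_bochner_integral lborel (\<lambda>\<tau>. norm (f k \<tau>)) (J \<bar>c\<bar> k)"
      using B[of "\<bar>c\<bar>"] pos[of k] by (simp add: f_def abs_mult power_abs)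
  qed
  have sums: "(\<lambda>k. f k \<tau>) sums (indicator {0..t} \<tau> * g \<tau>)" for \<tau>
  proof (cases "0 < \<tau> \<and> \<tau> \<le> t")
    case True
    have "\<tau> powr (real k * \<alpha> + p - 1) = \<tau> powr (p - 1) * (\<tau> powr \<alpha>) ^ k" for k
      using True by (simp add: powr_add[symmetric] powr_power algebra_simps)
    then have "f k \<tau> = \<tau> powr (p - 1) * (t - \<tau>) powr (q - 1) *
        ((c * \<tau> powr \<alpha>) ^ k / Gamma (real k * \<alpha> + p))" for k
      using True by (simp add: f_def power_mult_distrib)
    then show ?thesis
      using sums_mult[OF mittag_leffler2_sums[OF assms(1-3), of "c * \<tau> powr \<alpha>"],
          of "\<tau> powr (p - 1) * (t - \<tau>) powr (q - 1)"] True
      by (simp add: g_def mult_ac)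
  next
    case False
    then have "\<tau> = 0 \<or> \<tau> \<notin> {0..t}" by auto
    then show ?thesis by (auto simp: f_def g_def)
  qed
  have abs_sum: "summable (\<lambda>k. norm (f k \<tau>))" for \<tau>
  proof (cases "0 < \<tau> \<and> \<tau> \<le> t")
    case True
    have "\<tau> powr (real k * \<alpha> + p - 1) = \<tau> powr (p - 1) * (\<tau> powr \<alpha>) ^ k" for k
      using True by (simp add: powr_add[symmetric] powr_power algebra_simps)
    then have "norm (f k \<tau>) = \<tau> powr (p - 1) * (t - \<tau>) powr (q - 1) *
        norm ((c * \<tau> powr \<alpha>) ^ k / Gamma (real k * \<alpha> + p))" for k
      using True by (simp add: f_def power_mult_distrib abs_mult power_abs)
    then show ?thesis
      by (simp only:) (intro summable_mult summable_mittag_leffler2 assms)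
  next
    case False
    then have "\<tau> = 0 \<or> \<tau> \<notin> {0..t}" by auto
    then show ?thesis by (auto simp: f_def g_def)
  qed
  have sumJ: "summable (\<lambda>k. integral\<^sup>L lborel (\<lambda>\<tau>. norm (f k \<tau>)))"
    unfolding has_bochner_integral_integral_eq[OF nf] J_def
    using summable_norm_cancel[OF summable_mittag_leffler2[of \<alpha> "p + q"]] assms
    by (intro summable_mult) auto
  have int: "integrable lborel (f k)" for k
    using f[of k] by (rule integrable.intros)
  have eq: "(\<lambda>\<tau>. \<Sum>k. f k \<tau>) = (\<lambda>\<tau>. indicator {0..t} \<tau> * g \<tau>)"
    using sums by (auto simp: sums_iff)
  have i: "integrable lborel (\<lambda>\<tau>. indicator {0..t} \<tau> * g \<tau>)"
    using integrable_suminf[OF int _ sumJ] abs_sum by (simp add: eq)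
  have s: "(\<lambda>k. integral\<^sup>L lborel (f k)) sums (integral\<^sup>L lborel (\<lambda>\<tau>. indicator {0..t} \<tau> * g \<tau>))"
    using sums_integral[OF int _ sumJ] abs_sum by (simp add: eq)
  have "J c sums (Gamma q * t powr (p + q - 1) * mittag_leffler2 \<alpha> (p + q) (c * t powr \<alpha>))"
    unfolding J_def using assms by (intro sums_mult mittag_leffler2_sums) auto
  with s show ?thesis
    using i unfolding has_bochner_integral_iff has_bochner_integral_integral_eq[OF f]
    by (simp add: sums_iff)
qed

text \<open>The extremum principle for the Caputo derivative.  On \<open>[0, b]\<close> with \<open>b < t\<close> the kernel
  \<open>(t - \<tau>)\<^sup>-\<^sup>\<alpha>\<close> is increasing, so by the second mean value theorem the integral equals
  \<open>(y b - y c) (t - b)\<^sup>-\<^sup>\<alpha>\<close> for some \<open>c\<close>, which is at least \<open>(y b - y t) (t - b)\<^sup>-\<^sup>\<alpha>\<close>.  As \<open>y\<close> is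
  differentiable at \<open>t\<close> and \<open>\<alpha> < 1\<close>, this lower bound tends to \<open>0\<close> for \<open>b \<rightarrow> t\<close>.\<close>

lemma caputo_nonneg_at_maximum:
  fixes y y' :: "real \<Rightarrow> real"
  assumes \<alpha>: "0 < \<alpha>" "\<alpha> < 1" and t: "t > 0"
    and cont: "continuous_on {0..t} y"
    and deriv: "\<And>\<tau>. 0 < \<tau> \<Longrightarrow> \<tau> \<le> t \<Longrightarrow> (y has_field_derivative y' \<tau>) (at \<tau>)"
    and int: "((\<lambda>\<tau>. y' \<tau> * (t - \<tau>) powr (- \<alpha>)) has_integral I) {0..t}"
    and max: "\<And>\<tau>. 0 \<le> \<tau> \<Longrightarrow> \<tau> \<le> t \<Longrightarrow> y \<tau> \<le> y t"
  shows "0 \<le> I"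
proof -
  let ?f = "\<lambda>\<tau>. y' \<tau> * (t - \<tau>) powr (- \<alpha>)"
  have lower: "(y b - y t) * (t - b) powr (- \<alpha>) \<le> integral {0..b} ?f" if b: "0 < b" "b < t" for b
  proof -
    have "(y' has_integral (y v - y u)) {u..v}" if "0 \<le> u" "u \<le> v" "v \<le> b" for u v
    proof (rule fundamental_theorem_of_calculus_interior)
      show "continuous_on {u..v} y"
        by (rule continuous_on_subset[OF cont]) (use that b in auto)
      show "(y has_vector_derivative y' x) (at x)" if "x \<in> {u<..<v}" for x
        using deriv[of x] that \<open>0 \<le> u\<close> \<open>v \<le> b\<close> b
        by (simp add: has_real_derivative_iff_has_vector_derivative)
    qed (use that in auto)
    note ftc = this
    \<comment> \<open>Setting the kernel to 0 at the left endpoint keeps it monotone and removes the boundary term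
      there from the mean value formula.\<close>
    define g where "g \<tau> = (if \<tau> \<le> 0 then 0 else (t - \<tau>) powr (- \<alpha>))" for \<tau>
    obtain c where c: "c \<in> {0..b}" and
      eq: "integral {0..b} (\<lambda>x. g x * y' x) = g 0 * integral {0..c} y' + g b * integral {c..b} y'"
    proof (rule second_mean_value_theorem[of y' 0 b g])
      show "y' integrable_on {0..b}" using ftc[of 0 b] b by (auto simp: integrable_on_def)
      show "g x \<le> g z" if "0 \<le> x" "x \<le> z" "z \<le> b" for x z
        using that b \<alpha> by (auto simp: g_def intro!: powr_mono2')
    qed (use b in auto)
    have "integral {0..b} ?f = integral {0..b} (\<lambda>x. g x * y' x)"
      by (rule integral_spike[of "{0}"]) (auto simp: g_def)
    also have "\<dots> = (y b - y c) * (t - b) powr (- \<alpha>)"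
      using eq c b integral_unique[OF ftc[of c b]] by (simp add: g_def)
    also have "\<dots> \<ge> (y b - y t) * (t - b) powr (- \<alpha>)"
      using max[of c] c b by (intro mult_right_mono) auto
    finally show ?thesis .
  qed
  have lim1: "((\<lambda>b. integral {0..b} ?f) \<longlongrightarrow> I) (at_left t)"
  proof -
    have "continuous_on {0..t} (\<lambda>b. integral {0..b} ?f)"
      using int by (intro indefinite_integral_continuous_1) (auto simp: integrable_on_def)
    then have "((\<lambda>b. integral {0..b} ?f) \<longlongrightarrow> integral {0..t} ?f) (at t within {0..t})"
      using t by (auto simp: continuous_on_def)
    moreover have "at t within {0..t} = at_left t"
      using t at_within_Icc_at_left[of 0 t] by simp
    ultimately show ?thesis using integral_unique[OF int] by simp
  qed
  have lim2: "((\<lambda>b. (y b - y t) * (t - b) powr (- \<alpha>)) \<longlongrightarrow> 0) (at_left t)"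
  proof -
    have "((\<lambda>b. (y b - y t) / (b - t)) \<longlongrightarrow> y' t) (at_left t)"
      using deriv[of t] t unfolding has_field_derivative_iff
      by (auto intro: tendsto_mono[OF at_le])
    moreover have "((\<lambda>b. - ((t - b) powr (1 - \<alpha>))) \<longlongrightarrow> 0) (at_left t)"
      using \<alpha> by real_asymp
    ultimately have "((\<lambda>b. (y b - y t) / (b - t) * (- ((t - b) powr (1 - \<alpha>)))) \<longlongrightarrow> y' t * 0) (at_left t)"
      by (rule tendsto_mult)
    moreover have "eventually (\<lambda>b. (y b - y t) / (b - t) * (- ((t - b) powr (1 - \<alpha>)))
        = (y b - y t) * (t - b) powr (- \<alpha>)) (at_left t)"
    proof (rule eventually_at_leftI[of "t - 1"])
      fix b assume "b \<in> {t - 1<..<t}"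
      then have "(t - b) powr (1 - \<alpha>) = (t - b) * (t - b) powr (- \<alpha>)"
        using powr_add[of "t - b" 1 "- \<alpha>"] by simp
      with \<open>b \<in> _\<close> show "(y b - y t) / (b - t) * (- ((t - b) powr (1 - \<alpha>)))
        = (y b - y t) * (t - b) powr (- \<alpha>)"
        by (simp only: minus_diff_eq[symmetric, of t b]) (simp del: minus_diff_eq)
    qed simp
    ultimately show ?thesis by (simp add: filterlim_cong)
  qed
  show ?thesis
  proof (rule tendsto_le[OF _ lim1 lim2])
    show "eventually (\<lambda>b. (y b - y t) * (t - b) powr (- \<alpha>) \<le> integral {0..b} ?f) (at_left t)"
      using lower t by (intro eventually_at_leftI[of 0]) auto
  qed simp
qed

text \<open>The function \<open>y(\<tau>) = E\<^sub>\<alpha>(-\<tau>\<^sup>\<alpha>)\<close> has Caputo derivative \<open>-y\<close> and starts at \<open>1\<close>.  If \<open>|y|\<close> exceeded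
  \<open>1\<close>, it would have a maximum \<open>|y(t\<^sub>0)| > 1\<close> on some interval at a point \<open>t\<^sub>0 > 0\<close>, where the extremum
  principle for \<open>sgn(y(t\<^sub>0)) y\<close> yields \<open>-|y(t\<^sub>0)| \<ge> 0\<close>.\<close>

theorem mittag_leffler_nonpos_bound:
  assumes \<alpha>: "0 < \<alpha>" "\<alpha> < 1" and "r \<le> 0"
  shows "\<bar>mittag_leffler \<alpha> r\<bar> \<le> 1"
proof (rule ccontr)
  assume neg: "\<not> \<bar>mittag_leffler \<alpha> r\<bar> \<le> 1"
  define y where "y \<tau> = mittag_leffler \<alpha> (- (\<tau> powr \<alpha>))" for \<tau>
  define y' where "y' \<tau> = - (\<tau> powr (\<alpha> - 1) * mittag_leffler2 \<alpha> \<alpha> (- (\<tau> powr \<alpha>)))" for \<tau>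
  \<comment> \<open>Chosen so that \<open>y t1\<close> is the value at \<open>r\<close>.\<close>
  define t1 where "t1 = (- r) powr (1 / \<alpha>)"
  have t1: "0 \<le> t1" "y t1 = mittag_leffler \<alpha> r"
    using \<alpha> \<open>r \<le> 0\<close> by (auto simp: t1_def y_def powr_powr)
  have y0: "y 0 = 1" by (simp add: y_def mittag_leffler_0)
  have cont: "continuous_on {0..t} y" for t
    unfolding y_def using \<alpha>
    by (intro continuous_on_compose2[OF continuous_mittag_leffler[OF \<alpha>, of UNIV]]
        continuous_intros continuous_on_powr') auto
  have "\<exists>t0\<in>{0..t1}. \<forall>\<tau>\<in>{0..t1}. \<bar>y \<tau>\<bar> \<le> \<bar>y t0\<bar>"
    using t1 by (intro continuous_attains_sup continuous_intros cont) auto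
  then obtain t0 where t0: "t0 \<in> {0..t1}" and max: "\<And>\<tau>. \<tau> \<in> {0..t1} \<Longrightarrow> \<bar>y \<tau>\<bar> \<le> \<bar>y t0\<bar>"
    by blast
  have big: "\<bar>y t0\<bar> > 1" using max[of t1] t1 neg by auto
  then have "t0 > 0" using t0 y0 by (cases "t0 = 0") auto
  define s where "s = sgn (y t0)"
  have s: "s * y t0 = \<bar>y t0\<bar>" "s * x \<le> \<bar>x\<bar>" for x
    by (auto simp: s_def sgn_if)
  have "has_bochner_integral lborel (\<lambda>\<tau>. indicator {0..t0} \<tau> *
      (\<tau> powr (\<alpha> - 1) * mittag_leffler2 \<alpha> \<alpha> ((- 1) * \<tau> powr \<alpha>) * (t0 - \<tau>) powr ((1 - \<alpha>) - 1)))
    (Gamma (1 - \<alpha>) * t0 powr (\<alpha> + (1 - \<alpha>) - 1) * mittag_leffler2 \<alpha> (\<alpha> + (1 - \<alpha>)) ((-1) * t0 powr \<alpha>))"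
    using \<alpha> \<open>t0 > 0\<close> by (intro fractional_integral_mittag_leffler2) auto
  then have "has_bochner_integral lborel (\<lambda>\<tau>. indicator {0..t0} \<tau> *
      (\<tau> powr (\<alpha> - 1) * mittag_leffler2 \<alpha> \<alpha> (- (\<tau> powr \<alpha>)) * (t0 - \<tau>) powr (- \<alpha>)))
     (Gamma (1 - \<alpha>) * y t0)"
    using \<open>t0 > 0\<close> by (simp add: y_def mittag_leffler_eq)
  from has_bochner_integral_mult_right[OF this, of "- s"]
  have "has_bochner_integral lborel (\<lambda>\<tau>. indicator {0..t0} \<tau> *
      (s * y' \<tau> * (t0 - \<tau>) powr (- \<alpha>))) (- (Gamma (1 - \<alpha>) * (s * y t0)))"
    by (simp add: y'_def mult_ac)
  from has_integral_integral_lborel[OF this[THEN integrable.intros]] this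
  have "((\<lambda>\<tau>. indicator {0..t0} \<tau> * (s * y' \<tau> * (t0 - \<tau>) powr (- \<alpha>)))
      has_integral - (Gamma (1 - \<alpha>) * (s * y t0))) UNIV"
    by (simp add: has_bochner_integral_iff)
  then have int: "((\<lambda>\<tau>. s * y' \<tau> * (t0 - \<tau>) powr (- \<alpha>))
      has_integral - (Gamma (1 - \<alpha>) * (s * y t0))) {0..t0}"
    by (subst has_integral_restrict_UNIV[symmetric], rule has_integral_eq[rotated])
       (auto simp: indicator_def)
  have "0 \<le> - (Gamma (1 - \<alpha>) * (s * y t0))"
  proof (rule caputo_nonneg_at_maximum[OF \<alpha> \<open>t0 > 0\<close> _ _ int])
    show "continuous_on {0..t0} (\<lambda>\<tau>. s * y \<tau>)" by (intro continuous_intros cont)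
    show "((\<lambda>\<tau>. s * y \<tau>) has_field_derivative s * y' \<tau>) (at \<tau>)" if "0 < \<tau>" for \<tau>
    proof -
      have "((\<lambda>\<tau>. - (\<tau> powr \<alpha>)) has_field_derivative - (\<alpha> * \<tau> powr (\<alpha> - 1))) (at \<tau>)"
        using that by (auto intro!: derivative_eq_intros)
      from DERIV_chain2[OF mittag_leffler_has_derivative[OF \<alpha>] this]
      show ?thesis
        unfolding y_def[abs_def] y'_def using \<alpha>
        by (intro DERIV_cmult) (simp add: mult_ac)
    qed
    show "s * y \<tau> \<le> s * y t0" if "0 \<le> \<tau>" "\<tau> \<le> t0" for \<tau>
      using s(2)[of "y \<tau>"] max[of \<tau>] t0 that s(1) by auto
  qed
  moreover have "Gamma (1 - \<alpha>) > 0" using \<alpha> by (intro Gamma_real_pos) auto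
  ultimately show False using big s(1) by (simp add: mult_le_0_iff)
qed

lemma mittag_leffler_bounded_above:
  assumes \<alpha>: "0 < \<alpha>" "\<alpha> < 1" and "r \<le> R"
  shows "\<bar>mittag_leffler \<alpha> r\<bar> \<le> 1 + mittag_leffler2 \<alpha> 1 \<bar>R\<bar>"
proof -
  have sums: "(\<lambda>k. r ^ k / Gamma (real k * \<alpha> + 1)) sums mittag_leffler2 \<alpha> 1 r" for r
    using \<alpha> by (intro mittag_leffler2_sums) auto
  have pos: "Gamma (real k * \<alpha> + 1) > 0" for k
    using assms by (intro Gamma_real_pos add_nonneg_pos) auto
  have nonneg: "0 \<le> mittag_leffler2 \<alpha> 1 r" if "0 \<le> r" for r
    using sums[of r] that pos by (rule_tac sums_le[OF _ sums_zero sums[of r]]) (simp add: less_imp_le)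
  show ?thesis
  proof (cases "r \<le> 0")
    case True
    then show ?thesis using mittag_leffler_nonpos_bound[OF \<alpha> True] nonneg[of "\<bar>R\<bar>"] by simp
  next
    case False
    have "mittag_leffler2 \<alpha> 1 r \<le> mittag_leffler2 \<alpha> 1 \<bar>R\<bar>"
      using False \<open>r \<le> R\<close> pos
      by (intro sums_le[OF _ sums sums] divide_right_mono power_mono) (auto simp: less_imp_le)
    then show ?thesis using nonneg[of r] False by (simp add: mittag_leffler_eq)
  qed
qed

lemma mittag_leffler_volterra:
  assumes "0 < \<alpha>" "\<alpha> < 1" "t > 0"
  shows "has_bochner_integral lborel
    (\<lambda>\<tau>. indicator {0..t} \<tau> * (c * mittag_leffler \<alpha> (c * \<tau> powr \<alpha>) * (t - \<tau>) powr (\<alpha> - 1)))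
    (Gamma \<alpha> * (mittag_leffler \<alpha> (c * t powr \<alpha>) - 1))"
proof -
  have "has_bochner_integral lborel (\<lambda>\<tau>. indicator {0..t} \<tau> *
      (\<tau> powr (1 - 1) * mittag_leffler2 \<alpha> 1 (c * \<tau> powr \<alpha>) * (t - \<tau>) powr (\<alpha> - 1)))
    (Gamma \<alpha> * t powr (1 + \<alpha> - 1) * mittag_leffler2 \<alpha> (1 + \<alpha>) (c * t powr \<alpha>))"
    using assms by (intro fractional_integral_mittag_leffler2) auto
  from has_bochner_integral_mult_right[OF this, of c]
  have *: "has_bochner_integral lborel (\<lambda>\<tau>. c * (indicator {0..t} \<tau> *
      (\<tau> powr (1 - 1) * mittag_leffler2 \<alpha> 1 (c * \<tau> powr \<alpha>) * (t - \<tau>) powr (\<alpha> - 1))))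
    (Gamma \<alpha> * (c * t powr \<alpha> * mittag_leffler2 \<alpha> (1 + \<alpha>) (c * t powr \<alpha>)))"
    by (simp add: mult_ac)
  have "(\<lambda>k. r ^ Suc k / Gamma (real (Suc k) * \<alpha> + 1)) sums (r * mittag_leffler2 \<alpha> (1 + \<alpha>) r)" for r
    using sums_mult[OF mittag_leffler2_sums[of \<alpha> "1 + \<alpha>" r], of r] assms
    by (simp add: algebra_simps)
  then have "(\<lambda>k. r ^ k / Gamma (real k * \<alpha> + 1)) sums (1 + r * mittag_leffler2 \<alpha> (1 + \<alpha>) r)" for r
    using sums_Suc_iff[of "\<lambda>k. r ^ k / Gamma (real k * \<alpha> + 1)" "r * mittag_leffler2 \<alpha> (1 + \<alpha>) r"]
    by (simp add: add.commute)
  then have rec: "mittag_leffler \<alpha> r = 1 + r * mittag_leffler2 \<alpha> (1 + \<alpha>) r" for r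
    by (simp add: mittag_leffler_eq mittag_leffler2_def sums_iff)
  have "has_bochner_integral lborel
     (\<lambda>\<tau>. indicator {0..t} \<tau> * (c * mittag_leffler \<alpha> (c * \<tau> powr \<alpha>) * (t - \<tau>) powr (\<alpha> - 1))) x
   \<longleftrightarrow> has_bochner_integral lborel (\<lambda>\<tau>. c * (indicator {0..t} \<tau> *
      (\<tau> powr (1 - 1) * mittag_leffler2 \<alpha> 1 (c * \<tau> powr \<alpha>) * (t - \<tau>) powr (\<alpha> - 1)))) x" for x
  proof (rule has_bochner_integral_cong_AE)
    have "AE \<tau> in lborel. \<tau> \<noteq> (0::real)" by (rule AE_lborel_singleton)
    then show "AE \<tau> in lborel. indicator {0..t} \<tau> * (c * mittag_leffler \<alpha> (c * \<tau> powr \<alpha>) * (t - \<tau>) powr (\<alpha> - 1))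
     = c * (indicator {0..t} \<tau> *
      (\<tau> powr (1 - 1) * mittag_leffler2 \<alpha> 1 (c * \<tau> powr \<alpha>) * (t - \<tau>) powr (\<alpha> - 1)))"
      by eventually_elim (auto simp: mittag_leffler_eq)
  next
    have [measurable]: "mittag_leffler \<alpha> \<in> borel_measurable borel"
      by (rule borel_measurable_continuous_onI[OF continuous_mittag_leffler]) fact+
    then have [measurable]: "mittag_leffler2 \<alpha> 1 \<in> borel_measurable borel"
      by (simp add: mittag_leffler_eq)
    show "(\<lambda>\<tau>. indicator {0..t} \<tau> * (c * mittag_leffler \<alpha> (c * \<tau> powr \<alpha>) * (t - \<tau>) powr (\<alpha> - 1)))
      \<in> borel_measurable lborel" by measurable
    show "(\<lambda>\<tau>. c * (indicator {0..t} \<tau> *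
      (\<tau> powr (1 - 1) * mittag_leffler2 \<alpha> 1 (c * \<tau> powr \<alpha>) * (t - \<tau>) powr (\<alpha> - 1))))
      \<in> borel_measurable lborel" by measurable
  qed
  with * show ?thesis by (simp add: rec)
qed

section \<open>Product integrals and integrable weights on Euclidean space\<close>

lemma lborel_integral_product:
  fixes f :: "'a::euclidean_space \<Rightarrow> real \<Rightarrow> 'b::{real_normed_field, banach, second_countable_topology}"
  assumes f: "\<And>b. b \<in> Basis \<Longrightarrow> integrable lborel (f b)"
  shows "integrable lborel (\<lambda>x::'a. \<Prod>b\<in>Basis. f b (x \<bullet> b))"
    and "(\<integral>x. (\<Prod>b\<in>Basis. f b (x \<bullet> b)) \<partial>(lborel :: 'a measure)) = (\<Prod>b\<in>Basis. integral\<^sup>L lborel (f b))"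
proof -
  interpret product_sigma_finite "\<lambda>_::'a. lborel :: real measure"
    by standard
  have [measurable]: "f b \<in> borel_measurable borel" if "b \<in> Basis" for b
    using f[OF that] by auto
  have coord: "(\<Sum>c\<in>Basis. y c *\<^sub>R c) \<bullet> b = y b" if "b \<in> Basis" for y and b :: 'a
    using that by simp
  have [measurable]: "(\<lambda>x::'a. \<Prod>b\<in>Basis. f b (x \<bullet> b)) \<in> borel_measurable borel"
    by (intro borel_measurable_prod) measurable
  have prod: "(\<Prod>b\<in>Basis. f b ((\<Sum>c\<in>Basis. y c *\<^sub>R c) \<bullet> b)) = (\<Prod>b\<in>Basis. f b (y b))" for y :: "'a \<Rightarrow> real"
    by (intro prod.cong refl) simp
  have m: "(\<lambda>y. \<Sum>c\<in>Basis. y c *\<^sub>R c :: 'a) \<in> measurable (\<Pi>\<^sub>M b\<in>Basis. lborel) borel"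
    by measurable
  show "integrable lborel (\<lambda>x::'a. \<Prod>b\<in>Basis. f b (x \<bullet> b))"
    unfolding lborel_eq[where 'a='a] using m
    by (subst integrable_distr_eq) (auto simp: prod intro!: product_integrable_prod f)
  show "(\<integral>x. (\<Prod>b\<in>Basis. f b (x \<bullet> b)) \<partial>(lborel :: 'a measure)) = (\<Prod>b\<in>Basis. integral\<^sup>L lborel (f b))"
    unfolding lborel_eq[where 'a='a] using m
    by (subst integral_distr) (auto simp: prod intro!: product_integral_prod f)
qed

lemma
  fixes f :: "'a::euclidean_space \<Rightarrow> 'b::{banach, second_countable_topology}"
  assumes f: "integrable lborel f" and c: "c \<noteq> 0"
  shows integrable_lborel_affine: "integrable lborel (\<lambda>x. f (t + c *\<^sub>R x))"
    and integral_lborel_affine: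
      "integral\<^sup>L lborel f = \<bar>c\<bar> ^ DIM('a) *\<^sub>R (\<integral>x. f (t + c *\<^sub>R x) \<partial>lborel)"
proof -
  have [measurable]: "f \<in> borel_measurable borel" using f by auto
  have "integrable (density (distr lborel borel (\<lambda>x. t + c *\<^sub>R x)) (\<lambda>_. ennreal (\<bar>c\<bar> ^ DIM('a)))) f"
    using f lborel_affine[OF c, of t] by (simp add: ennreal_power)
  then have "integrable (distr lborel borel (\<lambda>x. t + c *\<^sub>R x)) (\<lambda>x. \<bar>c\<bar> ^ DIM('a) *\<^sub>R f x)"
    by (subst (asm) integrable_density) auto
  then have "integrable lborel (\<lambda>x. \<bar>c\<bar> ^ DIM('a) *\<^sub>R f (t + c *\<^sub>R x))"
    by (subst (asm) integrable_distr_eq) auto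
  from integrable_scaleR_right[OF this, of "inverse (\<bar>c\<bar> ^ DIM('a))"]
  show "integrable lborel (\<lambda>x. f (t + c *\<^sub>R x))"
    using c by simp
  have "integral\<^sup>L lborel f
      = integral\<^sup>L (density (distr lborel borel (\<lambda>x. t + c *\<^sub>R x)) (\<lambda>_. ennreal (\<bar>c\<bar> ^ DIM('a)))) f"
    using lborel_affine[OF c, of t] by (simp add: ennreal_power)
  also have "\<dots> = integral\<^sup>L (distr lborel borel (\<lambda>x. t + c *\<^sub>R x)) (\<lambda>x. \<bar>c\<bar> ^ DIM('a) *\<^sub>R f x)"
    by (subst integral_density) auto
  also have "\<dots> = \<bar>c\<bar> ^ DIM('a) *\<^sub>R (\<integral>x. f (t + c *\<^sub>R x) \<partial>lborel)"
    by (subst integral_distr) auto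
  finally show "integral\<^sup>L lborel f = \<bar>c\<bar> ^ DIM('a) *\<^sub>R (\<integral>x. f (t + c *\<^sub>R x) \<partial>lborel)" .
qed

text \<open>A product over the coordinates, so that its integral factorises and a shift along a basis vector
  changes a single factor.  With \<open>q = 1\<close> it dominates Schwartz functions; the exponent \<open>m / N\<close> gives
  the sharp Sobolev condition.\<close>

definition decay :: "real \<Rightarrow> 'a::euclidean_space \<Rightarrow> real" where
  "decay q x = (\<Prod>b\<in>Basis. (1 + (x \<bullet> b)\<^sup>2) powr (- q))"

lemma decay_pos: "decay q x > 0"
  unfolding decay_def
  by (intro prod_pos) (simp add: add_nonneg_eq_0_iff)

lemma borel_measurable_decay [measurable]: "decay q \<in> borel_measurable borel"
  unfolding decay_def[abs_def] by measurable

lemma integrable_decay_real: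
  fixes q :: real
  assumes "q > 1 / 2"
  shows "integrable lborel (\<lambda>s::real. (1 + s\<^sup>2) powr (- q))"
proof -
  \<comment> \<open>Outside \<open>[-1, 1]\<close> the integrand is at most \<open>h s + h (- s)\<close>.\<close>
  define h where "h s = indicator {1..} s * s powr (- 2 * q)" for s :: real
  have "((\<lambda>s. s powr (- 2 * q)) has_integral - (1 powr (- 2 * q + 1)) / (- 2 * q + 1)) {1..}"
    using assms by (intro has_integral_powr_to_inf) auto
  then have "(\<lambda>s. s powr (- 2 * q)) absolutely_integrable_on {1..}"
    by (intro nonnegative_absolutely_integrable_1) (auto simp: integrable_on_def)
  then have "integrable lebesgue h"
    by (simp add: set_integrable_def h_def[abs_def])
  then have h: "integrable lborel h"
    by (subst (asm) integrable_completion) (auto simp: h_def[abs_def])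
  then have h': "integrable lborel (\<lambda>s. h (- s))"
    using lborel_integrable_real_affine[of h "-1" 0] by simp
  have i: "integrable lborel (indicator {-1..1} :: real \<Rightarrow> real)"
    by (intro integrable_real_indicator) auto
  show ?thesis
  proof (rule Bochner_Integration.integrable_bound)
    show "integrable lborel (\<lambda>s. indicator {-1..1} s + (h s + h (- s)))"
      by (intro Bochner_Integration.integrable_add i h h')
    have le: "(1 + s\<^sup>2) powr (- q) \<le> indicator {-1..1} s + (h s + h (- s))" for s :: real
    proof (cases "\<bar>s\<bar> \<le> 1")
      case True
      have "(1 + s\<^sup>2) powr (- q) \<le> (1 + s\<^sup>2) powr 0"
        using assms by (intro powr_mono) auto
      also have "\<dots> = 1" by (simp add: add_nonneg_eq_0_iff)
      finally show ?thesis using True by (auto simp: h_def indicator_def)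
    next
      case False
      have "(1 + s\<^sup>2) powr (- q) \<le> (\<bar>s\<bar>\<^sup>2) powr (- q)"
        using assms False by (intro powr_mono2') auto
      also have "\<dots> = \<bar>s\<bar> powr (- 2 * q)"
        using False powr_powr[of "\<bar>s\<bar>" 2 "- q"] by (simp add: powr_numeral)
      also have "\<dots> \<le> h s + h (- s)" using False by (auto simp: h_def indicator_def abs_if)
      finally show ?thesis using False by (auto simp: indicator_def)
    qed
    show "AE s in lborel. norm ((1 + s\<^sup>2) powr (- q)) \<le> norm (indicator {-1..1} s + (h s + h (- s)))"
      using order_trans[OF le abs_ge_self] by auto
  qed measurable
qed

lemma integrable_decay:
  assumes "q > 1 / 2"
  shows "integrable lborel (decay q :: 'a::euclidean_space \<Rightarrow> real)"
  unfolding decay_def[abs_def]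
  using lborel_integral_product(1)[of "\<lambda>_::'a. \<lambda>s::real. (1 + s\<^sup>2) powr (- q)"]
    integrable_decay_real[OF assms] by simp

section \<open>Fourier transforms of integrable functions\<close>

abbreviation character :: "'a::euclidean_space \<Rightarrow> 'a \<Rightarrow> complex" where
  "character \<xi> x \<equiv> exp (- 2 * of_real pi * \<i> * of_real (x \<bullet> \<xi>))"

lemma character_cis: "character \<xi> x = cis (- 2 * pi * (x \<bullet> \<xi>))"
  by (simp add: cis_conv_exp mult_ac)

lemma norm_character [simp]: "norm (character \<xi> x) = 1"
  unfolding character_cis by simp

lemma fourier_lborel:
  assumes "f \<in> borel_measurable borel"
  shows "fourier f \<xi> = (LINT x|lborel. f x * character \<xi> x)"
  unfolding fourier_def using assms by (subst integral_completion) auto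

lemma integrable_times_character:
  assumes "integrable lborel f"
  shows "integrable lborel (\<lambda>x. f x * character \<xi> x)"
proof (rule Bochner_Integration.integrable_bound[OF assms])
  have [measurable]: "f \<in> borel_measurable borel" using assms by auto
  show "(\<lambda>x. f x * character \<xi> x) \<in> borel_measurable lborel"
    by measurable
  show "AE x in lborel. norm (f x * character \<xi> x) \<le> norm (f x)"
    by (simp add: norm_mult del: of_real_minus of_real_mult)
qed

lemma norm_fourier_le:
  assumes "integrable lborel f"
  shows "norm (fourier f \<xi>) \<le> (LINT x|lborel. norm (f x))"
proof -
  have "norm (LINT x|lborel. f x * character \<xi> x) \<le> (LINT x|lborel. norm (f x * character \<xi> x))"
    by (rule integral_norm_bound)
  then show ?thesis
    using assms by (subst fourier_lborel) (auto simp: norm_mult)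
qed

lemma borel_measurable_fourier:
  assumes "f \<in> borel_measurable borel"
  shows "fourier f \<in> borel_measurable borel"
proof -
  note assms[measurable]
  have "(\<lambda>\<xi>. LINT x|lborel. f x * character \<xi> x) \<in> borel_measurable lborel"
    by (rule lborel.borel_measurable_lebesgue_integral) measurable
  then show ?thesis using fourier_lborel[OF assms] by (simp add: fun_eq_iff cong: measurable_cong)
qed

lemma integrable_mult_bounded:
  fixes f g :: "'a::euclidean_space \<Rightarrow> complex"
  assumes "integrable lborel f" "g \<in> borel_measurable borel" "\<And>x. norm (g x) \<le> C"
  shows "integrable lborel (\<lambda>x. f x * g x)"
proof (rule Bochner_Integration.integrable_bound[of _ "\<lambda>x. of_real C * f x"])
  show "AE x in lborel. norm (f x * g x) \<le> norm (of_real C * f x)"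
  proof (intro AE_I2)
    fix x
    have "norm (g x) \<le> \<bar>C\<bar>" using assms(3)[of x] by simp
    then show "norm (f x * g x) \<le> norm (of_real C * f x)"
      by (simp add: norm_mult mult.commute[of "norm (f x)"] mult_right_mono)
  qed
  have [measurable]: "f \<in> borel_measurable borel" "g \<in> borel_measurable borel" using assms by auto
  show "(\<lambda>x. f x * g x) \<in> borel_measurable lborel" by measurable
qed (use assms in auto)

lemma integrable_mult_fourier:
  fixes f g :: "'a::euclidean_space \<Rightarrow> complex"
  assumes f: "integrable lborel f" and g: "integrable lborel g"
  shows "integrable lborel (\<lambda>x. g x * fourier f x)"
  using f g norm_fourier_le[OF f] by (intro integrable_mult_bounded borel_measurable_fourier) auto

lemma fourier_multiplication_formula:
  fixes f g :: "'a::euclidean_space \<Rightarrow> complex"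
  assumes f: "integrable lborel f" and g: "integrable lborel g"
  shows "(LINT x|lborel. fourier f x * g x) = (LINT x|lborel. f x * fourier g x)"
proof -
  have [measurable]: "f \<in> borel_measurable borel" "g \<in> borel_measurable borel"
    using f g by auto
  have int: "integrable (lborel \<Otimes>\<^sub>M lborel) (\<lambda>(x, y). f x * g y * character y x)"
  proof (rule lborel_pair.Fubini_integrable)
    show "(\<lambda>(x, y). f x * g y * character y x) \<in> borel_measurable (lborel \<Otimes>\<^sub>M lborel)"
      by measurable
    have "integrable lborel (\<lambda>x. norm (f x) * (LINT y|lborel. norm (g y)))"
      using f by (intro integrable_mult_left integrable_norm)
    then show "integrable lborel (\<lambda>x. LINT y|lborel. norm (case (x, y) of (x, y) \<Rightarrow> f x * g y * character y x))"
      by (simp add: norm_mult)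
    show "AE x in lborel. integrable lborel (\<lambda>y. case (x, y) of (x, y) \<Rightarrow> f x * g y * character y x)"
    proof (intro AE_I2)
      fix x
      show "integrable lborel (\<lambda>y. case (x, y) of (x, y) \<Rightarrow> f x * g y * character y x)"
        using integrable_mult_right[OF integrable_times_character[OF g, of x], of "f x"]
        by (simp add: inner_commute mult_ac)
    qed
  qed
  have "(LINT x|lborel. f x * fourier g x) = (LINT x|lborel. LINT y|lborel. f x * g y * character y x)"
  proof (intro Bochner_Integration.integral_cong refl)
    fix x
    have "f x * fourier g x = f x * (LINT y|lborel. g y * character x y)"
      by (subst fourier_lborel) auto
    also have "\<dots> = (LINT y|lborel. f x * (g y * character x y))"
      using integrable_times_character[OF g] by simp
    finally show "f x * fourier g x = (LINT y|lborel. f x * g y * character y x)"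
      by (simp add: inner_commute mult_ac)
  qed
  also have "\<dots> = (LINT y|lborel. LINT x|lborel. f x * g y * character y x)"
    using lborel_pair.Fubini_integral[OF int] by simp
  also have "\<dots> = (LINT y|lborel. fourier f y * g y)"
  proof (intro Bochner_Integration.integral_cong refl)
    fix y
    have "fourier f y * g y = (LINT x|lborel. f x * character y x) * g y"
      by (subst fourier_lborel) auto
    also have "\<dots> = (LINT x|lborel. (f x * character y x) * g y)"
      using integrable_times_character[OF f] by simp
    finally show "(LINT x|lborel. f x * g y * character y x) = fourier f y * g y"
      by (simp add: mult_ac)
  qed
  finally show ?thesis by simp
qed

definition gaussian :: "real \<Rightarrow> 'a::euclidean_space \<Rightarrow> real" where
  "gaussian c x = exp (- pi * c\<^sup>2 * (norm x)\<^sup>2)"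

lemma borel_measurable_gaussian [measurable]: "gaussian c \<in> borel_measurable borel"
  unfolding gaussian_def[abs_def] by measurable

lemma gaussian_pos: "gaussian c x > 0" and gaussian_le_1: "gaussian c x \<le> 1"
  by (auto simp: gaussian_def)

lemma gaussian_minus [simp]: "gaussian c (- x) = gaussian c x"
  by (simp add: gaussian_def)

lemma norm_squared_coordinates: "(norm x)\<^sup>2 = (\<Sum>b\<in>Basis. (x \<bullet> b)\<^sup>2)"
  by (subst power2_norm_eq_inner, subst euclidean_inner) (simp add: power2_eq_square)

lemma gaussian_prod: "gaussian c x = (\<Prod>b\<in>Basis. exp (- pi * c\<^sup>2 * (x \<bullet> b)\<^sup>2))"
  by (simp add: gaussian_def norm_squared_coordinates exp_sum[symmetric] sum_distrib_left)

text \<open>This is the characteristic function of the standard normal distribution, rescaled.\<close>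

lemma gaussian_integral_real:
  fixes c u :: real
  assumes "c > 0"
  shows "has_bochner_integral lborel
    (\<lambda>s. of_real (exp (- pi * c\<^sup>2 * s\<^sup>2)) * exp (- 2 * of_real pi * \<i> * of_real (s * u)))
    (of_real (exp (- pi * (u / c)\<^sup>2) / c) :: complex)"
proof -
  \<comment> \<open>The substitution \<open>x = k s\<close> turns the normal density into the Gaussian of parameter \<open>c\<close>.\<close>
  define k where "k = c * sqrt (2 * pi)"
  have k: "k > 0" "k\<^sup>2 = 2 * pi * c\<^sup>2" using assms by (auto simp: k_def power_mult_distrib)
  define t where "t = - 2 * pi * u / k"
  let ?G = "\<lambda>x. std_normal_density x *\<^sub>R iexp (t * x)"
  interpret std: prob_space std_normal_distribution
    by (simp add: prob_space_normal_density)
  have [measurable]: "(\<lambda>x. iexp (t * x)) \<in> borel_measurable borel"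
    by measurable
  have "integrable std_normal_distribution (\<lambda>x. iexp (t * x))"
    by (rule std.integrable_const_bound[where B=1]) (auto simp: cong: measurable_cong_sets)
  then have i: "integrable lborel ?G"
    by (subst (asm) integrable_density) (auto simp: normal_density_nonneg)
  have "integral\<^sup>L lborel ?G = char std_normal_distribution t"
    unfolding char_def by (subst integral_density) (auto simp: normal_density_nonneg)
  also have "\<dots> = of_real (exp (- (t\<^sup>2) / 2))"
    by (simp add: char_std_normal_distribution)
  finally have "has_bochner_integral lborel ?G (of_real (exp (- (t\<^sup>2) / 2)))"
    using i by (simp add: has_bochner_integral_iff)
  then have "has_bochner_integral lborel (\<lambda>s. ?G (0 + k * s)) (of_real (exp (- (t\<^sup>2) / 2)) /\<^sub>R \<bar>k\<bar>)"
    using k by (subst (asm) lborel_has_bochner_integral_real_affine_iff[of k _ _ 0]) auto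
  from has_bochner_integral_mult_right[OF this, of "of_real (sqrt (2 * pi))"]
  have "has_bochner_integral lborel (\<lambda>s. of_real (sqrt (2 * pi)) * ?G (0 + k * s))
     (of_real (sqrt (2 * pi)) * (of_real (exp (- (t\<^sup>2) / 2)) /\<^sub>R \<bar>k\<bar>))" .
  moreover have "of_real (sqrt (2 * pi)) * ?G (0 + k * s)
      = of_real (exp (- pi * c\<^sup>2 * s\<^sup>2)) * exp (- 2 * of_real pi * \<i> * of_real (s * u))" for s
  proof -
    have "t * (k * s) = - 2 * pi * (s * u)" using k by (simp add: t_def)
    then have "iexp (t * (k * s)) = exp (- 2 * of_real pi * \<i> * of_real (s * u))"
      by (simp only:) (simp add: mult_ac)
    moreover have "sqrt (2 * pi) * std_normal_density (k * s) = exp (- pi * c\<^sup>2 * s\<^sup>2)"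
      by (simp add: std_normal_density_def power_mult_distrib k(2))
    ultimately show ?thesis
      by (simp add: scaleR_conv_of_real del: of_real_mult) (metis mult.assoc of_real_mult)
  qed
  moreover have "of_real (sqrt (2 * pi)) * (of_real (exp (- (t\<^sup>2) / 2)) /\<^sub>R \<bar>k\<bar>)
      = (of_real (exp (- pi * (u / c)\<^sup>2) / c) :: complex)"
  proof -
    have "t\<^sup>2 = 4 * pi\<^sup>2 * u\<^sup>2 / (2 * pi * c\<^sup>2)"
      by (simp add: t_def power_divide power_mult_distrib k(2))
    then have "t\<^sup>2 / 2 = pi * (u / c)\<^sup>2"
      using assms by (simp add: power2_eq_square field_simps)
    then have e: "exp (- (t\<^sup>2) / 2) = exp (- pi * (u / c)\<^sup>2)" by simp
    have "sqrt (2 * pi) * inverse k = inverse c" using assms by (simp add: k_def)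
    then have "sqrt (2 * pi) * (inverse k * exp (- (t\<^sup>2) / 2)) = exp (- pi * (u / c)\<^sup>2) / c"
      unfolding e mult.assoc[symmetric] by (simp only: divide_real_def mult.commute)
    from arg_cong[OF this, of complex_of_real] show ?thesis
      using k(1) by (simp only: of_real_mult scaleR_conv_of_real abs_of_pos)
  qed
  ultimately show ?thesis by simp
qed

lemma
  assumes c: "c > 0"
  shows integrable_gaussian: "integrable lborel (gaussian c :: 'a::euclidean_space \<Rightarrow> real)"
    and fourier_gaussian: "fourier (\<lambda>x::'a. of_real (gaussian c x)) \<xi>
      = of_real (gaussian (1 / c) \<xi> / c ^ DIM('a))"
proof -
  define f :: "'a \<Rightarrow> real \<Rightarrow> complex" where
    "f b s = of_real (exp (- pi * c\<^sup>2 * s\<^sup>2)) * exp (- 2 * of_real pi * \<i> * of_real (s * (\<xi> \<bullet> b)))" for b s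
  have f: "has_bochner_integral lborel (f b) (of_real (exp (- pi * ((\<xi> \<bullet> b) / c)\<^sup>2) / c))" for b
    using gaussian_integral_real[OF c, of "\<xi> \<bullet> b"] by (simp add: f_def[abs_def])
  have prod: "(\<Prod>b\<in>Basis. f b (x \<bullet> b)) = of_real (gaussian c x) * character \<xi> x" for x :: 'a
  proof -
    have "x \<bullet> \<xi> = (\<Sum>b\<in>Basis. (x \<bullet> b) * (\<xi> \<bullet> b))" by (rule euclidean_inner)
    then show ?thesis
      unfolding f_def prod.distrib gaussian_prod
      by (simp add: exp_sum sum_distrib_left)
  qed
  have int: "integrable lborel (\<lambda>x::'a. of_real (gaussian c x) * character \<xi> x)"
    using lborel_integral_product(1)[of f, OF integrable.intros[OF f]] unfolding prod .
  have "integrable lborel (\<lambda>x::'a. norm (of_real (gaussian c x) * character \<xi> x))"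
    by (rule integrable_norm[OF int])
  then show "integrable lborel (gaussian c :: 'a \<Rightarrow> real)"
    by (simp add: norm_mult abs_of_pos gaussian_pos)
  have "fourier (\<lambda>x::'a. of_real (gaussian c x)) \<xi> = (\<Prod>b\<in>Basis. of_real (exp (- pi * ((\<xi> \<bullet> b) / c)\<^sup>2) / c))"
    using lborel_integral_product(2)[of f, OF integrable.intros[OF f]]
    unfolding prod has_bochner_integral_integral_eq[OF f]
    by (subst fourier_lborel) auto
  also have "\<dots> = of_real (\<Prod>b\<in>Basis. exp (- pi * (1 / c)\<^sup>2 * (\<xi> \<bullet> b)\<^sup>2) / c)"
    by (simp add: power_divide)
  also have "\<dots> = of_real (gaussian (1 / c) \<xi> / c ^ DIM('a))"
    by (simp add: gaussian_prod prod_dividef)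
  finally show "fourier (\<lambda>x::'a. of_real (gaussian c x)) \<xi> = of_real (gaussian (1 / c) \<xi> / c ^ DIM('a))" .
qed

lemma integral_gaussian:
  assumes c: "c > 0"
  shows "(LINT x|lborel. gaussian c (x::'a::euclidean_space)) = 1 / c ^ DIM('a)"
proof -
  have "fourier (\<lambda>x::'a. of_real (gaussian c x)) 0 = of_real (1 / c ^ DIM('a))"
    using fourier_gaussian[OF c, of "0::'a"] by (simp add: gaussian_def)
  moreover have "fourier (\<lambda>x::'a. of_real (gaussian c x)) 0 = of_real (LINT x|lborel. gaussian c (x::'a))"
    by (subst fourier_lborel) auto
  ultimately show ?thesis using of_real_eq_iff by metis
qed

lemma fourier_modulated_gaussian:
  assumes c: "c > 0"
  shows "fourier (\<lambda>\<xi>::'a::euclidean_space. of_real (gaussian c \<xi>) * character (- x) \<xi>) y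
      = of_real (gaussian (1 / c) (y - x) / c ^ DIM('a))"
proof -
  have "fourier (\<lambda>\<xi>. of_real (gaussian c \<xi>) * character (- x) \<xi>) y
     = (LINT \<xi>|lborel. of_real (gaussian c \<xi>) * character (y - x) \<xi>)"
    by (subst fourier_lborel)
       (auto simp: inner_diff_right right_diff_distrib exp_diff exp_minus divide_inverse mult_ac
         exp_add[symmetric])
  also have "\<dots> = fourier (\<lambda>\<xi>. of_real (gaussian c \<xi>)) (y - x)"
    by (subst fourier_lborel) auto
  finally show ?thesis using fourier_gaussian[OF c] by simp
qed

lemma borel_measurable_cnj [measurable (raw)]:
  "f \<in> borel_measurable M \<Longrightarrow> (\<lambda>x. cnj (f x)) \<in> borel_measurable M"
  by (rule borel_measurable_continuous_on[of cnj]) (auto intro!: continuous_intros)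

lemma abs_gaussian [simp]: "\<bar>gaussian c x\<bar> = gaussian c x"
  by (simp add: gaussian_def)

lemma gaussian_scaled_tendsto_1: "(\<lambda>n. gaussian (1 / real (Suc n)) x) \<longlonglongrightarrow> 1"
proof -
  have "(\<lambda>n. exp (- pi * (1 / real (Suc n))\<^sup>2 * (norm x)\<^sup>2)) \<longlonglongrightarrow> exp (- pi * 0\<^sup>2 * (norm x)\<^sup>2)"
    by (intro tendsto_intros LIMSEQ_inverse_real_of_nat[unfolded inverse_eq_divide])
  then show ?thesis by (simp add: gaussian_def)
qed

text \<open>A Gaussian factor makes the inversion integral absolutely convergent as a double integral.  By the
  multiplication formula it becomes an average of \<open>\<phi>\<close> against a concentrating Gaussian centred at
  \<open>x\<close>; both sides converge by dominated convergence as the Gaussian factor widens.\<close>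

theorem fourier_inversion:
  fixes \<phi> :: "'a::euclidean_space \<Rightarrow> complex"
  assumes int: "integrable lborel \<phi>" and Fint: "integrable lborel (fourier \<phi>)"
    and cont: "continuous_on UNIV \<phi>" and bd: "\<And>x. norm (\<phi> x) \<le> B"
  shows "fourier (fourier \<phi>) (- x) = \<phi> x"
proof -
  define c where "c n = 1 / real (Suc n)" for n
  have c: "c n > 0" for n by (simp add: c_def)
  have [measurable]: "\<phi> \<in> borel_measurable borel" "fourier \<phi> \<in> borel_measurable borel"
    using int Fint by auto
  let ?e = "\<lambda>n \<xi>. of_real (gaussian (c n) \<xi>) * character (- x) \<xi>"
  have gi: "integrable lborel (\<lambda>\<xi>::'a. complex_of_real (gaussian (c n) \<xi>))" for n
    by (intro integrable_of_real integrable_gaussian c)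
  have eq: "(LINT \<xi>|lborel. fourier \<phi> \<xi> * ?e n \<xi>) = (LINT z|lborel. \<phi> (x + c n *\<^sub>R z) * of_real (gaussian 1 z))" for n
  proof -
    have "(LINT \<xi>|lborel. fourier \<phi> \<xi> * ?e n \<xi>) = (LINT y|lborel. \<phi> y * fourier (?e n) y)"
      using integrable_times_character[OF gi] by (intro fourier_multiplication_formula int)
    also have "\<dots> = (LINT y|lborel. \<phi> y * of_real (gaussian (1 / c n) (y - x) / c n ^ DIM('a)))"
      by (simp only: fourier_modulated_gaussian[OF c])
    also have "\<dots> = \<bar>c n\<bar> ^ DIM('a) *\<^sub>R (LINT z|lborel. \<phi> (x + c n *\<^sub>R z) *
        of_real (gaussian (1 / c n) ((x + c n *\<^sub>R z) - x) / c n ^ DIM('a)))"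
    proof (rule integral_lborel_affine)
      show "integrable lborel (\<lambda>y. \<phi> y * complex_of_real (gaussian (1 / c n) (y - x) / c n ^ DIM('a)))"
      proof (rule integrable_mult_bounded[OF int])
        show "norm (complex_of_real (gaussian (1 / c n) (y - x) / c n ^ DIM('a))) \<le> 1 / c n ^ DIM('a)" for y
          using gaussian_le_1[of "1 / c n" "y - x"] gaussian_pos[of "1 / c n" "y - x"] c[of n]
          by (simp add: norm_divide norm_power divide_right_mono)
      qed measurable
    qed (use c[of n] in simp)
    also have "\<dots> = (LINT z|lborel. \<bar>c n\<bar> ^ DIM('a) *\<^sub>R (\<phi> (x + c n *\<^sub>R z) *
        of_real (gaussian (1 / c n) ((x + c n *\<^sub>R z) - x) / c n ^ DIM('a))))"
      by simp
    also have "\<dots> = (LINT z|lborel. \<phi> (x + c n *\<^sub>R z) * of_real (gaussian 1 z))"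
    proof (intro Bochner_Integration.integral_cong refl)
      fix z :: 'a
      have "gaussian (1 / c n) (c n *\<^sub>R z) = gaussian 1 z"
        using c[of n] by (simp add: gaussian_def power_mult_distrib power_divide)
      then show "\<bar>c n\<bar> ^ DIM('a) *\<^sub>R (\<phi> (x + c n *\<^sub>R z) *
          of_real (gaussian (1 / c n) ((x + c n *\<^sub>R z) - x) / c n ^ DIM('a)))
        = \<phi> (x + c n *\<^sub>R z) * of_real (gaussian 1 z)"
        using c[of n] by (simp add: scaleR_conv_of_real)
    qed
    finally show ?thesis .
  qed
  have "(\<lambda>n. LINT \<xi>|lborel. fourier \<phi> \<xi> * ?e n \<xi>) \<longlonglongrightarrow> (LINT \<xi>|lborel. fourier \<phi> \<xi> * character (- x) \<xi>)"
  proof (rule integral_dominated_convergence)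
    show "integrable lborel (\<lambda>\<xi>. norm (fourier \<phi> \<xi>))" using Fint by auto
    show "AE \<xi> in lborel. norm (fourier \<phi> \<xi> * ?e n \<xi>) \<le> norm (fourier \<phi> \<xi>)" for n
      by (intro AE_I2) (simp add: norm_mult mult_left_le gaussian_le_1)
    show "AE \<xi> in lborel. (\<lambda>n. fourier \<phi> \<xi> * ?e n \<xi>) \<longlonglongrightarrow> fourier \<phi> \<xi> * character (- x) \<xi>"
    proof (intro AE_I2)
      fix \<xi> :: 'a
      have "(\<lambda>n. complex_of_real (gaussian (c n) \<xi>)) \<longlonglongrightarrow> of_real 1"
        unfolding c_def by (intro tendsto_of_real gaussian_scaled_tendsto_1)
      then have "(\<lambda>n. fourier \<phi> \<xi> * ?e n \<xi>) \<longlonglongrightarrow> fourier \<phi> \<xi> * (of_real 1 * character (- x) \<xi>)"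
        by (intro tendsto_mult tendsto_const)
      then show "(\<lambda>n. fourier \<phi> \<xi> * ?e n \<xi>) \<longlonglongrightarrow> fourier \<phi> \<xi> * character (- x) \<xi>"
        by simp
    qed
  qed measurable
  also have "(LINT \<xi>|lborel. fourier \<phi> \<xi> * character (- x) \<xi>) = fourier (fourier \<phi>) (- x)"
    by (subst fourier_lborel[of "fourier \<phi>"]) auto
  finally have lim1: "(\<lambda>n. LINT \<xi>|lborel. fourier \<phi> \<xi> * ?e n \<xi>) \<longlonglongrightarrow> fourier (fourier \<phi>) (- x)" .
  have "(\<lambda>n. LINT z|lborel. \<phi> (x + c n *\<^sub>R z) * of_real (gaussian 1 z))
      \<longlonglongrightarrow> (LINT z|lborel. \<phi> x * of_real (gaussian 1 (z::'a)))"
  proof (rule integral_dominated_convergence)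
    show "integrable lborel (\<lambda>z::'a. \<bar>B\<bar> * gaussian 1 z)"
      by (intro integrable_mult_right integrable_gaussian) simp
    show "AE z in lborel. norm (\<phi> (x + c n *\<^sub>R z) * of_real (gaussian 1 z)) \<le> \<bar>B\<bar> * gaussian 1 z" for n
    proof (intro AE_I2)
      fix z
      show "norm (\<phi> (x + c n *\<^sub>R z) * of_real (gaussian 1 z)) \<le> \<bar>B\<bar> * gaussian 1 z"
        using bd[of "x + c n *\<^sub>R z"] gaussian_pos[of 1 z]
        by (simp add: norm_mult)
    qed
    show "AE z in lborel. (\<lambda>n. \<phi> (x + c n *\<^sub>R z) * of_real (gaussian 1 z)) \<longlonglongrightarrow> \<phi> x * of_real (gaussian 1 z)"
    proof (intro AE_I2 tendsto_mult tendsto_const)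
      fix z
      have "(\<lambda>n. x + c n *\<^sub>R z) \<longlonglongrightarrow> x + 0 *\<^sub>R z"
        unfolding c_def by (intro tendsto_intros LIMSEQ_inverse_real_of_nat[unfolded inverse_eq_divide])
      then show "(\<lambda>n. \<phi> (x + c n *\<^sub>R z)) \<longlonglongrightarrow> \<phi> x"
        using continuous_on_tendsto_compose[OF cont, of "\<lambda>n. x + c n *\<^sub>R z" x sequentially] by simp
    qed
  qed measurable
  also have "(LINT z|lborel. \<phi> x * of_real (gaussian 1 (z::'a))) = \<phi> x"
  proof -
    have "(LINT z|lborel. complex_of_real (gaussian 1 (z::'a))) = of_real (LINT z|lborel. gaussian 1 (z::'a))"
      by (rule integral_complex_of_real)
    then show ?thesis
      using integral_gaussian[where 'a='a, of 1] integral_mult_right_zero[of lborel "\<phi> x" "\<lambda>z. complex_of_real (gaussian 1 (z::'a))"] by simp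
  qed
  finally have "(\<lambda>n. LINT \<xi>|lborel. fourier \<phi> \<xi> * ?e n \<xi>) \<longlonglongrightarrow> \<phi> x"
    unfolding eq .
  with lim1 show ?thesis by (rule LIMSEQ_unique)
qed

lemma fourier_cnj_reflect:
  fixes w :: "'a::euclidean_space \<Rightarrow> complex"
  assumes w: "integrable lborel w"
  shows "integrable lborel (\<lambda>y. cnj (w (- y)))"
    and "fourier (\<lambda>y. cnj (w (- y))) x = cnj (fourier w x)"
proof -
  have [measurable]: "w \<in> borel_measurable borel" using w by auto
  have "integrable lborel (\<lambda>y. w (0 + (-1) *\<^sub>R y))"
    by (rule integrable_lborel_affine[OF w]) simp
  then show i: "integrable lborel (\<lambda>y. cnj (w (- y)))" by simp
  have "fourier (\<lambda>y. cnj (w (- y))) x = (LINT y|lborel. cnj (w (- y)) * character x y)"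
    by (rule fourier_lborel) (use borel_measurable_integrable[OF i] in simp)
  also have "\<dots> = \<bar>-1\<bar> ^ DIM('a) *\<^sub>R
      (LINT y|lborel. cnj (w (- (0 + (-1) *\<^sub>R y))) * character x (0 + (-1) *\<^sub>R y))"
    by (rule integral_lborel_affine[OF integrable_times_character[OF i]]) simp
  also have "\<dots> = (LINT y|lborel. cnj (w y * character x y))"
    by (simp add: exp_cnj)
  also have "\<dots> = cnj (fourier w x)"
    by (subst fourier_lborel) (auto simp del: complex_cnj_mult)
  finally show "fourier (\<lambda>y. cnj (w (- y))) x = cnj (fourier w x)" .
qed

text \<open>One half of Plancherel's theorem.  Two applications of the multiplication formula rewrite the
  integral of \<open>|F w|\<^sup>2\<close> against a Gaussian as the double integral of \<open>w(\<xi>) cnj (w(y)) G(\<xi> - y)\<close>, where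
  \<open>G\<close> is a symmetric probability density.  Bounding \<open>|w(\<xi>) w(y)|\<close> by
  \<open>(|w(\<xi>)|\<^sup>2 + |w(y)|\<^sup>2) / 2\<close> gives the squared norm of \<open>w\<close>, and Fatou's lemma removes the Gaussian.\<close>

theorem fourier_bessel_inequality:
  fixes w :: "'a::euclidean_space \<Rightarrow> complex"
  assumes w: "integrable lborel w" and w2: "integrable lborel (\<lambda>x. (norm (w x))\<^sup>2)"
  shows "integrable lborel (\<lambda>x. (norm (fourier w x))\<^sup>2)"
    and "(LINT x|lborel. (norm (fourier w x))\<^sup>2) \<le> (LINT x|lborel. (norm (w x))\<^sup>2)"
proof -
  define A where "A = (LINT x|lborel. (norm (w x))\<^sup>2)"
  have A0: "A \<ge> 0" by (simp add: A_def)
  have [measurable]: "w \<in> borel_measurable borel" "fourier w \<in> borel_measurable borel"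
    using w borel_measurable_fourier[of w] by auto
  have nnA: "(\<integral>\<^sup>+x. ennreal ((norm (w x))\<^sup>2) \<partial>lborel) = ennreal A"
    unfolding A_def by (rule nn_integral_eq_integral[OF w2]) simp
  have main: "(\<integral>\<^sup>+x. ennreal (gaussian c x * (norm (fourier w x))\<^sup>2) \<partial>lborel) \<le> ennreal A" if c: "c > 0" for c
  proof -
    \<comment> \<open>The transform of the Gaussian, a probability density.\<close>
    define G where "G z = gaussian (1 / c) z / c ^ DIM('a)" for z :: 'a
    have G0: "G z \<ge> 0" for z using c gaussian_pos[of "1 / c" z] by (simp add: G_def less_imp_le)
    have Gm [measurable]: "G \<in> borel_measurable borel" unfolding G_def[abs_def] by measurable
    have Gsym: "G (y - z) = G (z - y)" for y z
      using gaussian_minus[of "1 / c" "y - z"] by (simp add: G_def)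
    have Gi: "integrable lborel G"
      unfolding G_def[abs_def] using c by (intro integrable_divide integrable_gaussian) auto
    have G1: "integral\<^sup>L lborel G = 1"
      using c integral_gaussian[where 'a='a, of "1 / c"] by (simp add: G_def[abs_def] power_divide)
    have GA: "integrable lborel (\<lambda>y. G (z - y))" "(LINT y|lborel. G (z - y)) = 1" for z
      using integrable_lborel_affine[OF Gi, of "-1" z] integral_lborel_affine[OF Gi, of "-1" z] G1 by auto
    have nnG: "(\<integral>\<^sup>+y. ennreal (G (z - y)) \<partial>lborel) = 1" for z
      using nn_integral_eq_integral[OF GA(1)] GA(2) G0 by simp
    have Gbd: "norm (complex_of_real (G z)) \<le> 1 / c ^ DIM('a)" for z
      using gaussian_le_1[of "1 / c" z] gaussian_pos[of "1 / c" z] c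
      by (simp add: G_def norm_divide norm_power divide_right_mono)
    define h where "h x = complex_of_real (gaussian c x) * cnj (fourier w x)" for x :: 'a
    have gi: "integrable lborel (\<lambda>x::'a. complex_of_real (gaussian c x))"
      by (intro integrable_of_real integrable_gaussian c)
    have h: "integrable lborel h"
      unfolding h_def[abs_def] using norm_fourier_le[OF w]
      by (intro integrable_mult_bounded[OF gi]) auto
    note wt = fourier_cnj_reflect[OF w]
    have Fh: "fourier h \<xi> = (LINT y|lborel. cnj (w y) * of_real (G (\<xi> - y)))" for \<xi>
    proof -
      have "fourier h \<xi> = (LINT x|lborel. h x * character \<xi> x)"
        using h by (intro fourier_lborel) auto
      also have "\<dots> = (LINT x|lborel. fourier (\<lambda>y. cnj (w (- y))) x * (of_real (gaussian c x) * character (- (- \<xi>)) x))"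
        unfolding wt(2) by (simp add: h_def mult_ac)
      also have "\<dots> = (LINT y|lborel. cnj (w (- y)) *
          fourier (\<lambda>x. of_real (gaussian c x) * character (- (- \<xi>)) x) y)"
        by (intro fourier_multiplication_formula wt integrable_times_character gi)
      also have "\<dots> = (LINT y|lborel. cnj (w (- y)) * of_real (G (y + \<xi>)))"
        unfolding fourier_modulated_gaussian[OF c] by (simp add: G_def)
      also have "\<dots> = \<bar>-1\<bar> ^ DIM('a) *\<^sub>R
        (LINT y|lborel. cnj (w (- (0 + (-1) *\<^sub>R y))) * of_real (G ((0 + (-1) *\<^sub>R y) + \<xi>)))"
        by (rule integral_lborel_affine[OF integrable_mult_bounded[OF wt(1) _ Gbd]]) auto
      finally show ?thesis by simp
    qed
    have nFh: "ennreal (norm (fourier h \<xi>)) \<le> (\<integral>\<^sup>+y. ennreal (norm (w y) * G (\<xi> - y)) \<partial>lborel)" for \<xi>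
    proof -
      have "integrable lborel (\<lambda>y. cnj (w y) * of_real (G (\<xi> - y)))"
        using w by (intro integrable_mult_bounded[OF _ _ Gbd]) auto
      from integral_norm_bound_ennreal[OF this] show ?thesis
        unfolding Fh using G0 by (simp add: norm_mult)
    qed
    have "(LINT x|lborel. fourier w x * h x) = (LINT x|lborel. of_real (gaussian c x * (norm (fourier w x))\<^sup>2))"
      by (intro Bochner_Integration.integral_cong refl)
         (simp add: h_def complex_norm_square mult_ac del: of_real_power)
    then have e1: "(LINT x|lborel. w x * fourier h x) = of_real (LINT x|lborel. gaussian c x * (norm (fourier w x))\<^sup>2)"
      using fourier_multiplication_formula[OF w h] by (simp del: of_real_mult of_real_power)
    have "integrable lborel (\<lambda>x. norm (fourier w x * h x))"
      using integrable_mult_fourier[OF w h] by (simp add: mult.commute)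
    then have gWi: "integrable lborel (\<lambda>x. gaussian c x * (norm (fourier w x))\<^sup>2)"
      by (simp add: h_def norm_mult power2_eq_square mult_ac)
    have "(\<integral>\<^sup>+x. ennreal (gaussian c x * (norm (fourier w x))\<^sup>2) \<partial>lborel)
        = ennreal (LINT x|lborel. gaussian c x * (norm (fourier w x))\<^sup>2)"
      by (rule nn_integral_eq_integral[OF gWi]) (simp add: gaussian_pos less_imp_le)
    also have "\<dots> \<le> ennreal (norm (LINT x|lborel. w x * fourier h x))"
      unfolding e1 by (intro ennreal_leI) simp
    also have "\<dots> \<le> (\<integral>\<^sup>+x. norm (w x * fourier h x) \<partial>lborel)"
      by (rule integral_norm_bound_ennreal[OF integrable_mult_fourier[OF h w]])
    also have "\<dots> \<le> (\<integral>\<^sup>+x. ennreal (norm (w x)) * (\<integral>\<^sup>+y. ennreal (norm (w y) * G (x - y)) \<partial>lborel) \<partial>lborel)"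
      using nFh by (intro nn_integral_mono) (simp add: norm_mult ennreal_mult mult_left_mono)
    also have "\<dots> = (\<integral>\<^sup>+x. (\<integral>\<^sup>+y. ennreal (norm (w x)) * ennreal (norm (w y) * G (x - y)) \<partial>lborel) \<partial>lborel)"
      by (intro nn_integral_cong nn_integral_cmult[symmetric]) measurable
    also have "\<dots> \<le> (\<integral>\<^sup>+x. (\<integral>\<^sup>+y. ennreal ((norm (w x))\<^sup>2 / 2) * ennreal (G (x - y))
        + ennreal ((norm (w y))\<^sup>2 / 2) * ennreal (G (x - y)) \<partial>lborel) \<partial>lborel)"
    proof (intro nn_integral_mono)
      fix x y
      have "norm (w x) * norm (w y) \<le> (norm (w x))\<^sup>2 / 2 + (norm (w y))\<^sup>2 / 2"
        using sum_squares_bound[of "norm (w x)" "norm (w y)"] by simp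
      then have "norm (w x) * norm (w y) * G (x - y) \<le> ((norm (w x))\<^sup>2 / 2 + (norm (w y))\<^sup>2 / 2) * G (x - y)"
        by (rule mult_right_mono[OF _ G0])
      then show "ennreal (norm (w x)) * ennreal (norm (w y) * G (x - y)) \<le> ennreal ((norm (w x))\<^sup>2 / 2) * ennreal (G (x - y))
        + ennreal ((norm (w y))\<^sup>2 / 2) * ennreal (G (x - y))"
        using G0[of "x - y"]
        by (simp add: ennreal_mult[symmetric] ennreal_plus[symmetric] ring_distribs mult_ac ennreal_leI
            del: ennreal_plus)
    qed
    also have "\<dots> = (\<integral>\<^sup>+x. (\<integral>\<^sup>+y. ennreal ((norm (w x))\<^sup>2 / 2) * ennreal (G (x - y)) \<partial>lborel) \<partial>lborel)
        + (\<integral>\<^sup>+x. (\<integral>\<^sup>+y. ennreal ((norm (w y))\<^sup>2 / 2) * ennreal (G (x - y)) \<partial>lborel) \<partial>lborel)"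
      by (subst nn_integral_add[symmetric]) (auto intro!: nn_integral_cong nn_integral_add)
    also have "(\<integral>\<^sup>+x. (\<integral>\<^sup>+y. ennreal ((norm (w x))\<^sup>2 / 2) * ennreal (G (x - y)) \<partial>lborel) \<partial>lborel)
        = (\<integral>\<^sup>+x. ennreal ((norm (w x))\<^sup>2 / 2) \<partial>lborel)"
      by (subst nn_integral_cmult) (auto simp: nnG)
    also have "(\<integral>\<^sup>+x. (\<integral>\<^sup>+y. ennreal ((norm (w y))\<^sup>2 / 2) * ennreal (G (x - y)) \<partial>lborel) \<partial>lborel)
        = (\<integral>\<^sup>+y. (\<integral>\<^sup>+x. ennreal ((norm (w y))\<^sup>2 / 2) * ennreal (G (x - y)) \<partial>lborel) \<partial>lborel)"
      by (rule lborel_pair.Fubini') measurable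
    also have "\<dots> = (\<integral>\<^sup>+x. ennreal ((norm (w x))\<^sup>2 / 2) \<partial>lborel)"
      by (subst nn_integral_cmult) (auto simp: Gsym nnG)
    also have "(\<integral>\<^sup>+x. ennreal ((norm (w x))\<^sup>2 / 2) \<partial>lborel) + (\<integral>\<^sup>+x. ennreal ((norm (w x))\<^sup>2 / 2) \<partial>lborel) = ennreal A"
      by (subst nn_integral_add[symmetric]) (auto simp: ennreal_plus[symmetric] nnA simp del: ennreal_plus)
    finally show ?thesis .
  qed
  have le: "(\<integral>\<^sup>+x. ennreal ((norm (fourier w x))\<^sup>2) \<partial>lborel) \<le> ennreal A"
  proof -
    let ?f = "\<lambda>n x. ennreal (gaussian (1 / real (Suc n)) x * (norm (fourier w x))\<^sup>2)"
    have "(\<lambda>n. ?f n x) \<longlonglongrightarrow> ennreal (1 * (norm (fourier w x))\<^sup>2)" for x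
      by (intro tendsto_ennrealI tendsto_mult gaussian_scaled_tendsto_1 tendsto_const)
    then have "liminf (\<lambda>n. ?f n x) = ennreal ((norm (fourier w x))\<^sup>2)" for x
      using lim_imp_Liminf[OF sequentially_bot, of "\<lambda>n. ?f n x"] by simp
    then have "(\<integral>\<^sup>+x. ennreal ((norm (fourier w x))\<^sup>2) \<partial>lborel) = (\<integral>\<^sup>+x. liminf (\<lambda>n. ?f n x) \<partial>lborel)"
      by simp
    also have "\<dots> \<le> liminf (\<lambda>n. \<integral>\<^sup>+x. ?f n x \<partial>lborel)"
      by (rule nn_integral_liminf) measurable
    also have "\<dots> \<le> liminf (\<lambda>n. ennreal A)"
      by (intro Liminf_mono always_eventually allI main) simp
    also have "\<dots> = ennreal A" by (simp add: Liminf_const)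
    finally show ?thesis .
  qed
  show i: "integrable lborel (\<lambda>x. (norm (fourier w x))\<^sup>2)"
    using le by (intro integrableI_bounded) (auto simp: le_less_trans[OF _ ennreal_less_top])
  have "ennreal (LINT x|lborel. (norm (fourier w x))\<^sup>2) \<le> ennreal A"
    using nn_integral_eq_integral[OF i] le by simp
  then show "(LINT x|lborel. (norm (fourier w x))\<^sup>2) \<le> (LINT x|lborel. (norm (w x))\<^sup>2)"
    using A0 unfolding A_def by (simp add: ennreal_le_iff)
qed

section \<open>Partial derivatives and the Schwartz space\<close>

lemma partials_append: "partials (bs @ cs) f = partials bs (partials cs f)"
  by (induction bs) auto

lemma partial_eq:
  assumes "(f has_derivative D) (at x)"
  shows "partials [b] f x = D b"
  using frechet_derivative_at[OF assms] by simp

lemma has_vector_derivative_along: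
  assumes "f differentiable at (x + s *\<^sub>R b)"
  shows "((\<lambda>s. f (x + s *\<^sub>R b)) has_vector_derivative partials [b] f (x + s *\<^sub>R b)) (at s)"
proof -
  obtain D where D: "(f has_derivative D) (at (x + s *\<^sub>R b))"
    using assms by (auto simp: differentiable_def)
  have "((\<lambda>s. f (x + s *\<^sub>R b)) has_derivative (\<lambda>h. D (h *\<^sub>R b))) (at s)"
    by (rule has_derivative_compose[where g=f and f="\<lambda>s. x + s *\<^sub>R b", OF _ D])
       (auto intro!: derivative_eq_intros)
  moreover have "D (h *\<^sub>R b) = h *\<^sub>R partials [b] f (x + s *\<^sub>R b)" for h
    using linear_cmul[OF has_derivative_linear[OF D]] partial_eq[OF D] by simp
  ultimately show ?thesis by (simp add: has_vector_derivative_def)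
qed

text \<open>Smoothness is proved for a class of functions at once: if the class is closed under first partial
  derivatives, then only properties of its members, not of their higher derivatives, need checking.\<close>

lemma partials_coinduct:
  assumes "f \<in> S"
    and step: "\<And>g b. g \<in> S \<Longrightarrow> b \<in> Basis \<Longrightarrow> partials [b] g \<in> S"
    and "set bs \<subseteq> Basis"
  shows "partials bs f \<in> S"
  using assms(3)
proof (induction bs)
  case (Cons b bs)
  then have "partials [b] (partials bs f) \<in> S" by (intro step) auto
  then show ?case by simp
qed (use assms(1) in simp)

lemma smooth_coinduct:
  assumes "f \<in> S"
    and diff: "\<And>g x. g \<in> S \<Longrightarrow> g differentiable at x"
    and step: "\<And>g b. g \<in> S \<Longrightarrow> b \<in> Basis \<Longrightarrow> partials [b] g \<in> S"
  shows "smooth f"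
  unfolding smooth_def using partials_coinduct[of f S] assms by blast

lemma schwartz_coinduct:
  assumes "f \<in> S"
    and diff: "\<And>g x. g \<in> S \<Longrightarrow> g differentiable at x"
    and bdd: "\<And>g k. g \<in> S \<Longrightarrow> bdd_above (range (\<lambda>x. norm x ^ k * norm (g x)))"
    and step: "\<And>g b. g \<in> S \<Longrightarrow> b \<in> Basis \<Longrightarrow> partials [b] g \<in> S"
  shows "f \<in> schwartz"
  unfolding schwartz_def
  using smooth_coinduct[OF assms(1) diff step] bdd partials_coinduct[OF assms(1) step] by auto

lemma schwartz_partials: "\<phi> \<in> schwartz \<Longrightarrow> set bs \<subseteq> Basis \<Longrightarrow> partials bs \<phi> \<in> schwartz"
  unfolding schwartz_def smooth_def by (auto simp flip: partials_append)

lemma schwartz_differentiable: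
  assumes "\<phi> \<in> schwartz"
  shows "\<phi> differentiable at x"
proof -
  have "partials [] \<phi> differentiable at x"
    using assms unfolding schwartz_def smooth_def by (auto dest!: spec[of _ "[]"])
  then show ?thesis by simp
qed

lemma schwartz_continuous: "\<phi> \<in> schwartz \<Longrightarrow> continuous_on A \<phi>"
  by (intro continuous_at_imp_continuous_on ballI differentiable_imp_continuous_within schwartz_differentiable)

lemma schwartz_borel_measurable: "\<phi> \<in> schwartz \<Longrightarrow> \<phi> \<in> borel_measurable borel"
  by (intro borel_measurable_continuous_onI schwartz_continuous)

lemma schwartz_bdd: 
  assumes "\<phi> \<in> schwartz"
  shows "bdd_above (range (\<lambda>x. norm x ^ k * norm (\<phi> x)))"
proof -
  have "bdd_above (range (\<lambda>x. norm x ^ k * norm (partials [] \<phi> x)))"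
    using assms unfolding schwartz_def by (auto dest!: spec[of _ "[]"] spec[of _ k])
  then show ?thesis by simp
qed

lemma schwartz_seminorm_upper:
  assumes "\<phi> \<in> schwartz"
  shows "norm x ^ k * norm (\<phi> x) \<le> schwartz_seminorm k [] \<phi>"
  unfolding schwartz_seminorm_def
  using cSUP_upper[OF UNIV_I schwartz_bdd[OF assms, of k]] by simp

lemma schwartz_seminorm_partials:
  "schwartz_seminorm k [] (partials bs \<phi>) = schwartz_seminorm k bs \<phi>"
  by (simp add: schwartz_seminorm_def)

lemma schwartz_seminorm_nonneg:
  assumes "\<phi> \<in> schwartz" "set bs \<subseteq> Basis"
  shows "0 \<le> schwartz_seminorm k bs \<phi>"
proof -
  have "0 \<le> norm (0::'a) ^ k * norm (partials bs \<phi> 0)" by simp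
  also have "\<dots> \<le> schwartz_seminorm k [] (partials bs \<phi>)"
    by (rule schwartz_seminorm_upper[OF schwartz_partials[OF assms]])
  finally show ?thesis by (simp add: schwartz_seminorm_partials)
qed

lemma decay_1: "decay 1 x = inverse (\<Prod>b\<in>Basis. 1 + (x \<bullet> b)\<^sup>2)"
proof -
  have "1 + s\<^sup>2 > 0" for s :: real by (simp add: add_pos_nonneg)
  then show ?thesis
    by (simp add: decay_def powr_minus prod_inversef[unfolded comp_def])
qed

lemma decay_1_le_1: "decay 1 x \<le> 1"
proof -
  have "1 \<le> (\<Prod>b\<in>Basis. 1 + (x \<bullet> b)\<^sup>2)" by (intro prod_ge_1) auto
  then show ?thesis by (simp add: decay_1 inverse_le_1_iff)
qed

text \<open>The product of the factors \<open>1 + x\<^sub>b\<^sup>2\<close> is at most \<open>(1 + |x|\<^sup>2)\<^sup>N\<close>, which the two seminorms of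
  order \<open>0\<close> and \<open>2 N\<close> control.\<close>

lemma schwartz_decay:
  fixes \<phi> :: "'a::euclidean_space \<Rightarrow> complex"
  assumes "\<phi> \<in> schwartz"
  defines "n \<equiv> DIM('a)"
  shows "norm (\<phi> x) \<le> 2 ^ n * (schwartz_seminorm 0 [] \<phi> + schwartz_seminorm (2 * n) [] \<phi>) * decay 1 x"
proof -
  define r where "r = (norm x)\<^sup>2"
  define p where "p = (\<Prod>b\<in>Basis. 1 + (x \<bullet> b)\<^sup>2)"
  have p1: "1 \<le> p" unfolding p_def by (intro prod_ge_1) auto
  have "p \<le> (\<Prod>b\<in>(Basis::'a set). 1 + r)"
    unfolding p_def r_def
    by (intro prod_mono conjI add_left_mono) (auto simp: abs_le_square_iff[symmetric] Basis_le_norm)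
  also have "\<dots> = (1 + r) ^ n" by (simp add: n_def)
  also have "\<dots> \<le> (2 * max 1 r) ^ n" by (intro power_mono) (auto simp: r_def)
  also have "\<dots> = 2 ^ n * max 1 r ^ n" by (rule power_mult_distrib)
  also have "max 1 r ^ n \<le> 1 + r ^ n" by (cases "r \<le> 1") (auto simp: max_def r_def)
  finally have p: "p \<le> 2 ^ n * (1 + r ^ n)" by simp
  have "norm (\<phi> x) * p \<le> norm (\<phi> x) * (2 ^ n * (1 + r ^ n))"
    by (intro mult_left_mono p) auto
  also have "\<dots> = 2 ^ n * (norm x ^ 0 * norm (\<phi> x) + norm x ^ (2 * n) * norm (\<phi> x))"
    by (simp add: r_def algebra_simps flip: power_mult)
  also have "\<dots> \<le> 2 ^ n * (schwartz_seminorm 0 [] \<phi> + schwartz_seminorm (2 * n) [] \<phi>)"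
    by (intro mult_left_mono add_mono schwartz_seminorm_upper assms) auto
  finally have "norm (\<phi> x) * p \<le> \<dots>" .
  then show ?thesis
    using p1 unfolding decay_1 p_def[symmetric] by (simp add: field_simps)
qed

lemma schwartz_decayE:
  assumes "\<phi> \<in> schwartz"
  obtains C where "C \<ge> 0" "\<And>x. norm (\<phi> x) \<le> C * decay 1 x"
proof
  define C where "C = 2 ^ DIM('a) * (schwartz_seminorm 0 [] \<phi> + schwartz_seminorm (2 * DIM('a)) [] \<phi>)"
  show "norm (\<phi> x) \<le> C * decay 1 x" for x
    using schwartz_decay[OF assms] by (simp add: C_def)
  show "C \<ge> 0" using schwartz_seminorm_nonneg[OF assms, of "[]"] by (simp add: C_def)
qed

lemma schwartz_bounded:
  assumes "\<phi> \<in> schwartz"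
  obtains C where "C \<ge> 0" "\<And>x. norm (\<phi> x) \<le> C"
proof -
  obtain C where C: "C \<ge> 0" "\<And>x. norm (\<phi> x) \<le> C * decay 1 x"
    using schwartz_decayE[OF assms] by blast
  have "norm (\<phi> x) \<le> C" for x
    using C(2)[of x] mult_left_mono[OF decay_1_le_1[of x] C(1)] by simp
  with C(1) show ?thesis by (rule that)
qed

lemma integrable_decay_bound:
  fixes f :: "'a::euclidean_space \<Rightarrow> 'b::{banach, second_countable_topology}"
  assumes "f \<in> borel_measurable borel" "\<And>x. norm (f x) \<le> C * decay 1 x"
  shows "integrable lborel f"
proof (rule Bochner_Integration.integrable_bound)
  show "integrable lborel (\<lambda>x::'a. C * decay 1 x)"
    by (intro integrable_mult_right integrable_decay) simp
  show "AE x in lborel. norm (f x) \<le> norm (C * decay 1 x)"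
    using assms(2) by (intro AE_I2) (metis abs_ge_self order_trans real_norm_def)
qed (use assms in auto)

lemma schwartz_integrable: "\<phi> \<in> schwartz \<Longrightarrow> integrable lborel \<phi>"
  using schwartz_decayE integrable_decay_bound schwartz_borel_measurable by metis

lemma schwartz_linear:
  assumes "\<phi> \<in> schwartz" "\<psi> \<in> schwartz"
  shows "(\<lambda>x. c * \<phi> x + \<psi> x) \<in> schwartz"
proof (rule schwartz_coinduct[of _ "{\<lambda>x. c * \<phi> x + \<psi> x | \<phi> \<psi>. \<phi> \<in> schwartz \<and> \<psi> \<in> schwartz}"])
  fix g assume "g \<in> {\<lambda>x. c * \<phi> x + \<psi> x | \<phi> \<psi>. \<phi> \<in> schwartz \<and> \<psi> \<in> schwartz}"
  then obtain \<phi> \<psi> where g: "g = (\<lambda>x. c * \<phi> x + \<psi> x)" and mem: "\<phi> \<in> schwartz" "\<psi> \<in> schwartz"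
    by auto
  have D: "(g has_derivative (\<lambda>h. c * (frechet_derivative \<phi> (at x)) h + (frechet_derivative \<psi> (at x)) h)) (at x)" for x
    unfolding g using schwartz_differentiable mem
    by (intro derivative_intros has_derivative_mult_right) (auto simp: frechet_derivative_works[symmetric])
  show "g differentiable at x" for x using D[of x] by (auto simp: differentiable_def)
  show "bdd_above (range (\<lambda>x. norm x ^ k * norm (g x)))" for k
  proof (rule bdd_aboveI2)
    fix x
    have "norm x ^ k * norm (g x) \<le> norm x ^ k * (norm c * norm (\<phi> x) + norm (\<psi> x))"
      unfolding g by (intro mult_left_mono) (metis norm_mult norm_triangle_ineq, simp)
    also have "\<dots> = norm c * (norm x ^ k * norm (\<phi> x)) + norm x ^ k * norm (\<psi> x)"
      by (simp add: algebra_simps)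
    also have "\<dots> \<le> norm c * schwartz_seminorm k [] \<phi> + schwartz_seminorm k [] \<psi>"
      by (intro add_mono mult_left_mono schwartz_seminorm_upper mem) auto
    finally show "norm x ^ k * norm (g x) \<le> norm c * schwartz_seminorm k [] \<phi> + schwartz_seminorm k [] \<psi>" .
  qed
  show "partials [b] g \<in> {\<lambda>x. c * \<phi> x + \<psi> x | \<phi> \<psi>. \<phi> \<in> schwartz \<and> \<psi> \<in> schwartz}" if "b \<in> Basis" for b
  proof -
    have "partials [b] g = (\<lambda>x. c * partials [b] \<phi> x + partials [b] \<psi> x)"
      using partial_eq[OF D] by (auto simp: fun_eq_iff)
    moreover have "partials [b] \<phi> \<in> schwartz" "partials [b] \<psi> \<in> schwartz"
      using that by (intro schwartz_partials mem; simp)+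
    ultimately show ?thesis by blast
  qed
qed (use assms in blast)

lemma schwartz_zero: "(\<lambda>x. 0) \<in> schwartz"
proof (rule schwartz_coinduct[of _ "{\<lambda>x. 0}"])
  show "partials [b] g \<in> {\<lambda>x. 0}" if "g \<in> {\<lambda>x. 0}" for g :: "'a \<Rightarrow> complex" and b
  proof -
    have "(g has_derivative (\<lambda>h. 0)) (at x)" for x using that by simp
    from partial_eq[OF this] show ?thesis by auto
  qed
qed auto

lemma schwartz_cmult: "\<phi> \<in> schwartz \<Longrightarrow> (\<lambda>x. c * \<phi> x) \<in> schwartz"
  using schwartz_linear[OF _ schwartz_zero] by simp

lemma schwartz_add: "\<phi> \<in> schwartz \<Longrightarrow> \<psi> \<in> schwartz \<Longrightarrow> (\<lambda>x. \<phi> x + \<psi> x) \<in> schwartz"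
  using schwartz_linear[of \<phi> \<psi> 1] by simp

lemma schwartz_sum:
  assumes "\<And>i. i \<in> I \<Longrightarrow> \<phi> i \<in> schwartz"
  shows "(\<lambda>x. \<Sum>i\<in>I. \<phi> i x) \<in> schwartz"
  using assms by (induction I rule: infinite_finite_induct) (auto intro: schwartz_zero schwartz_add)

text \<open>The products \<open>x\<^sub>b \<phi>\<close> alone are not closed under differentiation, but the sums \<open>x\<^sub>b \<phi> + \<psi>\<close> are.\<close>

lemma schwartz_coordinate_mult:
  fixes \<phi> :: "'a::euclidean_space \<Rightarrow> complex"
  assumes "\<phi> \<in> schwartz" "b \<in> Basis"
  shows "(\<lambda>x. of_real (x \<bullet> b) * \<phi> x) \<in> schwartz"
proof -
  let ?S = "{\<lambda>x::'a. of_real (x \<bullet> b) * \<phi> x + \<psi> x | \<phi> \<psi>. \<phi> \<in> schwartz \<and> \<psi> \<in> schwartz}"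
  have "(\<lambda>x. of_real (x \<bullet> b) * \<phi> x + 0) \<in> schwartz"
  proof (rule schwartz_coinduct[of _ ?S])
    show "(\<lambda>x. of_real (x \<bullet> b) * \<phi> x + 0) \<in> ?S"
      by (intro CollectI exI[of _ \<phi>] exI[of _ "\<lambda>x. 0"] conjI refl assms(1) schwartz_zero)
  next
    fix g assume "g \<in> ?S"
    then obtain \<phi> \<psi> where g: "g = (\<lambda>x. of_real (x \<bullet> b) * \<phi> x + \<psi> x)"
      and mem: "\<phi> \<in> schwartz" "\<psi> \<in> schwartz"
      by auto
    have D: "(g has_derivative (\<lambda>h. of_real (x \<bullet> b) * frechet_derivative \<phi> (at x) h + of_real (h \<bullet> b) * \<phi> x
        + frechet_derivative \<psi> (at x) h)) (at x)" for x
      unfolding g using schwartz_differentiable mem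
      by (intro has_derivative_add has_derivative_mult has_derivative_of_real has_derivative_inner_left
          has_derivative_ident) (auto simp: frechet_derivative_works[symmetric])
    show "g differentiable at x" for x using D[of x] by (auto simp: differentiable_def)
    show "bdd_above (range (\<lambda>x. norm x ^ k * norm (g x)))" for k
    proof (rule bdd_aboveI2)
      fix x
      have "norm (g x) \<le> norm x * norm (\<phi> x) + norm (\<psi> x)"
        unfolding g using Basis_le_norm[OF assms(2), of x]
        by (intro order_trans[OF norm_triangle_ineq] add_right_mono) (simp add: norm_mult mult_right_mono)
      then have "norm x ^ k * norm (g x) \<le> norm x ^ k * (norm x * norm (\<phi> x) + norm (\<psi> x))"
        by (intro mult_left_mono) auto
      also have "\<dots> = norm x ^ Suc k * norm (\<phi> x) + norm x ^ k * norm (\<psi> x)"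
        by (simp add: algebra_simps)
      also have "\<dots> \<le> schwartz_seminorm (Suc k) [] \<phi> + schwartz_seminorm k [] \<psi>"
        by (intro add_mono schwartz_seminorm_upper mem)
      finally show "norm x ^ k * norm (g x) \<le> schwartz_seminorm (Suc k) [] \<phi> + schwartz_seminorm k [] \<psi>" .
    qed
    show "partials [c] g \<in> ?S" if "c \<in> Basis" for c
    proof -
      have mem': "partials [c] \<phi> \<in> schwartz" "partials [c] \<psi> \<in> schwartz"
        using that by (intro schwartz_partials mem; simp)+
      have "partials [c] g = (\<lambda>x. of_real (x \<bullet> b) * partials [c] \<phi> x + (of_real (c \<bullet> b) * \<phi> x + partials [c] \<psi> x))"
        using partial_eq[OF D] by (auto simp: fun_eq_iff)
      moreover have "(\<lambda>x. of_real (c \<bullet> b) * \<phi> x + partials [c] \<psi> x) \<in> schwartz"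
        by (intro schwartz_linear mem mem')
      ultimately show ?thesis using mem'(1) by (intro CollectI exI conjI)
    qed
  qed
  then show ?thesis by simp
qed

lemma test_functions_subset_schwartz: "test_functions \<subseteq> schwartz"
proof
  fix \<phi> :: "'a \<Rightarrow> complex" assume \<phi>: "\<phi> \<in> test_functions"
  define K where "K = closure {x. \<phi> x \<noteq> 0}"
  have K: "compact K" "open (- K)" using \<phi> by (auto simp: K_def test_functions_def)
  have sm: "smooth \<phi>" using \<phi> by (simp add: test_functions_def)
  have out: "partials bs \<phi> x = 0" if "x \<notin> K" for bs x
    using that
  proof (induction bs arbitrary: x)
    case Nil
    then show ?case using closure_subset[of "{x. \<phi> x \<noteq> 0}"] by (auto simp: K_def)
  next
    case (Cons b bs)
    have "((\<lambda>x. 0) has_derivative (\<lambda>h. 0)) (at x)" by simp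
    then have "(partials bs \<phi> has_derivative (\<lambda>h. 0)) (at x)"
      by (rule has_derivative_transform_within_open[OF _ K(2)]) (use Cons in auto)
    from frechet_derivative_at[OF this] show ?case by (metis partials.simps(2))
  qed
  have "bdd_above (range (\<lambda>x. norm x ^ k * norm (partials bs \<phi> x)))" if "set bs \<subseteq> Basis" for k bs
  proof -
    have "continuous_on K (\<lambda>x. norm x ^ k * norm (partials bs \<phi> x))"
      using sm that unfolding smooth_def
      by (intro continuous_intros continuous_at_imp_continuous_on ballI differentiable_imp_continuous_within) auto
    then have "bounded ((\<lambda>x. norm x ^ k * norm (partials bs \<phi> x)) ` K)"
      using K(1) by (intro compact_imp_bounded compact_continuous_image)
    then obtain B where B: "\<And>x. x \<in> K \<Longrightarrow> norm x ^ k * norm (partials bs \<phi> x) \<le> B"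
      by (auto simp: bounded_iff)
    show ?thesis
    proof (rule bdd_aboveI2)
      show "norm x ^ k * norm (partials bs \<phi> x) \<le> max B 0" for x
        using B[of x] out[of x bs] by (cases "x \<in> K") auto
    qed
  qed
  then show "\<phi> \<in> schwartz" using sm by (simp add: schwartz_def)
qed

lemma laplacian_schwartz: "\<phi> \<in> schwartz \<Longrightarrow> laplacian \<phi> \<in> schwartz"
  unfolding laplacian_def by (intro schwartz_sum schwartz_partials) auto

section \<open>The Fourier transform on the Schwartz space\<close>

text \<open>Lets \<open>decay 1\<close> dominate all difference quotients with step at most \<open>1\<close> of a function whose
  derivative it dominates.\<close>

lemma decay_shift:
  fixes x b :: "'a::euclidean_space"
  assumes b: "b \<in> Basis" and s: "\<bar>s\<bar> \<le> 1"
  shows "decay 1 (x + s *\<^sub>R b) \<le> 3 * decay 1 x"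
proof -
  have pos: "1 + r\<^sup>2 > 0" for r :: real by (simp add: add_pos_nonneg)
  have fac: "1 + (x \<bullet> c)\<^sup>2 \<le> (if c = b then 3 else 1) * (1 + ((x + s *\<^sub>R b) \<bullet> c)\<^sup>2)" if "c \<in> Basis" for c
  proof (cases "c = b")
    case True
    have aux: "1 + p \<le> 3 * (1 + u)" if "p \<le> 2 * u + 2 * v" "v \<le> 1" "0 \<le> u" for p u v :: real
      using that by (simp add: algebra_simps)
    have "(x \<bullet> b)\<^sup>2 \<le> 2 * (x \<bullet> b + s)\<^sup>2 + 2 * s\<^sup>2"
      using sum_squares_bound[of "x \<bullet> b + s" "- s"] by (simp add: power2_eq_square algebra_simps)
    moreover have "s\<^sup>2 \<le> 1" using s by (simp add: abs_square_le_1)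
    ultimately have "1 + (x \<bullet> b)\<^sup>2 \<le> 3 * (1 + (x \<bullet> b + s)\<^sup>2)"
      by (rule aux) simp
    then show ?thesis using True b by (simp add: inner_add_left)
  next
    case False
    then show ?thesis using b that by (simp add: inner_add_left inner_Basis)
  qed
  have "(\<Prod>c\<in>Basis. 1 + (x \<bullet> c)\<^sup>2) \<le> (\<Prod>c\<in>Basis. (if c = b then 3 else 1) * (1 + ((x + s *\<^sub>R b) \<bullet> c)\<^sup>2))"
    by (intro prod_mono conjI fac) (simp_all add: pos less_imp_le)
  also have "\<dots> = 3 * (\<Prod>c\<in>Basis. 1 + ((x + s *\<^sub>R b) \<bullet> c)\<^sup>2)"
    using b by (simp add: prod.distrib prod.delta)
  finally have "(\<Prod>c\<in>Basis. 1 + (x \<bullet> c)\<^sup>2) \<le> 3 * (\<Prod>c\<in>Basis. 1 + ((x + s *\<^sub>R b) \<bullet> c)\<^sup>2)" .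
  moreover have "(\<Prod>c\<in>Basis. 1 + (y \<bullet> c)\<^sup>2) > 0" for y :: 'a
    by (intro prod_pos pos)
  ultimately show ?thesis
    unfolding decay_1 by (simp add: field_simps)
qed

text \<open>By translation invariance the difference quotients of \<open>\<psi>\<close> have integral \<open>0\<close>.  They are dominated
  by a multiple of \<open>decay 1\<close> through the mean value inequality, so the limit has integral \<open>0\<close> as well.\<close>

lemma integral_directional_derivative_zero:
  fixes \<psi> D :: "'a::euclidean_space \<Rightarrow> complex"
  assumes b: "b \<in> Basis" and int: "integrable lborel \<psi>"
    and deriv: "\<And>x s. ((\<lambda>s. \<psi> (x + s *\<^sub>R b)) has_vector_derivative D (x + s *\<^sub>R b)) (at s)"
    and meas [measurable]: "D \<in> borel_measurable borel"
    and bound: "\<And>x. norm (D x) \<le> C * decay 1 x"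
  shows "integral\<^sup>L lborel D = 0"
proof -
  define h where "h n = 1 / real (Suc n)" for n
  have h: "0 < h n" "h n \<le> 1" for n by (auto simp: h_def divide_simps)
  have h0: "h \<longlonglongrightarrow> 0"
    unfolding h_def by (rule LIMSEQ_inverse_real_of_nat[unfolded inverse_eq_divide])
  have [measurable]: "\<psi> \<in> borel_measurable borel" using int by auto
  define q where "q n x = (\<psi> (x + h n *\<^sub>R b) - \<psi> x) /\<^sub>R h n" for n x
  have C: "C \<ge> 0"
    using bound[of 0] decay_pos[of 1 "0::'a"] norm_ge_zero[of "D 0"]
    by (meson order_trans zero_le_mult_iff not_le less_le_trans)
  have shift: "integrable lborel (\<lambda>x. \<psi> (x + h n *\<^sub>R b))"
      "(LINT x|lborel. \<psi> (x + h n *\<^sub>R b)) = integral\<^sup>L lborel \<psi>" for n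
    using integrable_lborel_affine[OF int, of 1 "h n *\<^sub>R b"]
      integral_lborel_affine[OF int, of 1 "h n *\<^sub>R b"] by (simp_all add: add.commute)
  have q0: "integral\<^sup>L lborel (q n) = 0" for n
    unfolding q_def[abs_def] using shift int by simp
  have "(\<lambda>n. integral\<^sup>L lborel (q n)) \<longlonglongrightarrow> integral\<^sup>L lborel D"
  proof (rule integral_dominated_convergence)
    show "integrable lborel (\<lambda>x::'a. 3 * C * decay 1 x)"
      by (intro integrable_mult_right integrable_decay) simp
    show "AE x in lborel. norm (q n x) \<le> 3 * C * decay 1 x" for n
    proof (intro AE_I2)
      fix x
      have "norm (\<psi> (x + h n *\<^sub>R b) - \<psi> (x + 0 *\<^sub>R b)) \<le> (3 * C * decay 1 x) * norm (h n - 0)"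
      proof (rule differentiable_bound[of "{0..h n}"])
        fix s assume s: "s \<in> {0..h n}"
        show "((\<lambda>s. \<psi> (x + s *\<^sub>R b)) has_derivative (\<lambda>d. d *\<^sub>R D (x + s *\<^sub>R b))) (at s within {0..h n})"
          using deriv[of x s] unfolding has_vector_derivative_def by (rule has_derivative_at_withinI)
        have dB: "norm (D (x + s *\<^sub>R b)) \<le> C * (3 * decay 1 x)"
          using s h(2)[of n]
          by (intro order_trans[OF bound] mult_left_mono decay_shift b C) auto
        have "norm (d *\<^sub>R D (x + s *\<^sub>R b)) \<le> 3 * C * decay 1 x * norm d" for d
          using mult_right_mono[OF dB, of "\<bar>d\<bar>"] by (simp add: mult_ac)
        then show "onorm (\<lambda>d. d *\<^sub>R D (x + s *\<^sub>R b)) \<le> 3 * C * decay 1 x"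
          by (rule onorm_le)
      qed (use h[of n] in auto)
      then show "norm (q n x) \<le> 3 * C * decay 1 x"
        using h(1)[of n] by (simp add: q_def divide_simps mult_ac)
    qed
    show "AE x in lborel. (\<lambda>n. q n x) \<longlonglongrightarrow> D x"
    proof (intro AE_I2)
      fix x
      have "((\<lambda>s. \<psi> (x + s *\<^sub>R b)) has_derivative (\<lambda>d. d *\<^sub>R D x)) (at 0)"
        using deriv[of x 0] by (simp add: has_vector_derivative_def)
      then have "(\<lambda>s. norm (\<psi> (x + s *\<^sub>R b) - \<psi> x - s *\<^sub>R D x) / norm s) \<midarrow>0\<rightarrow> 0"
        by (simp add: has_derivative_at)
      then have "(\<lambda>n. norm (\<psi> (x + h n *\<^sub>R b) - \<psi> x - h n *\<^sub>R D x) / norm (h n)) \<longlonglongrightarrow> 0"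
      proof (rule filterlim_compose)
        show "filterlim h (at 0) sequentially"
          using h0 h(1) by (intro filterlim_atI) (auto simp: less_imp_neq[symmetric])
      qed
      moreover have "norm (\<psi> (x + h n *\<^sub>R b) - \<psi> x - h n *\<^sub>R D x) / norm (h n) = norm (q n x - D x)" for n
      proof -
        have "q n x - D x = (\<psi> (x + h n *\<^sub>R b) - \<psi> x - h n *\<^sub>R D x) /\<^sub>R h n"
          using h(1)[of n] by (simp add: q_def scaleR_diff_right)
        then show ?thesis using h(1)[of n] by (simp add: divide_inverse mult.commute)
      qed
      ultimately have "(\<lambda>n. norm (q n x - D x)) \<longlonglongrightarrow> 0" by simp
      then show "(\<lambda>n. q n x) \<longlonglongrightarrow> D x"
        by (simp add: tendsto_norm_zero_iff LIM_zero_iff)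
    qed
  qed (auto simp: q_def[abs_def])
  then show ?thesis unfolding q0 by (simp add: LIMSEQ_const_iff)
qed

lemma schwartz_integration_by_parts:
  fixes \<phi> e :: "'a::euclidean_space \<Rightarrow> complex"
  assumes \<phi>: "\<phi> \<in> schwartz" and b: "b \<in> Basis"
    and diff: "\<And>x. e differentiable at x" and e: "\<And>x. norm (e x) \<le> E"
    and e': "partials [b] e \<in> borel_measurable borel" "\<And>x. norm (partials [b] e x) \<le> E'"
  shows "(LINT x|lborel. partials [b] \<phi> x * e x) = - (LINT x|lborel. \<phi> x * partials [b] e x)"
proof -
  let ?D = "\<lambda>x. \<phi> x * partials [b] e x + partials [b] \<phi> x * e x"
  have p\<phi>: "partials [b] \<phi> \<in> schwartz" using b by (intro schwartz_partials \<phi>) auto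
  note meas = schwartz_borel_measurable[OF \<phi>] schwartz_borel_measurable[OF p\<phi>] e'(1)
  have em: "e \<in> borel_measurable borel"
    by (intro borel_measurable_continuous_onI continuous_at_imp_continuous_on ballI
        differentiable_imp_continuous_within diff)
  obtain C where C: "C \<ge> 0" "\<And>x. norm (\<phi> x) \<le> C * decay 1 x"
    using schwartz_decayE[OF \<phi>] by blast
  obtain C' where C': "C' \<ge> 0" "\<And>x. norm (partials [b] \<phi> x) \<le> C' * decay 1 x"
    using schwartz_decayE[OF p\<phi>] by blast
  have "integral\<^sup>L lborel ?D = 0"
  proof (rule integral_directional_derivative_zero[OF b, of "\<lambda>x. \<phi> x * e x"])
    show "integrable lborel (\<lambda>x. \<phi> x * e x)"
      by (rule integrable_mult_bounded[OF schwartz_integrable[OF \<phi>] em e])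
    show "((\<lambda>s. \<phi> (x + s *\<^sub>R b) * e (x + s *\<^sub>R b)) has_vector_derivative ?D (x + s *\<^sub>R b)) (at s)" for x s
      by (intro has_vector_derivative_mult has_vector_derivative_along schwartz_differentiable \<phi> diff)
    show "?D \<in> borel_measurable borel"
      using meas em by (intro borel_measurable_add borel_measurable_times) auto
    show "norm (?D x) \<le> (C * E' + C' * E) * decay 1 x" for x
    proof -
      have d: "0 \<le> decay 1 x" by (simp add: decay_pos less_imp_le)
      have "norm (?D x) \<le> norm (\<phi> x) * norm (partials [b] e x) + norm (partials [b] \<phi> x) * norm (e x)"
        by (rule order_trans[OF norm_triangle_ineq]) (simp add: norm_mult)
      also have "\<dots> \<le> (C * decay 1 x) * E' + (C' * decay 1 x) * E"
        using C C' d by (intro add_mono mult_mono e e'(2)) auto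
      finally show ?thesis by (simp add: algebra_simps)
    qed
  qed
  moreover have "integral\<^sup>L lborel ?D
      = (LINT x|lborel. \<phi> x * partials [b] e x) + (LINT x|lborel. partials [b] \<phi> x * e x)"
    by (intro Bochner_Integration.integral_add integrable_mult_bounded[OF _ e'(1) e'(2)]
        integrable_mult_bounded[OF _ em e] schwartz_integrable \<phi> p\<phi>)
  ultimately show ?thesis by (simp add: eq_neg_iff_add_eq_0 add.commute)
qed

lemma character_has_derivative:
  "(character \<xi> has_derivative (\<lambda>h. - 2 * of_real pi * \<i> * of_real (h \<bullet> \<xi>) * character \<xi> x)) (at x)"
proof -
  have "((\<lambda>x. - 2 * complex_of_real pi * \<i> * of_real (x \<bullet> \<xi>)) has_derivative
      (\<lambda>h. - 2 * of_real pi * \<i> * of_real (h \<bullet> \<xi>))) (at x)"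
    by (intro has_derivative_mult_right has_derivative_of_real has_derivative_inner_left has_derivative_ident)
  from has_derivative_compose[OF this DERIV_exp[unfolded has_field_derivative_def]]
  show ?thesis by (simp add: mult.commute)
qed

lemma partial_character:
  "partials [b] (character \<xi>) = (\<lambda>x. - 2 * of_real pi * \<i> * of_real (b \<bullet> \<xi>) * character \<xi> x)"
  using partial_eq[OF character_has_derivative] by (simp only: fun_eq_iff) blast

lemma fourier_schwartz: "\<phi> \<in> schwartz \<Longrightarrow> fourier \<phi> \<xi> = (LINT x|lborel. \<phi> x * character \<xi> x)"
  by (intro fourier_lborel schwartz_borel_measurable)

lemma fourier_partial:
  assumes \<phi>: "\<phi> \<in> schwartz" and b: "b \<in> Basis"
  shows "fourier (partials [b] \<phi>) \<xi> = 2 * of_real pi * \<i> * of_real (\<xi> \<bullet> b) * fourier \<phi> \<xi>"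
proof -
  have "fourier (partials [b] \<phi>) \<xi> = (LINT x|lborel. partials [b] \<phi> x * character \<xi> x)"
    using b by (intro fourier_schwartz schwartz_partials \<phi>) auto
  also have "\<dots> = - (LINT x|lborel. \<phi> x * partials [b] (character \<xi>) x)"
  proof (rule schwartz_integration_by_parts[OF \<phi> b, where E=1 and E'="2 * pi * \<bar>b \<bullet> \<xi>\<bar>"])
    show "character \<xi> differentiable at x" for x
      using character_has_derivative[of \<xi> x] unfolding differentiable_def by blast
    show "partials [b] (character \<xi>) \<in> borel_measurable borel"
      unfolding partial_character by measurable
    show "norm (partials [b] (character \<xi>) x) \<le> 2 * pi * \<bar>b \<bullet> \<xi>\<bar>" for x
      unfolding partial_character norm_mult norm_character by simp
  qed simp
  also have "\<dots> = (LINT x|lborel. 2 * of_real pi * \<i> * of_real (\<xi> \<bullet> b) * (\<phi> x * character \<xi> x))"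
    unfolding partial_character by (simp add: inner_commute mult_ac flip: integral_minus)
  also have "\<dots> = 2 * of_real pi * \<i> * of_real (\<xi> \<bullet> b) * fourier \<phi> \<xi>"
    unfolding fourier_schwartz[OF \<phi>]
    by (intro Bochner_Integration.integral_mult_right integrable_times_character schwartz_integrable \<phi>)
  finally show ?thesis .
qed

text \<open>The multiplier by which the transform turns \<open>partials bs\<close> into a product.\<close>

definition symbol :: "'a::euclidean_space list \<Rightarrow> 'a \<Rightarrow> complex" where
  "symbol bs \<xi> = prod_list (map (\<lambda>b. 2 * of_real pi * \<i> * of_real (\<xi> \<bullet> b)) bs)"

lemma symbol_simps [simp]:
  "symbol [] \<xi> = 1"
  "symbol (b # bs) \<xi> = 2 * of_real pi * \<i> * of_real (\<xi> \<bullet> b) * symbol bs \<xi>"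
  by (simp_all add: symbol_def)

lemma norm_symbol_replicate: "norm (symbol (replicate k b) \<xi>) = (2 * pi * \<bar>\<xi> \<bullet> b\<bar>) ^ k"
  by (induction k) (auto simp: norm_mult)

lemma symbol_rev: "symbol (rev bs) \<xi> = symbol bs \<xi>"
  by (simp add: symbol_def rev_map[symmetric])

lemma borel_measurable_symbol [measurable]: "symbol bs \<in> borel_measurable borel"
proof (induction bs)
  case (Cons b bs)
  note this[measurable]
  have "symbol (b # bs) = (\<lambda>\<xi>. 2 * of_real pi * \<i> * of_real (\<xi> \<bullet> b) * symbol bs \<xi>)"
    by (rule ext) (rule symbol_simps(2))
  moreover have "(\<lambda>\<xi>. 2 * of_real pi * \<i> * of_real (\<xi> \<bullet> b) * symbol bs \<xi>) \<in> borel_measurable borel"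
    by measurable
  ultimately show ?case by simp
next
  case Nil
  have "symbol [] = (\<lambda>_::'a. 1)" by (rule ext) (rule symbol_simps(1))
  then show ?case by simp
qed

lemma fourier_partials:
  assumes \<phi>: "\<phi> \<in> schwartz" and "set bs \<subseteq> Basis"
  shows "fourier (partials bs \<phi>) \<xi> = symbol bs \<xi> * fourier \<phi> \<xi>"
  using assms(2)
proof (induction bs)
  case (Cons b bs)
  have "fourier (partials [b] (partials bs \<phi>)) \<xi>
      = 2 * of_real pi * \<i> * of_real (\<xi> \<bullet> b) * fourier (partials bs \<phi>) \<xi>"
    using Cons.prems by (intro fourier_partial schwartz_partials \<phi>) auto
  also have "fourier (partials bs \<phi>) \<xi> = symbol bs \<xi> * fourier \<phi> \<xi>"
    using Cons by simp
  finally show ?case by (simp add: mult.assoc)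
qed simp

lemma fourier_laplacian:
  fixes \<phi> :: "'a::euclidean_space \<Rightarrow> complex"
  assumes \<phi>: "\<phi> \<in> schwartz"
  shows "fourier (laplacian \<phi>) \<xi> = - of_real (4 * pi\<^sup>2 * (norm \<xi>)\<^sup>2) * fourier \<phi> \<xi>"
proof -
  have p: "partials [b, b] \<phi> \<in> schwartz" if "b \<in> Basis" for b
    using that by (intro schwartz_partials \<phi>) auto
  have "fourier (laplacian \<phi>) \<xi> = (LINT x|lborel. laplacian \<phi> x * character \<xi> x)"
    by (rule fourier_schwartz[OF laplacian_schwartz[OF \<phi>]])
  also have "\<dots> = (LINT x|lborel. (\<Sum>b\<in>Basis. partials [b, b] \<phi> x * character \<xi> x))"
    unfolding laplacian_def sum_distrib_right ..
  also have "\<dots> = (\<Sum>b\<in>Basis. (LINT x|lborel. partials [b, b] \<phi> x * character \<xi> x))"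
    by (intro Bochner_Integration.integral_sum integrable_times_character schwartz_integrable p)
  also have "\<dots> = (\<Sum>b\<in>Basis. symbol [b, b] \<xi> * fourier \<phi> \<xi>)"
    by (intro sum.cong refl) (simp only: fourier_schwartz[OF p, symmetric], rule fourier_partials[OF \<phi>], simp)
  also have "\<dots> = (\<Sum>b\<in>Basis. - of_real (4 * pi\<^sup>2 * (\<xi> \<bullet> b)\<^sup>2) * fourier \<phi> \<xi>)"
    by (intro sum.cong refl) (simp add: power2_eq_square mult_ac)
  also have "\<dots> = - of_real (4 * pi\<^sup>2 * (\<Sum>b\<in>Basis. (\<xi> \<bullet> b)\<^sup>2)) * fourier \<phi> \<xi>"
    by (simp add: sum_distrib_left sum_distrib_right sum_negf)
  also have "(\<Sum>b\<in>Basis. (\<xi> \<bullet> b)\<^sup>2) = (norm \<xi>)\<^sup>2"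
    by (rule norm_squared_coordinates[symmetric])
  finally show ?thesis .
qed

lemma norm_character_taylor:
  "norm (character (\<xi> + h) x - character \<xi> x - character \<xi> x * (- 2 * of_real pi * \<i> * of_real (x \<bullet> h)))
    \<le> 2 * pi\<^sup>2 * (x \<bullet> h)\<^sup>2"
proof -
  define \<theta> where "\<theta> = - 2 * pi * (x \<bullet> h)"
  have th: "\<i> * of_real \<theta> = - 2 * of_real pi * \<i> * of_real (x \<bullet> h)"
    by (simp add: \<theta>_def mult_ac)
  have "character (\<xi> + h) x = character \<xi> x * iexp \<theta>"
    unfolding th by (simp add: inner_add_right algebra_simps flip: exp_add)
  then have "character (\<xi> + h) x - character \<xi> x - character \<xi> x * (\<i> * of_real \<theta>)
      = character \<xi> x * (iexp \<theta> - (\<Sum>k\<le>1. (\<i> * of_real \<theta>) ^ k / fact k))"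
    by (simp add: algebra_simps)
  then have "norm (character (\<xi> + h) x - character \<xi> x - character \<xi> x * (\<i> * of_real \<theta>))
      = norm (iexp \<theta> - (\<Sum>k\<le>1. (\<i> * of_real \<theta>) ^ k / fact k))"
    by (simp only: norm_mult norm_character mult_1_left)
  also have "\<dots> \<le> \<bar>\<theta>\<bar> ^ Suc 1 / fact (Suc 1)" by (rule iexp_approx1)
  also have "\<dots> = 2 * pi\<^sup>2 * (x \<bullet> h)\<^sup>2" by (simp add: \<theta>_def power2_eq_square abs_mult)
  finally show ?thesis unfolding th .
qed

text \<open>Differentiation under the integral sign.  The second-order Taylor bound for the character, together
  with the finite second moment of \<open>\<phi>\<close>, makes the remainder \<open>O(|h|\<^sup>2)\<close>.\<close>

lemma fourier_has_derivative:
  fixes \<phi> :: "'a::euclidean_space \<Rightarrow> complex"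
  assumes \<phi>: "\<phi> \<in> schwartz"
  shows "(fourier \<phi> has_derivative
    (\<lambda>h. \<Sum>b\<in>Basis. (h \<bullet> b) *\<^sub>R fourier (\<lambda>x. (- 2 * of_real pi * \<i>) * (of_real (x \<bullet> b) * \<phi> x)) \<xi>)) (at \<xi>)"
    (is "(_ has_derivative ?D) _")
proof -
  define m where "m b x = (- 2 * of_real pi * \<i>) * (of_real (x \<bullet> b) * \<phi> x)" for b x
  have m: "m b \<in> schwartz" if "b \<in> Basis" for b
    unfolding m_def by (intro schwartz_cmult schwartz_coordinate_mult \<phi> that)
  define K where "K = (LINT x|lborel. 2 * pi\<^sup>2 * ((norm x)\<^sup>2 * norm (\<phi> x)))"
  have int2: "integrable lborel (\<lambda>x. 2 * pi\<^sup>2 * ((norm x)\<^sup>2 * norm (\<phi> x)))"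
  proof -
    have "(\<lambda>x. \<Sum>b\<in>Basis. of_real (x \<bullet> b) * (of_real (x \<bullet> b) * \<phi> x)) \<in> schwartz"
      by (intro schwartz_sum schwartz_coordinate_mult \<phi>)
    moreover have "(\<Sum>b\<in>Basis. of_real (x \<bullet> b) * (of_real (x \<bullet> b) * \<phi> x)) = of_real ((norm x)\<^sup>2) * \<phi> x" for x
      unfolding norm_squared_coordinates of_real_sum sum_distrib_right
      by (intro sum.cong refl) (simp add: power2_eq_square)
    ultimately have "integrable lborel (\<lambda>x. norm (of_real ((norm x)\<^sup>2) * \<phi> x))"
      by (intro integrable_norm schwartz_integrable) simp
    then show ?thesis by (simp add: norm_mult norm_power)
  qed
  have rem: "norm (fourier \<phi> (\<xi> + h) - fourier \<phi> \<xi> - ?D h) \<le> K * (norm h)\<^sup>2" for h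
  proof -
    let ?r = "\<lambda>x. character (\<xi> + h) x - character \<xi> x - character \<xi> x * (- 2 * of_real pi * \<i> * of_real (x \<bullet> h))"
    have i\<phi>: "integrable lborel \<phi>" by (rule schwartz_integrable[OF \<phi>])
    have im: "integrable lborel (\<lambda>x. (h \<bullet> b) *\<^sub>R (m b x * character \<xi> x))" if "b \<in> Basis" for b
      by (intro integrable_scaleR_right integrable_times_character schwartz_integrable m that)
    have D: "?D h = (LINT x|lborel. (\<Sum>b\<in>Basis. (h \<bullet> b) *\<^sub>R (m b x * character \<xi> x)))"
    proof -
      have "?D h = (\<Sum>b\<in>Basis. (h \<bullet> b) *\<^sub>R fourier (m b) \<xi>)" by (simp only: m_def[abs_def])
      also have "\<dots> = (\<Sum>b\<in>Basis. (LINT x|lborel. (h \<bullet> b) *\<^sub>R (m b x * character \<xi> x)))"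
        by (intro sum.cong refl) (simp only: fourier_schwartz[OF m] integral_scaleR_right)
      also have "\<dots> = (LINT x|lborel. (\<Sum>b\<in>Basis. (h \<bullet> b) *\<^sub>R (m b x * character \<xi> x)))"
        using im by (rule Bochner_Integration.integral_sum[symmetric])
      finally show ?thesis .
    qed
    have sum: "(\<Sum>b\<in>Basis. (h \<bullet> b) *\<^sub>R (m b x * character \<xi> x))
        = \<phi> x * (character \<xi> x * (- 2 * of_real pi * \<i> * of_real (x \<bullet> h)))" for x
      by (subst euclidean_inner[of x h])
         (simp add: m_def scaleR_conv_of_real sum_distrib_left sum_distrib_right mult_ac)
    have iD: "integrable lborel (\<lambda>x. \<phi> x * (character \<xi> x * (- 2 * of_real pi * \<i> * of_real (x \<bullet> h))))"
      unfolding sum[symmetric] by (intro Bochner_Integration.integrable_sum im)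
    have eq: "fourier \<phi> (\<xi> + h) - fourier \<phi> \<xi> - ?D h = (LINT x|lborel. \<phi> x * ?r x)"
      unfolding D sum fourier_schwartz[OF \<phi>]
      using integrable_times_character[OF i\<phi>] iD
      by (simp only: Bochner_Integration.integral_diff[symmetric] Bochner_Integration.integrable_diff
          right_diff_distrib)
    have ir: "integrable lborel (\<lambda>x. \<phi> x * ?r x)"
      unfolding right_diff_distrib
      by (intro Bochner_Integration.integrable_diff integrable_times_character i\<phi> iD)
    have "norm (LINT x|lborel. \<phi> x * ?r x) \<le> (LINT x|lborel. norm (\<phi> x * ?r x))"
      by (rule integral_norm_bound)
    also have "\<dots> \<le> (LINT x|lborel. (norm h)\<^sup>2 * (2 * pi\<^sup>2 * ((norm x)\<^sup>2 * norm (\<phi> x))))"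
    proof (rule integral_mono)
      show "integrable lborel (\<lambda>x. norm (\<phi> x * ?r x))" by (rule integrable_norm[OF ir])
      show "integrable lborel (\<lambda>x. (norm h)\<^sup>2 * (2 * pi\<^sup>2 * ((norm x)\<^sup>2 * norm (\<phi> x))))"
        by (rule integrable_mult_right[OF int2])
      fix x
      have "(x \<bullet> h)\<^sup>2 \<le> (norm x * norm h)\<^sup>2"
        using Cauchy_Schwarz_ineq2[of x h] by (metis abs_ge_zero power2_abs power_mono)
      then have "2 * pi\<^sup>2 * (x \<bullet> h)\<^sup>2 \<le> 2 * pi\<^sup>2 * (norm x * norm h)\<^sup>2" by (intro mult_left_mono) auto
      with norm_character_taylor[of x \<xi> h]
      have "norm (?r x) \<le> 2 * pi\<^sup>2 * (norm x * norm h)\<^sup>2" by (rule order_trans)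
      then have "norm (\<phi> x) * norm (?r x) \<le> norm (\<phi> x) * (2 * pi\<^sup>2 * (norm x * norm h)\<^sup>2)"
        by (rule mult_left_mono) simp
      then show "norm (\<phi> x * ?r x) \<le> (norm h)\<^sup>2 * (2 * pi\<^sup>2 * ((norm x)\<^sup>2 * norm (\<phi> x)))"
        unfolding norm_mult[of "\<phi> x"] power_mult_distrib by (simp only: mult_ac)
    qed
    also have "\<dots> = K * (norm h)\<^sup>2" using int2 by (simp add: K_def mult.commute)
    finally show ?thesis unfolding eq .
  qed
  show ?thesis
  proof (rule has_derivativeI_sandwich[where e=1])
    show "bounded_linear ?D"
      by (intro bounded_linear_sum bounded_linear_scaleR_left[THEN bounded_linear_compose]
          bounded_linear_inner_left)
    show "norm (fourier \<phi> y - fourier \<phi> \<xi> - ?D (y - \<xi>)) / norm (y - \<xi>) \<le> K * norm (y - \<xi>)" if "y \<noteq> \<xi>" for y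
      using rem[of "y - \<xi>"] that by (simp add: divide_le_eq power2_eq_square mult.assoc)
    have "((\<lambda>y. K * norm (y - \<xi>)) \<longlongrightarrow> K * norm (\<xi> - \<xi>)) (at \<xi>)"
      by (intro tendsto_intros)
    then show "((\<lambda>y. K * norm (y - \<xi>)) \<longlongrightarrow> 0) (at \<xi>)" by simp
  qed simp
qed

text \<open>Some coordinate of \<open>\<xi>\<close> is at least \<open>|\<xi>| / N\<close> in absolute value, and its \<open>k\<close>-th power is dominated by the symbol of
  a pure \<open>k\<close>-th derivative.\<close>

lemma fourier_power_bound:
  fixes \<phi> :: "'a::euclidean_space \<Rightarrow> complex"
  assumes \<phi>: "\<phi> \<in> schwartz"
  shows "norm \<xi> ^ k * norm (fourier \<phi> \<xi>)
    \<le> real DIM('a) ^ k * (\<Sum>b\<in>Basis. (LINT x|lborel. norm (partials (replicate k b) \<phi> x)))"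
proof -
  define M where "M = Max ((\<lambda>b. \<bar>\<xi> \<bullet> b\<bar>) ` Basis)"
  have "M \<in> (\<lambda>b. \<bar>\<xi> \<bullet> b\<bar>) ` Basis" unfolding M_def by (intro Max_in) auto
  then obtain b where b: "b \<in> Basis" "M = \<bar>\<xi> \<bullet> b\<bar>" by blast
  have "norm \<xi> \<le> (\<Sum>c\<in>Basis. \<bar>\<xi> \<bullet> c\<bar>)" by (rule norm_le_l1)
  also have "\<dots> \<le> (\<Sum>c\<in>(Basis::'a set). M)" unfolding M_def by (intro sum_mono Max_ge) auto
  finally have le: "norm \<xi> \<le> real DIM('a) * \<bar>\<xi> \<bullet> b\<bar>" by (simp add: b)
  have "\<bar>\<xi> \<bullet> b\<bar> ^ k \<le> norm (symbol (replicate k b) \<xi>)"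
    unfolding norm_symbol_replicate using pi_ge_two by (intro power_mono) (auto simp: mult_le_cancel_right1)
  then have "norm \<xi> ^ k \<le> real DIM('a) ^ k * norm (symbol (replicate k b) \<xi>)"
    using power_mono[OF le, of k] by (simp add: power_mult_distrib)
      (meson mult_left_mono order_trans zero_le_power of_nat_0_le_iff)
  then have "norm \<xi> ^ k * norm (fourier \<phi> \<xi>) \<le> real DIM('a) ^ k * norm (symbol (replicate k b) \<xi> * fourier \<phi> \<xi>)"
    unfolding norm_mult mult.assoc[symmetric] by (rule mult_right_mono) simp
  also have "symbol (replicate k b) \<xi> * fourier \<phi> \<xi> = fourier (partials (replicate k b) \<phi>) \<xi>"
    using b by (intro fourier_partials[symmetric] \<phi>) auto
  also have "norm \<dots> \<le> (LINT x|lborel. norm (partials (replicate k b) \<phi> x))"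
    using b by (intro norm_fourier_le schwartz_integrable schwartz_partials \<phi>) auto
  also have "\<dots> \<le> (\<Sum>b\<in>Basis. (LINT x|lborel. norm (partials (replicate k b) \<phi> x)))"
    using b by (intro member_le_sum) auto
  finally show ?thesis by (simp add: mult_left_mono)
qed

text \<open>A partial derivative of \<open>F \<phi>\<close> is the transform of \<open>\<phi>\<close> multiplied by a coordinate, so the image of the
  Schwartz space is closed under partial derivatives; its members decay because derivatives of \<open>\<phi>\<close>
  are integrable.\<close>

theorem fourier_in_schwartz:
  fixes \<phi> :: "'a::euclidean_space \<Rightarrow> complex"
  assumes \<phi>: "\<phi> \<in> schwartz"
  shows "fourier \<phi> \<in> schwartz"
proof (rule schwartz_coinduct[of _ "fourier ` schwartz"])
  fix g :: "'a \<Rightarrow> complex" assume "g \<in> fourier ` schwartz"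
  then obtain \<psi> where g: "g = fourier \<psi>" and \<psi>: "\<psi> \<in> schwartz" by blast
  show "g differentiable at x" for x
    unfolding g differentiable_def using fourier_has_derivative[OF \<psi>] by blast
  show "bdd_above (range (\<lambda>x. norm x ^ k * norm (g x)))" for k
    unfolding g by (rule bdd_aboveI2[OF fourier_power_bound[OF \<psi>]])
  show "partials [b] g \<in> fourier ` schwartz" if b: "b \<in> Basis" for b
  proof -
    have "partials [b] g = fourier (\<lambda>x. (- 2 * of_real pi * \<i>) * (of_real (x \<bullet> b) * \<psi> x))"
      unfolding g partial_eq[OF fourier_has_derivative[OF \<psi>], abs_def]
    proof
      fix \<xi>
      show "(\<Sum>c\<in>Basis. (b \<bullet> c) *\<^sub>R fourier (\<lambda>x. (- 2 * of_real pi * \<i>) * (of_real (x \<bullet> c) * \<psi> x)) \<xi>)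
          = fourier (\<lambda>x. (- 2 * of_real pi * \<i>) * (of_real (x \<bullet> b) * \<psi> x)) \<xi>"
        using b by (subst sum.remove[OF finite_Basis b])
          (auto simp: inner_Basis intro!: sum.neutral split: if_splits)
    qed
    then show ?thesis
      using schwartz_cmult[OF schwartz_coordinate_mult[OF \<psi> b]] by blast
  qed
qed (use \<phi> in blast)

theorem fourier_inversion_schwartz:
  assumes \<phi>: "\<phi> \<in> schwartz"
  shows "fourier (fourier \<phi>) x = \<phi> (- x)"
proof -
  obtain B where "\<And>x. norm (\<phi> x) \<le> B" using schwartz_bounded[OF \<phi>] by blast
  from fourier_inversion[OF schwartz_integrable[OF \<phi>] schwartz_integrable[OF fourier_in_schwartz[OF \<phi>]]
      schwartz_continuous[OF \<phi>] this, of "- x"]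
  show ?thesis by simp
qed

text \<open>Two transforms give a reflection, hence four give the identity.\<close>

lemma fourier_schwartz_surj:
  assumes \<phi>: "\<phi> \<in> schwartz"
  obtains \<psi> where "\<psi> \<in> schwartz" "\<phi> = fourier \<psi>"
proof
  show "fourier (fourier (fourier \<phi>)) \<in> schwartz" by (intro fourier_in_schwartz \<phi>)
  show "\<phi> = fourier (fourier (fourier (fourier \<phi>)))"
    using fourier_inversion_schwartz[OF \<phi>]
      fourier_inversion_schwartz[OF fourier_in_schwartz[OF fourier_in_schwartz[OF \<phi>]]]
    by (simp add: fun_eq_iff)
qed

section \<open>Smooth bumps on boxes\<close>

text \<open>For \<open>p = 1\<close> the standard flat function \<open>exp(-c / s)\<close>.  The polynomial factor in \<open>1 / s\<close> makes the
  class closed under differentiation.\<close>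

definition flat_kernel :: "real \<Rightarrow> real poly \<Rightarrow> real \<Rightarrow> real" where
  "flat_kernel c p s = (if s > 0 then poly p (1 / s) * exp (- (c / s)) else 0)"

lemma power_times_exp_decay:
  fixes c :: real
  assumes "c > 0"
  shows "((\<lambda>u. u ^ k * poly p u * exp (- (c * u))) \<longlongrightarrow> 0) at_top"
proof (induction p arbitrary: k)
  case (pCons a p)
  have "((\<lambda>u. u ^ k * exp (- (c * u))) \<longlongrightarrow> 0) at_top"
    using assms by real_asymp
  then have "((\<lambda>u. a * (u ^ k * exp (- (c * u)))) \<longlongrightarrow> a * 0) at_top"
    by (intro tendsto_intros)
  from tendsto_add[OF this pCons.IH[of "Suc k"]]
  show ?case by (simp add: algebra_simps)
qed simp

lemma flat_kernel_has_derivative: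
  assumes c: "c > 0"
  shows "(flat_kernel c p has_real_derivative
    flat_kernel c ([:0, 0, 1:] * (smult c p - pderiv p)) s) (at s)"
proof -
  consider "s > 0" | "s < 0" | "s = 0" by linarith
  then show ?thesis
  proof cases
    case 1
    have "((\<lambda>s. poly p (1 / s) * exp (- (c / s))) has_real_derivative
        flat_kernel c ([:0, 0, 1:] * (smult c p - pderiv p)) s) (at s)"
      using 1 by (auto intro!: derivative_eq_intros
          simp: flat_kernel_def power2_eq_square field_simps)
    then show ?thesis
      by (rule DERIV_cong_ev[THEN iffD1, OF refl _ refl, rotated])
         (use 1 in \<open>auto simp: flat_kernel_def eventually_nhds intro!: exI[of _ "{0<..}"]\<close>)
  next
    case 2
    have "((\<lambda>s. 0) has_real_derivative 0) (at s)" by simp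
    then have "(flat_kernel c p has_real_derivative 0) (at s)"
      by (rule DERIV_cong_ev[THEN iffD1, OF refl _ refl, rotated])
         (use 2 in \<open>auto simp: flat_kernel_def eventually_nhds intro!: exI[of _ "{..<0}"]\<close>)
    then show ?thesis using 2 by (simp add: flat_kernel_def)
  next
    case 3
    have "((\<lambda>h. (flat_kernel c p h - flat_kernel c p 0) / (h - 0)) \<longlongrightarrow> 0) (at 0)"
    proof (rule filterlim_split_at)
      have "eventually (\<lambda>h. (flat_kernel c p h - flat_kernel c p 0) / (h - 0) = 0) (at_left 0)"
        by (intro eventually_at_leftI[of "-1"]) (auto simp: flat_kernel_def)
      then show "((\<lambda>h. (flat_kernel c p h - flat_kernel c p 0) / (h - 0)) \<longlongrightarrow> 0) (at_left 0)"
        by (simp add: tendsto_eventually)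
      have "((\<lambda>h. inverse h ^ 1 * poly p (inverse h) * exp (- (c * inverse h))) \<longlongrightarrow> 0) (at_right 0)"
        by (rule filterlim_compose[OF power_times_exp_decay[OF c] filterlim_inverse_at_top_right])
      moreover have "eventually (\<lambda>h. inverse h ^ 1 * poly p (inverse h) * exp (- (c * inverse h))
          = (flat_kernel c p h - flat_kernel c p 0) / (h - 0)) (at_right 0)"
        by (intro eventually_at_rightI[of _ 1]) (auto simp: flat_kernel_def divide_inverse)
      ultimately show "((\<lambda>h. (flat_kernel c p h - flat_kernel c p 0) / (h - 0)) \<longlongrightarrow> 0) (at_right 0)"
        by (rule Lim_transform_eventually)
    qed
    then show ?thesis using 3 by (simp add: has_field_derivative_iff flat_kernel_def)
  qed
qed

lemma smooth_flat_ridge: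
  assumes c: "c > 0"
  shows "smooth (\<lambda>x::'a::euclidean_space. of_real (flat_kernel c p (\<sigma> * (x \<bullet> b) + t)))"
proof -
  let ?S = "{\<lambda>x::'a. complex_of_real (k * flat_kernel c p (\<sigma> * (x \<bullet> b) + t)) | k p. True}"
  have "smooth (\<lambda>x::'a. of_real (1 * flat_kernel c p (\<sigma> * (x \<bullet> b) + t)))"
  proof (rule smooth_coinduct[of _ ?S])
    fix g assume "g \<in> ?S"
    then obtain k p where g: "g = (\<lambda>x::'a. complex_of_real (k * flat_kernel c p (\<sigma> * (x \<bullet> b) + t)))" by auto
    let ?p' = "[:0, 0, 1:] * (smult c p - pderiv p)"
    have D: "(g has_derivative (\<lambda>h. complex_of_real (k * (flat_kernel c ?p' (\<sigma> * (x \<bullet> b) + t) * (\<sigma> * (h \<bullet> b)))))) (at x)" for x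
      unfolding g
    proof (intro has_derivative_of_real has_derivative_mult_right)
      have "((\<lambda>x. \<sigma> * (x \<bullet> b) + t) has_derivative (\<lambda>h. \<sigma> * (h \<bullet> b))) (at x)"
        by (auto intro!: derivative_eq_intros)
      from has_derivative_compose[OF this flat_kernel_has_derivative[OF c, unfolded has_field_derivative_def]]
      show "((\<lambda>x. flat_kernel c p (\<sigma> * (x \<bullet> b) + t)) has_derivative
        (\<lambda>h. flat_kernel c ?p' (\<sigma> * (x \<bullet> b) + t) * (\<sigma> * (h \<bullet> b)))) (at x)" .
    qed
    show "g differentiable at x" for x using D[of x] unfolding differentiable_def by blast
    show "partials [d] g \<in> ?S" for d
    proof -
      have "partials [d] g = (\<lambda>x. complex_of_real ((k * (\<sigma> * (d \<bullet> b))) * flat_kernel c ?p' (\<sigma> * (x \<bullet> b) + t)))"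
        using partial_eq[OF D] by (auto simp: fun_eq_iff)
      then show ?thesis by blast
    qed
  qed blast
  then show ?thesis by simp
qed

text \<open>Sums are included because the product rule produces them: the closure of the smooth functions
  under both operations is closed under partial derivatives, by rule induction.\<close>

inductive_set smooth_algebra :: "('a::euclidean_space \<Rightarrow> complex) set" where
  base: "smooth f \<Longrightarrow> f \<in> smooth_algebra"
| add: "f \<in> smooth_algebra \<Longrightarrow> g \<in> smooth_algebra \<Longrightarrow> (\<lambda>x. f x + g x) \<in> smooth_algebra"
| mult: "f \<in> smooth_algebra \<Longrightarrow> g \<in> smooth_algebra \<Longrightarrow> (\<lambda>x. f x * g x) \<in> smooth_algebra"

lemma smooth_partials: "smooth f \<Longrightarrow> set bs \<subseteq> Basis \<Longrightarrow> smooth (partials bs f)"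
  unfolding smooth_def by (auto simp flip: partials_append)

lemma smooth_algebra_partial:
  assumes "f \<in> smooth_algebra"
  shows "(\<forall>x. f differentiable at x) \<and> (\<forall>b\<in>Basis. partials [b] f \<in> smooth_algebra)"
  using assms
proof induction
  case (base f)
  then have "f differentiable at x" for x
    unfolding smooth_def by (auto dest: spec[of _ "[]"])
  moreover have "partials [b] f \<in> smooth_algebra" if "b \<in> Basis" for b
    using that by (intro smooth_algebra.base smooth_partials[OF base]) auto
  ultimately show ?case by blast
next
  case (add f g)
  have D: "((\<lambda>x. f x + g x) has_derivative (\<lambda>h. frechet_derivative f (at x) h + frechet_derivative g (at x) h)) (at x)" for x
    using add.IH by (intro has_derivative_add) (auto simp: frechet_derivative_works[symmetric])
  have "partials [b] (\<lambda>x. f x + g x) = (\<lambda>x. partials [b] f x + partials [b] g x)" for b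
    using partial_eq[OF D] by (auto simp: fun_eq_iff)
  then show ?case using add D unfolding differentiable_def by (auto intro!: smooth_algebra.add simp del: partials.simps)
next
  case (mult f g)
  have D: "((\<lambda>x. f x * g x) has_derivative (\<lambda>h. f x * frechet_derivative g (at x) h + frechet_derivative f (at x) h * g x)) (at x)" for x
    using mult.IH by (intro has_derivative_mult) (auto simp: frechet_derivative_works[symmetric])
  have "partials [b] (\<lambda>x. f x * g x) = (\<lambda>x. f x * partials [b] g x + partials [b] f x * g x)" for b
    using partial_eq[OF D] by (auto simp: fun_eq_iff)
  then show ?case using mult D unfolding differentiable_def
    by (auto intro!: smooth_algebra.add smooth_algebra.mult simp del: partials.simps)
qed

lemma smooth_mult:
  assumes "smooth f" "smooth g"
  shows "smooth (\<lambda>x. f x * g x)"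
  using smooth_algebra_partial assms
  by (intro smooth_coinduct[of _ smooth_algebra]) (auto intro: smooth_algebra.intros simp del: partials.simps)

lemma smooth_one: "smooth (\<lambda>x::'a::euclidean_space. 1)"
proof (rule smooth_coinduct[of _ "{\<lambda>x. 1, \<lambda>x. 0}"])
  show "partials [b] g \<in> {\<lambda>x. 1, \<lambda>x. 0}" if "g \<in> {\<lambda>x. 1, \<lambda>x. 0}" for g :: "'a \<Rightarrow> complex" and b
  proof -
    have "(g has_derivative (\<lambda>h. 0)) (at x)" for x using that by auto
    from partial_eq[OF this] show ?thesis by (auto simp: fun_eq_iff)
  qed
qed auto

lemma smooth_prod:
  assumes "\<And>i. i \<in> I \<Longrightarrow> smooth (f i)"
  shows "smooth (\<lambda>x. \<Prod>i\<in>I. f i x)"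
  using assms by (induction I rule: infinite_finite_induct) (auto intro: smooth_one smooth_mult)

text \<open>Converges to the indicator of the box, since \<open>exp(-1 / ((n + 1) s))\<close> tends to \<open>1\<close> for every
  \<open>s > 0\<close>.\<close>

definition box_bump :: "'a::euclidean_space \<Rightarrow> 'a \<Rightarrow> nat \<Rightarrow> 'a \<Rightarrow> real" where
  "box_bump l r n x = (\<Prod>b\<in>Basis.
     flat_kernel (1 / real (Suc n)) 1 (x \<bullet> b - l \<bullet> b) * flat_kernel (1 / real (Suc n)) 1 (r \<bullet> b - x \<bullet> b))"

lemma flat_kernel_1_bounds: "0 \<le> flat_kernel (1 / real (Suc n)) 1 s" "flat_kernel (1 / real (Suc n)) 1 s \<le> 1"
  by (auto simp: flat_kernel_def)

lemma flat_kernel_1_eq_0: "s \<le> 0 \<Longrightarrow> flat_kernel c p s = 0"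
  by (simp add: flat_kernel_def)

lemma flat_kernel_1_tendsto: 
  assumes "s > 0"
  shows "(\<lambda>n. flat_kernel (1 / real (Suc n)) 1 s) \<longlonglongrightarrow> 1"
proof -
  have "(\<lambda>n. exp (- (1 / real (Suc n) / s))) \<longlonglongrightarrow> exp (- (0 / s))"
    using assms by (intro tendsto_intros LIMSEQ_inverse_real_of_nat[unfolded inverse_eq_divide]) auto
  then show ?thesis using assms by (simp add: flat_kernel_def)
qed

lemma box_bump_outside: "x \<notin> box l r \<Longrightarrow> box_bump l r n x = 0"
  unfolding box_bump_def mem_box
  by (auto simp: flat_kernel_1_eq_0 not_less intro!: prod_zero bexI)

lemma box_bump_bounds: "0 \<le> box_bump l r n x" "box_bump l r n x \<le> 1"
  unfolding box_bump_def using flat_kernel_1_bounds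
  by (auto intro!: prod_nonneg prod_le_1 mult_le_one simp del: of_nat_Suc)

lemma box_bump_tendsto: "(\<lambda>n. box_bump l r n x) \<longlonglongrightarrow> indicator (box l r) x"
proof (cases "x \<in> box l r")
  case True
  then have "(\<lambda>n. box_bump l r n x) \<longlonglongrightarrow> (\<Prod>b\<in>(Basis::'a set). 1 * 1)"
    unfolding box_bump_def
    by (intro tendsto_prod tendsto_mult flat_kernel_1_tendsto) (auto simp: mem_box)
  then show ?thesis using True by simp
next
  case False
  then show ?thesis by (simp add: box_bump_outside)
qed

lemma box_bump_test_function:
  "(\<lambda>x. complex_of_real (box_bump l r n x)) \<in> test_functions"
proof -
  have "smooth (\<lambda>x. \<Prod>b\<in>Basis. complex_of_real (flat_kernel (1 / real (Suc n)) 1 (1 * (x \<bullet> b) + (- (l \<bullet> b)))) *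
      complex_of_real (flat_kernel (1 / real (Suc n)) 1 ((-1) * (x \<bullet> b) + r \<bullet> b)))"
    by (intro smooth_prod smooth_mult smooth_flat_ridge) auto
  moreover have "(\<lambda>x. \<Prod>b\<in>Basis. complex_of_real (flat_kernel (1 / real (Suc n)) 1 (1 * (x \<bullet> b) + (- (l \<bullet> b)))) *
      complex_of_real (flat_kernel (1 / real (Suc n)) 1 ((-1) * (x \<bullet> b) + r \<bullet> b)))
    = (\<lambda>x. complex_of_real (box_bump l r n x))"
    unfolding box_bump_def of_real_prod of_real_mult by (simp add: algebra_simps del: of_nat_Suc)
  ultimately have "smooth (\<lambda>x. complex_of_real (box_bump l r n x))" by simp
  moreover have "{x. complex_of_real (box_bump l r n x) \<noteq> 0} \<subseteq> box l r"
    using box_bump_outside[of _ l r n] by auto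
  then have "compact (closure {x. complex_of_real (box_bump l r n x) \<noteq> 0})"
    by (meson bounded_box bounded_subset compact_closure)
  ultimately show ?thesis by (simp add: test_functions_def)
qed

section \<open>Square integrable functions and the fundamental lemma\<close>

lemma lebesgue_borel_representative:
  fixes f :: "'a::euclidean_space \<Rightarrow> complex"
  assumes "f \<in> borel_measurable lebesgue"
  obtains g where "g \<in> borel_measurable borel" "AE x in lebesgue. f x = g x"
proof -
  have "(\<lambda>x. Re (f x)) \<in> borel_measurable lebesgue" "(\<lambda>x. Im (f x)) \<in> borel_measurable lebesgue"
    using assms by measurable
  then obtain p q where "p \<in> borel_measurable lborel" "AE x in lborel. Re (f x) = p x"
    and "q \<in> borel_measurable lborel" "AE x in lborel. Im (f x) = q x"
    using completion_ex_borel_measurable_real by metis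
  note pq = this
  have "AE x in lborel. f x = Complex (p x) (q x)"
    using pq(2,4) by eventually_elim (simp add: complex_eq_iff)
  moreover have "(\<lambda>x. Complex (p x) (q x)) \<in> borel_measurable borel"
    using pq(1,3) unfolding borel_measurable_complex_iff by simp
  ultimately show ?thesis using that AE_completion by blast
qed

lemma square_integrable_add:
  assumes "square_integrable f" "square_integrable g"
  shows "square_integrable (\<lambda>x. f x + g x)"
proof -
  have [measurable]: "f \<in> borel_measurable lebesgue" "g \<in> borel_measurable lebesgue"
    using assms by (auto simp: square_integrable_def)
  have "integrable lebesgue (\<lambda>x. (norm (f x + g x))\<^sup>2)"
  proof (rule Bochner_Integration.integrable_bound)
    show "integrable lebesgue (\<lambda>x. 2 * (norm (f x))\<^sup>2 + 2 * (norm (g x))\<^sup>2)"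
      using assms by (auto simp: square_integrable_def)
    have "(norm (f x + g x))\<^sup>2 \<le> 2 * (norm (f x))\<^sup>2 + 2 * (norm (g x))\<^sup>2" for x
    proof -
      have "(norm (f x + g x))\<^sup>2 \<le> (norm (f x) + norm (g x))\<^sup>2"
        by (intro power_mono norm_triangle_ineq) auto
      also have "\<dots> \<le> 2 * (norm (f x))\<^sup>2 + 2 * (norm (g x))\<^sup>2"
        using sum_squares_bound[of "norm (f x)" "norm (g x)"] by (simp add: power2_sum)
      finally show ?thesis .
    qed
    then show "AE x in lebesgue. norm ((norm (f x + g x))\<^sup>2) \<le> norm (2 * (norm (f x))\<^sup>2 + 2 * (norm (g x))\<^sup>2)"
      by (intro AE_I2) simp
  qed measurable
  then show ?thesis by (simp add: square_integrable_def)
qed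

lemma square_integrable_cmult: "square_integrable f \<Longrightarrow> square_integrable (\<lambda>x. c * f x)"
  by (auto simp: square_integrable_def norm_mult power_mult_distrib)

lemma square_integrable_diff:
  assumes "square_integrable f" "square_integrable g"
  shows "square_integrable (\<lambda>x. f x - g x)"
  using square_integrable_add[OF assms(1) square_integrable_cmult[OF assms(2), of "-1"]] by simp

lemma L2_norm_nonneg: "0 \<le> L2_norm f"
  by (simp add: L2_norm_def)

lemma
  fixes f g :: "'a::euclidean_space \<Rightarrow> complex"
  assumes f: "square_integrable f" and g: "square_integrable g"
  shows integrable_L2_mult: "integrable lebesgue (\<lambda>x. f x * g x)"
    and L2_Cauchy_Schwarz: "norm (LINT x|lebesgue. f x * g x) \<le> L2_norm f * L2_norm g"
proof -
  have [measurable]: "f \<in> borel_measurable lebesgue" "g \<in> borel_measurable lebesgue"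
    and i: "integrable lebesgue (\<lambda>x. (norm (f x))\<^sup>2)" "integrable lebesgue (\<lambda>x. (norm (g x))\<^sup>2)"
    using assms by (auto simp: square_integrable_def)
  show int: "integrable lebesgue (\<lambda>x. f x * g x)"
  proof (rule Bochner_Integration.integrable_bound)
    show "integrable lebesgue (\<lambda>x. (norm (f x))\<^sup>2 + (norm (g x))\<^sup>2)" using i by auto
    show "AE x in lebesgue. norm (f x * g x) \<le> norm ((norm (f x))\<^sup>2 + (norm (g x))\<^sup>2)"
    proof (intro AE_I2)
      fix x
      have "0 \<le> norm (f x * g x)" by simp
      moreover have "2 * norm (f x * g x) \<le> (norm (f x))\<^sup>2 + (norm (g x))\<^sup>2"
        using sum_squares_bound[of "norm (f x)" "norm (g x)"] by (simp add: norm_mult)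
      ultimately show "norm (f x * g x) \<le> norm ((norm (f x))\<^sup>2 + (norm (g x))\<^sup>2)"
        unfolding real_norm_def by linarith
    qed
  qed measurable
  have nn: "(\<integral>\<^sup>+x. ennreal (norm (h x)) ^ 2 \<partial>lebesgue) = ennreal ((L2_norm h)\<^sup>2)"
    if "integrable lebesgue (\<lambda>x. (norm (h x))\<^sup>2)" for h :: "'a \<Rightarrow> complex"
    using nn_integral_eq_integral[OF that] by (simp add: L2_norm_def ennreal_power)
  have "(\<integral>\<^sup>+x. ennreal (norm (f x * g x)) \<partial>lebesgue) = ennreal (LINT x|lebesgue. norm (f x * g x))"
    using int by (intro nn_integral_eq_integral) auto
  moreover have "(\<integral>\<^sup>+x. ennreal (norm (f x)) * ennreal (norm (g x)) \<partial>lebesgue)\<^sup>2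
      \<le> (\<integral>\<^sup>+x. ennreal (norm (f x)) ^ 2 \<partial>lebesgue) * (\<integral>\<^sup>+x. ennreal (norm (g x)) ^ 2 \<partial>lebesgue)"
    by (rule Cauchy_Schwarz_nn_integral) measurable
  ultimately have "(ennreal (LINT x|lebesgue. norm (f x * g x)))\<^sup>2 \<le> ennreal ((L2_norm f)\<^sup>2) * ennreal ((L2_norm g)\<^sup>2)"
    unfolding nn[OF i(1)] nn[OF i(2)] by (simp add: norm_mult ennreal_mult)
  then have "(LINT x|lebesgue. norm (f x * g x))\<^sup>2 \<le> (L2_norm f * L2_norm g)\<^sup>2"
    by (simp add: ennreal_power ennreal_mult[symmetric] power_mult_distrib)
  then have "(LINT x|lebesgue. norm (f x * g x)) \<le> L2_norm f * L2_norm g"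
    by (rule power2_le_imp_le) (simp add: L2_norm_nonneg)
  then show "norm (LINT x|lebesgue. f x * g x) \<le> L2_norm f * L2_norm g"
    using integral_norm_bound[of lebesgue "\<lambda>x. f x * g x"] by linarith
qed

lemma schwartz_square_integrable:
  assumes "\<phi> \<in> schwartz"
  shows "square_integrable \<phi>"
proof -
  obtain C where C: "C \<ge> 0" "\<And>x. norm (\<phi> x) \<le> C * decay 1 x"
    using schwartz_decayE[OF assms] by blast
  have [measurable]: "\<phi> \<in> borel_measurable borel" by (rule schwartz_borel_measurable[OF assms])
  have "norm ((norm (\<phi> x))\<^sup>2) \<le> C\<^sup>2 * decay 1 x" for x
  proof -
    have "(norm (\<phi> x))\<^sup>2 \<le> (C * decay 1 x)\<^sup>2" by (intro power_mono C) auto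
    also have "\<dots> = C\<^sup>2 * (decay 1 x * decay 1 x)" by (simp add: power2_eq_square)
    also have "\<dots> \<le> C\<^sup>2 * decay 1 x"
      using decay_1_le_1[of x] decay_pos[of 1 x] by (intro mult_left_mono mult_left_le) auto
    finally show ?thesis by simp
  qed
  then have "integrable lborel (\<lambda>x. (norm (\<phi> x))\<^sup>2)"
    by (rule integrable_decay_bound[rotated]) measurable
  then show ?thesis
    unfolding square_integrable_def by (auto simp: integrable_completion measurable_completion)
qed

text \<open>Letting bumps converge to the indicator of a box shows that \<open>g\<close> has integral \<open>0\<close> over every box.
  Boxes are an intersection-stable generator of the Borel sets, so the same holds for all Borel
  subsets of a large box, which forces \<open>g\<close> to vanish almost everywhere there.  The argument runs on
  a Borel representative of \<open>g\<close>.\<close>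

theorem fundamental_lemma_calculus_of_variations:
  fixes g :: "'a::euclidean_space \<Rightarrow> complex"
  assumes g: "square_integrable g"
    and zero: "\<And>\<psi>. \<psi> \<in> test_functions \<Longrightarrow> (LINT x|lebesgue. g x * \<psi> x) = 0"
  shows "AE x in lebesgue. g x = 0"
proof -
  obtain f where f [measurable]: "f \<in> borel_measurable borel" and fg: "AE x in lebesgue. g x = f x"
    using lebesgue_borel_representative g unfolding square_integrable_def by blast
  have gm: "g \<in> borel_measurable lebesgue" using g by (simp add: square_integrable_def)
  have fm: "f \<in> borel_measurable lebesgue" by (rule measurable_completion) simp
  have f2: "integrable lborel (\<lambda>x. (norm (f x))\<^sup>2)"
  proof -
    have "integrable lebesgue (\<lambda>x. (norm (f x))\<^sup>2)"
      using g fg gm fm unfolding square_integrable_def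
      by (elim conjE, subst integrable_cong_AE[of _ _ "\<lambda>x. (norm (g x))\<^sup>2"]) auto
    then show ?thesis by (subst (asm) integrable_completion) auto
  qed
  have fbox: "integrable lborel (\<lambda>x. indicator (box l r) x *\<^sub>R f x)" for l r
  proof (rule Bochner_Integration.integrable_bound)
    show "integrable lborel (\<lambda>x. indicator (box l r) x + (norm (f x))\<^sup>2)"
      by (intro Bochner_Integration.integrable_add f2 integrable_real_indicator)
         (auto simp: emeasure_lborel_box_eq)
    have "norm (f x) \<le> 1 + (norm (f x))\<^sup>2" for x
      using sum_squares_bound[of "norm (f x)" 1] norm_ge_zero[of "f x"] by (simp add: power2_eq_square) (smt (verit) norm_ge_zero)
    then show "AE x in lborel. norm (indicator (box l r) x *\<^sub>R f x) \<le> norm (indicator (box l r) x + (norm (f x))\<^sup>2)"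
      by (intro AE_I2) (auto simp: indicator_def)
  qed measurable
  have box0: "(LINT x|lborel. indicator (box l r) x *\<^sub>R f x) = 0" for l r
  proof -
    have [measurable]: "(\<lambda>x::'a. complex_of_real (box_bump l r n x)) \<in> borel_measurable borel" for n
      using box_bump_test_function test_functions_subset_schwartz schwartz_borel_measurable by blast
    have "(\<lambda>n. LINT x|lborel. f x * of_real (box_bump l r n x)) \<longlonglongrightarrow> (LINT x|lborel. indicator (box l r) x *\<^sub>R f x)"
    proof (rule integral_dominated_convergence)
      show "integrable lborel (\<lambda>x. norm (indicator (box l r) x *\<^sub>R f x))"
        by (rule integrable_norm[OF fbox])
      show "AE x in lborel. norm (f x * of_real (box_bump l r n x)) \<le> norm (indicator (box l r) x *\<^sub>R f x)" for n
      proof (intro AE_I2)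
        fix x
        show "norm (f x * of_real (box_bump l r n x)) \<le> norm (indicator (box l r) x *\<^sub>R f x)"
          using box_bump_bounds[of l r n x] box_bump_outside[of x l r n]
          by (cases "x \<in> box l r") (auto simp: norm_mult mult_left_le)
      qed
      show "AE x in lborel. (\<lambda>n. f x * of_real (box_bump l r n x)) \<longlonglongrightarrow> indicator (box l r) x *\<^sub>R f x"
      proof (intro AE_I2)
        fix x
        have "(\<lambda>n. f x * of_real (box_bump l r n x)) \<longlonglongrightarrow> f x * of_real (indicator (box l r) x)"
          by (intro tendsto_intros box_bump_tendsto)
        then show "(\<lambda>n. f x * of_real (box_bump l r n x)) \<longlonglongrightarrow> indicator (box l r) x *\<^sub>R f x"
          by (simp add: scaleR_conv_of_real mult.commute)
      qed
    qed measurable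
    moreover have "(LINT x|lborel. f x * of_real (box_bump l r n x)) = 0" for n
    proof -
      have bm: "(\<lambda>x::'a. complex_of_real (box_bump l r n x)) \<in> borel_measurable lebesgue"
        by (rule measurable_completion) simp
      have "(LINT x|lborel. f x * of_real (box_bump l r n x)) = (LINT x|lebesgue. f x * of_real (box_bump l r n x))"
        by (rule integral_completion[symmetric]) simp
      also have "\<dots> = (LINT x|lebesgue. g x * of_real (box_bump l r n x))"
        using fg gm fm bm by (intro integral_cong_AE borel_measurable_times) auto
      also have "\<dots> = 0" by (rule zero[OF box_bump_test_function])
      finally show ?thesis .
    qed
    ultimately show ?thesis by (simp add: LIMSEQ_const_iff)
  qed
  have "AE x in lborel. indicator (box (- (real n *\<^sub>R One)) (real n *\<^sub>R One)) x *\<^sub>R f x = 0" for n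
  proof (rule sigma_finite_measure.density_zero[OF lborel.sigma_finite_measure_axioms fbox])
    let ?Q = "box (- (real n *\<^sub>R One)) (real n *\<^sub>R One) :: 'a set"
    let ?h = "\<lambda>x. indicator ?Q x *\<^sub>R f x"
    fix A :: "'a set" assume "A \<in> sets lborel"
    then have A: "A \<in> sigma_sets UNIV (range (\<lambda>(a, b). box a b))"
      by (simp add: borel_eq_box)
    have "Int_stable (range (\<lambda>(a, b). box a b :: 'a set))"
      by (auto simp: Int_stable_def box_Int_box)
    moreover have "range (\<lambda>(a, b). box a b :: 'a set) \<subseteq> Pow UNIV" by simp
    moreover note A
    ultimately show "set_lebesgue_integral lborel A ?h = 0"
    proof (induction rule: sigma_sets_induct_disjoint)
      case (basic A)
      then obtain a b where A: "A = box a b" by auto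
      have "indicator A x *\<^sub>R ?h x = indicator (A \<inter> ?Q) x *\<^sub>R f x" for x
        by (simp add: indicator_def)
      then have "set_lebesgue_integral lborel A ?h = (LINT x|lborel. indicator (A \<inter> ?Q) x *\<^sub>R f x)"
        by (simp only: set_lebesgue_integral_def)
      also have "\<dots> = 0" unfolding A box_Int_box by (rule box0)
      finally show ?case .
    next
      case empty
      show ?case by (simp add: set_lebesgue_integral_def)
    next
      case (compl A)
      then have [measurable]: "A \<in> sets borel" by (simp add: borel_eq_box)
      have "set_lebesgue_integral lborel (UNIV - A) ?h = (LINT x|lborel. ?h x - indicator A x *\<^sub>R ?h x)"
        unfolding set_lebesgue_integral_def
        by (intro Bochner_Integration.integral_cong refl) (auto simp: indicator_def)
      also have "\<dots> = (LINT x|lborel. ?h x) - (LINT x|lborel. indicator A x *\<^sub>R ?h x)"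
        by (intro Bochner_Integration.integral_diff fbox integrable_mult_indicator) auto
      also have "\<dots> = 0" using compl.IH box0 by (simp add: set_lebesgue_integral_def)
      finally show ?case .
    next
      case (union B)
      have B: "B i \<in> sets lborel" for i using union(2) by (auto simp: borel_eq_box)
      have "set_lebesgue_integral lborel (\<Union>i. B i) ?h = (\<Sum>i. set_lebesgue_integral lborel (B i) ?h)"
      proof (rule lebesgue_integral_countable_add)
        show "set_integrable lborel (\<Union>i. B i) ?h"
          unfolding set_integrable_def using B by (intro integrable_mult_indicator fbox sets.countable_UN) auto
        show "B i \<inter> B j = {}" if "i \<noteq> j" for i j
          using union(1) that by (auto simp: disjoint_family_on_def)
      qed (rule B)
      then show ?case using union.IH by simp
    qed
  qed
  then have "AE x in lborel. \<forall>n. indicator (box (- (real n *\<^sub>R One)) (real n *\<^sub>R One)) x *\<^sub>R f x = 0"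
    by (subst AE_all_countable) blast
  then have "AE x in lborel. f x = 0"
  proof eventually_elim
    case (elim x)
    have "x \<in> (\<Union>n. box (- (real n *\<^sub>R One)) (real n *\<^sub>R One))"
      using UN_box_eq_UNIV by blast
    then obtain n :: nat where "x \<in> box (- (real n *\<^sub>R One)) (real n *\<^sub>R One)" by blast
    then show ?case using elim by (auto dest: spec[of _ n])
  qed
  then have "AE x in lebesgue. f x = 0" by (rule AE_completion)
  with fg show ?thesis by eventually_elim simp
qed

section \<open>Weak derivatives\<close>

lemma test_function_square_integrable: "\<psi> \<in> test_functions \<Longrightarrow> square_integrable \<psi>"
  using test_functions_subset_schwartz schwartz_square_integrable by blast

lemma test_function_partials_square_integrable:
  "\<psi> \<in> test_functions \<Longrightarrow> set bs \<subseteq> Basis \<Longrightarrow> square_integrable (partials bs \<psi>)"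
  using test_functions_subset_schwartz by (blast intro: schwartz_square_integrable schwartz_partials)

lemma has_weak_partials_unique:
  assumes g: "square_integrable g" "square_integrable h"
    and w: "has_weak_partials bs f g" "has_weak_partials bs f h"
  shows "AE x in lebesgue. g x = h x"
proof -
  have "AE x in lebesgue. g x - h x = 0"
  proof (rule fundamental_lemma_calculus_of_variations)
    show "square_integrable (\<lambda>x. g x - h x)" by (intro square_integrable_diff g)
    fix \<psi> :: "'a \<Rightarrow> complex" assume \<psi>: "\<psi> \<in> test_functions"
    have "(-1) ^ length bs * (LINT x|lebesgue. g x * \<psi> x) = (-1) ^ length bs * (LINT x|lebesgue. h x * \<psi> x)"
      using w \<psi> by (simp add: has_weak_partials_def)
    then have "(LINT x|lebesgue. g x * \<psi> x) = (LINT x|lebesgue. h x * \<psi> x)" by simp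
    then show "(LINT x|lebesgue. (g x - h x) * \<psi> x) = 0"
      using integrable_L2_mult[OF g(1) test_function_square_integrable[OF \<psi>]]
        integrable_L2_mult[OF g(2) test_function_square_integrable[OF \<psi>]]
      by (simp add: left_diff_distrib)
  qed
  then show ?thesis by simp
qed

lemma weak_partials_works:
  assumes "\<phi> \<in> sobolev m" "bs \<in> directions m"
  shows "square_integrable (weak_partials bs \<phi>)" "has_weak_partials bs \<phi> (weak_partials bs \<phi>)"
proof -
  have "\<exists>g. square_integrable g \<and> has_weak_partials bs \<phi> g"
    using assms by (simp add: sobolev_def)
  then have "square_integrable (weak_partials bs \<phi>) \<and> has_weak_partials bs \<phi> (weak_partials bs \<phi>)"
    unfolding weak_partials_def by (rule someI_ex)
  then show "square_integrable (weak_partials bs \<phi>)" "has_weak_partials bs \<phi> (weak_partials bs \<phi>)"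
    by auto
qed

lemma weak_partials_AE:
  assumes "square_integrable g" "has_weak_partials bs \<phi> g"
  shows "square_integrable (weak_partials bs \<phi>)" "AE x in lebesgue. weak_partials bs \<phi> x = g x"
proof -
  have "square_integrable (weak_partials bs \<phi>) \<and> has_weak_partials bs \<phi> (weak_partials bs \<phi>)"
    unfolding weak_partials_def by (rule someI[where x=g]) (use assms in simp)
  then show "square_integrable (weak_partials bs \<phi>)" "AE x in lebesgue. weak_partials bs \<phi> x = g x"
    using has_weak_partials_unique assms by blast+
qed

lemma has_weak_partials_linear:
  assumes f: "square_integrable f1" "square_integrable f2"
    and g: "square_integrable g1" "square_integrable g2"
    and w: "has_weak_partials bs f1 g1" "has_weak_partials bs f2 g2" and bs: "set bs \<subseteq> Basis"
  shows "has_weak_partials bs (\<lambda>x. c * f1 x + f2 x) (\<lambda>x. c * g1 x + g2 x)"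
  unfolding has_weak_partials_def
proof
  fix \<psi> :: "'a \<Rightarrow> complex" assume \<psi>: "\<psi> \<in> test_functions"
  note t = test_function_square_integrable[OF \<psi>] and p = test_function_partials_square_integrable[OF \<psi> bs]
  have "(LINT x|lebesgue. (c * f1 x + f2 x) * partials bs \<psi> x)
      = c * (LINT x|lebesgue. f1 x * partials bs \<psi> x) + (LINT x|lebesgue. f2 x * partials bs \<psi> x)"
    using integrable_L2_mult[OF f(1) p] integrable_L2_mult[OF f(2) p]
    by (simp add: distrib_right mult.assoc)
  also have "\<dots> = (- 1) ^ length bs * (c * (LINT x|lebesgue. g1 x * \<psi> x) + (LINT x|lebesgue. g2 x * \<psi> x))"
    using w \<psi> by (simp add: has_weak_partials_def algebra_simps)
  also have "c * (LINT x|lebesgue. g1 x * \<psi> x) + (LINT x|lebesgue. g2 x * \<psi> x)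
      = (LINT x|lebesgue. (c * g1 x + g2 x) * \<psi> x)"
    using integrable_L2_mult[OF g(1) t] integrable_L2_mult[OF g(2) t]
    by (simp add: distrib_right mult.assoc)
  finally show "(LINT x|lebesgue. (c * f1 x + f2 x) * partials bs \<psi> x)
      = (- 1) ^ length bs * (LINT x|lebesgue. (c * g1 x + g2 x) * \<psi> x)" .
qed

lemma directions_Basis: "bs \<in> directions m \<Longrightarrow> set bs \<subseteq> Basis"
  by (simp add: directions_def)

lemma finite_directions: "finite (directions m :: 'a::euclidean_space list set)"
  unfolding directions_def by (rule finite_lists_length_le[OF finite_Basis])

lemma sobolev_square_integrable: "\<phi> \<in> sobolev m \<Longrightarrow> square_integrable \<phi>"
  by (simp add: sobolev_def)

lemma weak_partials_linear:
  assumes "\<phi> \<in> sobolev m" "\<psi> \<in> sobolev m" "bs \<in> directions m"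
  shows "square_integrable (weak_partials bs (\<lambda>x. c * \<phi> x + \<psi> x))"
    and "AE x in lebesgue. weak_partials bs (\<lambda>x. c * \<phi> x + \<psi> x) x
      = c * weak_partials bs \<phi> x + weak_partials bs \<psi> x"
proof -
  note w = weak_partials_works[OF assms(1,3)] weak_partials_works[OF assms(2,3)]
  have "square_integrable (\<lambda>x. c * weak_partials bs \<phi> x + weak_partials bs \<psi> x)"
    by (intro square_integrable_add square_integrable_cmult w)
  moreover have "has_weak_partials bs (\<lambda>x. c * \<phi> x + \<psi> x) (\<lambda>x. c * weak_partials bs \<phi> x + weak_partials bs \<psi> x)"
    by (intro has_weak_partials_linear w sobolev_square_integrable[OF assms(1)]
        sobolev_square_integrable[OF assms(2)] directions_Basis[OF assms(3)])
  ultimately show "square_integrable (weak_partials bs (\<lambda>x. c * \<phi> x + \<psi> x))"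
    "AE x in lebesgue. weak_partials bs (\<lambda>x. c * \<phi> x + \<psi> x) x
      = c * weak_partials bs \<phi> x + weak_partials bs \<psi> x"
    by (rule weak_partials_AE)+
qed

text \<open>The outermost derivative of \<open>\<psi>\<close> is moved first and ends up innermost on \<open>\<phi>\<close>, whence the reversal
  of the list.\<close>

lemma schwartz_iterated_integration_by_parts:
  fixes \<phi> \<psi> :: "'a::euclidean_space \<Rightarrow> complex"
  assumes "\<phi> \<in> schwartz" "\<psi> \<in> schwartz" "set bs \<subseteq> Basis"
  shows "(LINT x|lborel. \<phi> x * partials bs \<psi> x)
    = (-1) ^ length bs * (LINT x|lborel. partials (rev bs) \<phi> x * \<psi> x)"
  using assms(1,3)
proof (induction bs arbitrary: \<phi>)
  case (Cons b bs)
  have b: "b \<in> Basis" and bs: "set bs \<subseteq> Basis" using Cons.prems by auto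
  have e: "partials bs \<psi> \<in> schwartz" by (intro schwartz_partials assms bs)
  have e': "partials [b] (partials bs \<psi>) \<in> schwartz" using b by (intro schwartz_partials[OF e]) auto
  obtain E where E: "\<And>x. norm (partials bs \<psi> x) \<le> E" using schwartz_bounded[OF e] by blast
  obtain E' where E': "\<And>x. norm (partials [b] (partials bs \<psi>) x) \<le> E'" using schwartz_bounded[OF e'] by blast
  have "(LINT x|lborel. partials [b] \<phi> x * partials bs \<psi> x)
      = - (LINT x|lborel. \<phi> x * partials [b] (partials bs \<psi>) x)"
    by (rule schwartz_integration_by_parts[OF Cons.prems(1) b schwartz_differentiable[OF e] E
          schwartz_borel_measurable[OF e'] E'])
  then have "(LINT x|lborel. \<phi> x * partials (b # bs) \<psi> x) = - (LINT x|lborel. partials [b] \<phi> x * partials bs \<psi> x)"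
    by simp
  also have "(LINT x|lborel. partials [b] \<phi> x * partials bs \<psi> x)
      = (- 1) ^ length bs * (LINT x|lborel. partials (rev bs) (partials [b] \<phi>) x * \<psi> x)"
    using b by (intro Cons.IH schwartz_partials Cons.prems bs) auto
  finally show ?case by (simp add: partials_append)
qed simp

lemma schwartz_has_weak_partials:
  assumes \<phi>: "\<phi> \<in> schwartz" and bs: "set bs \<subseteq> Basis"
  shows "has_weak_partials bs \<phi> (partials (rev bs) \<phi>)"
  unfolding has_weak_partials_def
proof
  fix \<psi> :: "'a \<Rightarrow> complex" assume "\<psi> \<in> test_functions"
  then have \<psi>: "\<psi> \<in> schwartz" using test_functions_subset_schwartz by blast
  have "partials bs \<psi> \<in> schwartz" "partials (rev bs) \<phi> \<in> schwartz"
    using bs by (intro schwartz_partials \<psi> \<phi>; simp)+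
  note [measurable] = this[THEN schwartz_borel_measurable] \<phi>[THEN schwartz_borel_measurable] \<psi>[THEN schwartz_borel_measurable]
  show "(LINT x|lebesgue. \<phi> x * partials bs \<psi> x) = (- 1) ^ length bs * (LINT x|lebesgue. partials (rev bs) \<phi> x * \<psi> x)"
    using schwartz_iterated_integration_by_parts[OF \<phi> \<psi> bs]
    by (subst (1 2) integral_completion) auto
qed

lemma schwartz_subset_sobolev: "schwartz \<subseteq> sobolev m"
proof
  fix \<phi> :: "'a \<Rightarrow> complex" assume \<phi>: "\<phi> \<in> schwartz"
  have "square_integrable (partials (rev bs) \<phi>) \<and> has_weak_partials bs \<phi> (partials (rev bs) \<phi>)"
    if "bs \<in> directions m" for bs
    using directions_Basis[OF that]
    by (intro conjI schwartz_square_integrable schwartz_partials schwartz_has_weak_partials \<phi>) auto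
  then show "\<phi> \<in> sobolev m"
    unfolding sobolev_def using schwartz_square_integrable[OF \<phi>] by blast
qed

section \<open>Pairing square integrable functions through the Fourier transform\<close>

definition truncate :: "nat \<Rightarrow> ('a::euclidean_space \<Rightarrow> complex) \<Rightarrow> 'a \<Rightarrow> complex" where
  "truncate n w \<xi> = (if norm \<xi> \<le> real n then w \<xi> else 0)"

definition square_integrable_borel :: "('a::euclidean_space \<Rightarrow> complex) \<Rightarrow> bool" where
  "square_integrable_borel w \<longleftrightarrow> w \<in> borel_measurable borel \<and> integrable lborel (\<lambda>x. (norm (w x))\<^sup>2)"

lemma square_integrable_borelD:
  assumes "square_integrable_borel w"
  shows "square_integrable w" "L2_norm w = sqrt (LINT x|lborel. (norm (w x))\<^sup>2)"
proof -
  have [measurable]: "w \<in> borel_measurable borel" and i: "integrable lborel (\<lambda>x. (norm (w x))\<^sup>2)"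
    using assms by (auto simp: square_integrable_borel_def)
  show "square_integrable w"
    unfolding square_integrable_def using i
    by (auto simp: integrable_completion intro!: measurable_completion)
  show "L2_norm w = sqrt (LINT x|lborel. (norm (w x))\<^sup>2)"
    unfolding L2_norm_def by (subst integral_completion) auto
qed

lemma fourier_L2_contraction:
  assumes "integrable lborel w" "square_integrable_borel w"
  shows "square_integrable (fourier w)" "L2_norm (fourier w) \<le> L2_norm w"
proof -
  have w2: "integrable lborel (\<lambda>x. (norm (w x))\<^sup>2)" using assms by (simp add: square_integrable_borel_def)
  have "square_integrable_borel (fourier w)"
    unfolding square_integrable_borel_def
    using fourier_bessel_inequality(1)[OF assms(1) w2] assms(1) by (auto intro!: borel_measurable_fourier)
  from square_integrable_borelD[OF this] show "square_integrable (fourier w)" "L2_norm (fourier w) \<le> L2_norm w"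
    using square_integrable_borelD(2)[OF assms(2)] fourier_bessel_inequality(2)[OF assms(1) w2] by auto
qed

lemma truncate_measurable:
  assumes [measurable]: "w \<in> borel_measurable borel"
  shows "truncate n w \<in> borel_measurable borel"
  unfolding truncate_def[abs_def] by measurable

lemma norm_truncate_le: "norm (truncate n w \<xi>) \<le> norm (w \<xi>)"
  by (simp add: truncate_def)

lemma square_integrable_borel_mono:
  assumes w: "square_integrable_borel w" and v: "v \<in> borel_measurable borel" "\<And>x. norm (v x) \<le> norm (w x)"
  shows "square_integrable_borel v" "L2_norm v \<le> L2_norm w"
proof -
  note [measurable] = v(1)
  have w2: "integrable lborel (\<lambda>x. (norm (w x))\<^sup>2)" using w by (simp add: square_integrable_borel_def)
  have le: "(norm (v x))\<^sup>2 \<le> (norm (w x))\<^sup>2" for x by (intro power_mono v) simp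
  have v2: "integrable lborel (\<lambda>x. (norm (v x))\<^sup>2)"
    by (rule Bochner_Integration.integrable_bound[OF w2]) (auto simp: le)
  then show vv: "square_integrable_borel v" by (simp add: square_integrable_borel_def)
  show "L2_norm v \<le> L2_norm w"
    unfolding square_integrable_borelD(2)[OF vv] square_integrable_borelD(2)[OF w]
    by (intro real_sqrt_le_mono integral_mono v2 w2 le)
qed

lemma truncate_integrable:
  assumes w: "square_integrable_borel w"
  shows "integrable lborel (truncate n w)"
proof (rule Bochner_Integration.integrable_bound)
  have [measurable]: "w \<in> borel_measurable borel" using w by (simp add: square_integrable_borel_def)
  show "integrable lborel (\<lambda>\<xi>. indicator (cball 0 (real n)) \<xi> + (norm (w \<xi>))\<^sup>2)"
    using w emeasure_lborel_cball_finite[of 0 "real n"] unfolding square_integrable_borel_def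
    by (intro Bochner_Integration.integrable_add integrable_real_indicator) auto
  have "norm (w \<xi>) \<le> 1 + (norm (w \<xi>))\<^sup>2" for \<xi>
    using sum_squares_bound[of "norm (w \<xi>)" 1] by simp (smt (verit) norm_ge_zero)
  then show "AE \<xi> in lborel. norm (truncate n w \<xi>) \<le> norm (indicator (cball 0 (real n)) \<xi> + (norm (w \<xi>))\<^sup>2)"
    by (intro AE_I2) (auto simp: truncate_def indicator_def)
  show "truncate n w \<in> borel_measurable lborel" using truncate_measurable[of w n] by simp
qed

lemma truncate_square_integrable:
  assumes "square_integrable_borel w"
  shows "square_integrable_borel (truncate n w)"
  using assms by (intro square_integrable_borel_mono(1)[OF assms] truncate_measurable norm_truncate_le)
    (simp add: square_integrable_borel_def)

definition truncated_pairing :: "('a::euclidean_space \<Rightarrow> complex) \<Rightarrow> nat \<Rightarrow> ('a \<Rightarrow> complex) \<Rightarrow> complex" where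
  "truncated_pairing w n f = (LINT x|lebesgue. fourier (truncate n w) x * f x)"

text \<open>The extension of \<open>f \<mapsto> \<integral> w (F f)\<close> from Schwartz functions to all square integrable \<open>f\<close>.  A
  truncation of \<open>w\<close> is integrable and so has a pointwise transform, which can be paired with \<open>f\<close>.\<close>

definition fourier_pairing :: "('a::euclidean_space \<Rightarrow> complex) \<Rightarrow> ('a \<Rightarrow> complex) \<Rightarrow> complex" where
  "fourier_pairing w f = lim (\<lambda>n. truncated_pairing w n f)"

lemma fourier_diff:
  assumes "integrable lborel f" "integrable lborel g"
  shows "fourier (\<lambda>x. f x - g x) \<xi> = fourier f \<xi> - fourier g \<xi>"
proof -
  have "f \<in> borel_measurable borel" "g \<in> borel_measurable borel" using assms by auto
  then show ?thesis
    using integrable_times_character[OF assms(1)] integrable_times_character[OF assms(2)]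
    by (simp add: fourier_lborel left_diff_distrib)
qed

text \<open>Bessel's inequality bounds the difference of two pairings by the norm of \<open>w\<close> outside a ball, so
  they form a Cauchy sequence.\<close>

lemma truncated_pairing_limit:
  assumes w: "square_integrable_borel w" and f: "square_integrable f"
  shows "(\<lambda>n. truncated_pairing w n f) \<longlonglongrightarrow> fourier_pairing w f"
proof -
  have [measurable]: "w \<in> borel_measurable borel" and w2: "integrable lborel (\<lambda>x. (norm (w x))\<^sup>2)"
    using w by (auto simp: square_integrable_borel_def)
  note [measurable] = truncate_measurable
  define tail where "tail k x = w x - truncate k w x" for k x
  have tail: "square_integrable_borel (tail k)" for k
    by (rule square_integrable_borel_mono[OF w]) (auto simp: tail_def[abs_def] truncate_def)
  have est: "norm (truncated_pairing w n f - truncated_pairing w k f) \<le> L2_norm (tail k) * L2_norm f"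
    if "k \<le> n" for n k
  proof -
    define v where "v x = truncate n w x - truncate k w x" for x
    have vi: "integrable lborel v"
      unfolding v_def[abs_def] by (intro Bochner_Integration.integrable_diff truncate_integrable w)
    have v2: "square_integrable_borel v" "L2_norm v \<le> L2_norm (tail k)"
      by (rule square_integrable_borel_mono[OF tail[of k]]; use that in \<open>auto simp: v_def[abs_def] truncate_def tail_def\<close>)+
    note Fv = fourier_L2_contraction[OF vi v2(1)]
    note Fn = fourier_L2_contraction(1)[OF truncate_integrable[OF w] truncate_square_integrable[OF w]]
    have "truncated_pairing w n f - truncated_pairing w k f
        = (LINT x|lebesgue. fourier (truncate n w) x * f x - fourier (truncate k w) x * f x)"
      unfolding truncated_pairing_def
      by (intro Bochner_Integration.integral_diff[symmetric] integrable_L2_mult Fn f)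
    also have "\<dots> = (LINT x|lebesgue. fourier v x * f x)"
      unfolding v_def[abs_def] fourier_diff[OF truncate_integrable[OF w] truncate_integrable[OF w]] left_diff_distrib ..
    also have "norm \<dots> \<le> L2_norm (fourier v) * L2_norm f"
      by (rule L2_Cauchy_Schwarz[OF Fv(1) f])
    also have "\<dots> \<le> L2_norm (tail k) * L2_norm f"
      using Fv(2) v2(2) by (intro mult_right_mono L2_norm_nonneg) simp
    finally show ?thesis .
  qed
  have "(\<lambda>k. LINT x|lborel. (norm (tail k x))\<^sup>2) \<longlonglongrightarrow> (LINT x|(lborel :: 'a measure). 0)"
  proof (rule integral_dominated_convergence)
    show "AE x in lborel. norm ((norm (tail k x))\<^sup>2) \<le> (norm (w x))\<^sup>2" for k
      by (intro AE_I2) (simp add: tail_def truncate_def)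
    show "AE x in lborel. (\<lambda>k. (norm (tail k x))\<^sup>2) \<longlonglongrightarrow> 0"
    proof (intro AE_I2 tendsto_eventually)
      fix x :: 'a
      have "\<forall>\<^sub>F k in sequentially. norm x \<le> real k"
        using filterlim_real_sequentially by (simp add: filterlim_at_top)
      then show "\<forall>\<^sub>F k in sequentially. (norm (tail k x))\<^sup>2 = 0"
        by eventually_elim (simp add: tail_def truncate_def)
    qed
  qed (use w2 in \<open>auto simp: tail_def[abs_def]\<close>)
  then have "(\<lambda>k. sqrt (LINT x|lborel. (norm (tail k x))\<^sup>2) * L2_norm f) \<longlonglongrightarrow> sqrt (LINT x|(lborel :: 'a measure). 0) * L2_norm f"
    by (intro tendsto_intros)
  then have lim: "(\<lambda>k. L2_norm (tail k) * L2_norm f) \<longlonglongrightarrow> 0"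
    by (simp add: square_integrable_borelD(2)[OF tail])
  have "Cauchy (\<lambda>n. truncated_pairing w n f)"
    unfolding Cauchy_altdef2
  proof (intro allI impI)
    fix e :: real assume "e > 0"
    with lim have "\<forall>\<^sub>F k in sequentially. L2_norm (tail k) * L2_norm f < e"
      by (rule order_tendstoD)
    then obtain N where "L2_norm (tail N) * L2_norm f < e"
      by (auto simp: eventually_sequentially)
    then show "\<exists>N. \<forall>n\<ge>N. dist (truncated_pairing w n f) (truncated_pairing w N f) < e"
      using est by (intro exI[of _ N]) (auto simp: dist_norm intro: le_less_trans)
  qed
  then show ?thesis
    unfolding fourier_pairing_def by (intro convergent_LIMSEQ_iff[THEN iffD1] Cauchy_convergent)
qed

lemma norm_fourier_pairing_le:
  assumes w: "square_integrable_borel w" and f: "square_integrable f"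
  shows "norm (fourier_pairing w f) \<le> L2_norm w * L2_norm f"
proof (rule LIMSEQ_le_const2)
  show "(\<lambda>n. norm (truncated_pairing w n f)) \<longlonglongrightarrow> norm (fourier_pairing w f)"
    by (intro tendsto_norm truncated_pairing_limit assms)
  have wm: "w \<in> borel_measurable borel" using w by (simp add: square_integrable_borel_def)
  have "norm (truncated_pairing w n f) \<le> L2_norm w * L2_norm f" for n
  proof -
    note Fn = fourier_L2_contraction[OF truncate_integrable[OF w] truncate_square_integrable[OF w], of n]
    have "norm (truncated_pairing w n f) \<le> L2_norm (fourier (truncate n w)) * L2_norm f"
      unfolding truncated_pairing_def by (rule L2_Cauchy_Schwarz[OF Fn(1) f])
    also have "\<dots> \<le> L2_norm w * L2_norm f"
      using Fn(2) square_integrable_borel_mono(2)[OF w truncate_measurable[OF wm] norm_truncate_le, of n]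
      by (intro mult_right_mono L2_norm_nonneg) simp
    finally show ?thesis .
  qed
  then show "\<exists>N. \<forall>n\<ge>N. norm (truncated_pairing w n f) \<le> L2_norm w * L2_norm f" by blast
qed

lemma fourier_pairing_linear:
  assumes w: "square_integrable_borel w" and f: "square_integrable f" "square_integrable g" "square_integrable h"
    and eq: "AE x in lebesgue. h x = c * f x + g x"
  shows "fourier_pairing w h = c * fourier_pairing w f + fourier_pairing w g"
proof -
  have "truncated_pairing w n h = c * truncated_pairing w n f + truncated_pairing w n g" for n
  proof -
    note Fn = fourier_L2_contraction(1)[OF truncate_integrable[OF w] truncate_square_integrable[OF w], of n]
    have m: "fourier (truncate n w) \<in> borel_measurable lebesgue" "f \<in> borel_measurable lebesgue"
      "g \<in> borel_measurable lebesgue" "h \<in> borel_measurable lebesgue"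
      using Fn f by (auto simp: square_integrable_def)
    have "truncated_pairing w n h = (LINT x|lebesgue. c * (fourier (truncate n w) x * f x) + fourier (truncate n w) x * g x)"
      unfolding truncated_pairing_def using eq m
      by (intro integral_cong_AE) (auto simp: algebra_simps)
    also have "\<dots> = c * truncated_pairing w n f + truncated_pairing w n g"
      unfolding truncated_pairing_def
      using integrable_L2_mult[OF Fn f(1)] integrable_L2_mult[OF Fn f(2)] by simp
    finally show ?thesis .
  qed
  then have "(\<lambda>n. truncated_pairing w n h) \<longlonglongrightarrow> c * fourier_pairing w f + fourier_pairing w g"
    using truncated_pairing_limit[OF w f(1)] truncated_pairing_limit[OF w f(2)]
    by (auto intro!: tendsto_intros)
  with truncated_pairing_limit[OF w f(3)] show ?thesis by (rule LIMSEQ_unique)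
qed

lemma fourier_pairing_schwartz:
  assumes w: "square_integrable_borel w" and \<phi>: "\<phi> \<in> schwartz"
    and f: "square_integrable f" "AE x in lebesgue. f x = \<phi> x"
  shows "integrable lborel (\<lambda>\<xi>. w \<xi> * fourier \<phi> \<xi>)"
    and "fourier_pairing w f = (LINT \<xi>|lborel. w \<xi> * fourier \<phi> \<xi>)"
proof -
  have wm [measurable]: "w \<in> borel_measurable borel" using w by (simp add: square_integrable_borel_def)
  note F\<phi> = fourier_in_schwartz[OF \<phi>]
  have [measurable]: "\<phi> \<in> borel_measurable borel" "fourier \<phi> \<in> borel_measurable borel"
    by (intro schwartz_borel_measurable \<phi> F\<phi>)+
  have "integrable lebesgue (\<lambda>\<xi>. w \<xi> * fourier \<phi> \<xi>)"
    by (intro integrable_L2_mult square_integrable_borelD[OF w] schwartz_square_integrable F\<phi>)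
  then show int: "integrable lborel (\<lambda>\<xi>. w \<xi> * fourier \<phi> \<xi>)"
    by (subst (asm) integrable_completion) auto
  have "truncated_pairing w n f = (LINT \<xi>|lborel. truncate n w \<xi> * fourier \<phi> \<xi>)" for n
  proof -
    have [measurable]: "fourier (truncate n w) \<in> borel_measurable borel"
      by (intro borel_measurable_fourier truncate_measurable wm)
    have "fourier (truncate n w) \<in> borel_measurable lebesgue" "\<phi> \<in> borel_measurable lebesgue"
      by (rule measurable_completion, simp)+
    then have "truncated_pairing w n f = (LINT x|lebesgue. fourier (truncate n w) x * \<phi> x)"
      unfolding truncated_pairing_def using f
      by (intro integral_cong_AE) (auto simp: square_integrable_def)
    also have "\<dots> = (LINT x|lborel. fourier (truncate n w) x * \<phi> x)"
      by (rule integral_completion) simp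
    also have "\<dots> = (LINT \<xi>|lborel. truncate n w \<xi> * fourier \<phi> \<xi>)"
      by (intro fourier_multiplication_formula truncate_integrable w schwartz_integrable \<phi>)
    finally show ?thesis .
  qed
  moreover have "(\<lambda>n. LINT \<xi>|lborel. truncate n w \<xi> * fourier \<phi> \<xi>) \<longlonglongrightarrow> (LINT \<xi>|lborel. w \<xi> * fourier \<phi> \<xi>)"
  proof (rule integral_dominated_convergence)
    show "integrable lborel (\<lambda>\<xi>. norm (w \<xi> * fourier \<phi> \<xi>))" by (rule integrable_norm[OF int])
    show "AE \<xi> in lborel. norm (truncate n w \<xi> * fourier \<phi> \<xi>) \<le> norm (w \<xi> * fourier \<phi> \<xi>)" for n
      by (intro AE_I2) (simp add: norm_mult mult_right_mono norm_truncate_le)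
    show "AE \<xi> in lborel. (\<lambda>n. truncate n w \<xi> * fourier \<phi> \<xi>) \<longlonglongrightarrow> w \<xi> * fourier \<phi> \<xi>"
    proof (intro AE_I2 tendsto_eventually)
      fix \<xi> :: 'a
      have "\<forall>\<^sub>F n in sequentially. norm \<xi> \<le> real n"
        using filterlim_real_sequentially by (simp add: filterlim_at_top)
      then show "\<forall>\<^sub>F n in sequentially. truncate n w \<xi> * fourier \<phi> \<xi> = w \<xi> * fourier \<phi> \<xi>"
        by eventually_elim (simp add: truncate_def)
    qed
    show "(\<lambda>\<xi>. truncate n w \<xi> * fourier \<phi> \<xi>) \<in> borel_measurable lborel" for n
      using truncate_measurable[OF wm, of n] by simp
  qed simp
  ultimately have "(\<lambda>n. truncated_pairing w n f) \<longlonglongrightarrow> (LINT \<xi>|lborel. w \<xi> * fourier \<phi> \<xi>)"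
    by simp
  with truncated_pairing_limit[OF w f(1)]
  show "fourier_pairing w f = (LINT \<xi>|lborel. w \<xi> * fourier \<phi> \<xi>)" by (rule LIMSEQ_unique)
qed

section \<open>Fourier multipliers as functionals on Sobolev spaces\<close>

text \<open>Equal to \<open>\<Sum>\<^sub>k\<^sub>\<le>\<^sub>m |2 \<pi> \<xi>|\<^sup>2\<^sup>k\<close>, the weight of the squared \<open>H\<^sup>m\<close> norm on the Fourier side.\<close>

definition bessel_symbol :: "nat \<Rightarrow> 'a::euclidean_space \<Rightarrow> real" where
  "bessel_symbol m \<xi> = (\<Sum>bs\<in>directions m. (norm (symbol bs \<xi>))\<^sup>2)"

lemma borel_measurable_bessel_symbol [measurable]: "bessel_symbol m \<in> borel_measurable borel"
  unfolding bessel_symbol_def[abs_def] by measurable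

lemma symbol_le_bessel_symbol:
  "bs \<in> directions m \<Longrightarrow> (norm (symbol bs \<xi>))\<^sup>2 \<le> bessel_symbol m \<xi>"
  unfolding bessel_symbol_def by (rule member_le_sum) (auto intro: finite_directions)

lemma bessel_symbol_ge_1: "1 \<le> bessel_symbol m \<xi>"
  using symbol_le_bessel_symbol[of "[]" m \<xi>] by (simp add: directions_def)

lemma bessel_symbol_lower:
  assumes b: "b \<in> Basis"
  shows "(1 + (\<xi> \<bullet> b)\<^sup>2) ^ m \<le> 2 ^ m * bessel_symbol m \<xi>"
proof -
  define r where "r = max 1 ((\<xi> \<bullet> b)\<^sup>2)"
  have "r ^ m \<le> bessel_symbol m \<xi>"
  proof (cases "(\<xi> \<bullet> b)\<^sup>2 \<le> 1")
    case True
    then show ?thesis using bessel_symbol_ge_1 by (simp add: r_def max_def)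
  next
    case False
    have "\<bar>\<xi> \<bullet> b\<bar> ^ m \<le> (2 * pi * \<bar>\<xi> \<bullet> b\<bar>) ^ m"
      using pi_ge_two by (intro power_mono) (auto simp: mult_le_cancel_right1)
    then have "(\<bar>\<xi> \<bullet> b\<bar> ^ m)\<^sup>2 \<le> (norm (symbol (replicate m b) \<xi>))\<^sup>2"
      unfolding norm_symbol_replicate by (rule power_mono) simp
    also have "\<dots> \<le> bessel_symbol m \<xi>"
      using b by (intro symbol_le_bessel_symbol) (auto simp: directions_def)
    finally show ?thesis using False
      by (simp add: r_def max_def power_mult[symmetric] mult.commute power_even_abs)
  qed
  moreover have "(1 + (\<xi> \<bullet> b)\<^sup>2) ^ m \<le> (2 * r) ^ m"
    by (intro power_mono) (auto simp: r_def)
  ultimately show ?thesis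
    unfolding power_mult_distrib by (meson mult_left_mono order_trans zero_le_numeral zero_le_power)
qed

text \<open>Up to the factor \<open>2\<^sup>m\<close>, the symbol dominates \<open>(1 + \<xi>\<^sub>b\<^sup>2)\<^sup>m\<close> for each of the \<open>N\<close> coordinates, hence
  also their geometric mean.  The exponent per coordinate is then \<open>m / N\<close>, which exceeds \<open>1 / 2\<close>
  exactly when \<open>m > N / 2\<close>.\<close>

lemma inverse_bessel_symbol_le:
  fixes \<xi> :: "'a::euclidean_space"
  shows "1 / bessel_symbol m \<xi> \<le> 2 ^ m * decay (real m / real DIM('a)) \<xi>"
proof -
  define n where "n = real DIM('a)"
  have n: "n > 0" by (simp add: n_def)
  define B where "B = bessel_symbol m \<xi>"
  have B: "B > 0" using bessel_symbol_ge_1[of m \<xi>] by (simp add: B_def)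
  \<comment> \<open>Splits \<open>1 / P\<close> into \<open>N\<close> equal factors, one for each coordinate.\<close>
  have eq: "(\<Prod>b\<in>(Basis::'a set). y powr (1 / n)) = y" if "y > 0" for y
    using that n by (simp add: n_def powr_realpow[symmetric] powr_powr)
  have "1 / (2 ^ m * B) = (\<Prod>b\<in>(Basis::'a set). (1 / (2 ^ m * B)) powr (1 / n))"
    by (rule eq[symmetric]) (simp add: B)
  also have "\<dots> \<le> (\<Prod>b\<in>(Basis::'a set). (1 + (\<xi> \<bullet> b)\<^sup>2) powr (- (real m / n)))"
  proof (intro prod_mono conjI)
    fix b :: 'a assume b: "b \<in> Basis"
    have pos: "1 + (\<xi> \<bullet> b)\<^sup>2 > 0" by (simp add: add_pos_nonneg)
    have "1 / (2 ^ m * B) \<le> 1 / (1 + (\<xi> \<bullet> b)\<^sup>2) ^ m"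
      using bessel_symbol_lower[OF b, of \<xi> m] B pos by (simp add: B_def frac_le)
    also have "\<dots> = (1 + (\<xi> \<bullet> b)\<^sup>2) powr (- real m)"
      using pos by (simp add: powr_minus powr_realpow divide_inverse)
    finally have "(1 / (2 ^ m * B)) powr (1 / n) \<le> ((1 + (\<xi> \<bullet> b)\<^sup>2) powr (- real m)) powr (1 / n)"
      using B n by (intro powr_mono2) auto
    then show "(1 / (2 ^ m * B)) powr (1 / n) \<le> (1 + (\<xi> \<bullet> b)\<^sup>2) powr (- (real m / n))"
      by (simp add: powr_powr)
  qed simp
  finally show ?thesis
    using B by (simp add: decay_def B_def n_def field_simps)
qed

lemma integrable_inverse_bessel_symbol:
  assumes "real m > real DIM('a::euclidean_space) / 2"
  shows "integrable lborel (\<lambda>\<xi>::'a. 1 / bessel_symbol m \<xi>)"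
proof (rule Bochner_Integration.integrable_bound)
  show "integrable lborel (\<lambda>\<xi>::'a. 2 ^ m * decay (real m / real DIM('a)) \<xi>)"
    using assms by (intro integrable_mult_right integrable_decay) (simp add: field_simps)
  have "norm (1 / bessel_symbol m \<xi>) \<le> norm (2 ^ m * decay (real m / real DIM('a)) \<xi>)" for \<xi> :: 'a
    using inverse_bessel_symbol_le[of m \<xi>] bessel_symbol_ge_1[of m \<xi>]
      decay_pos[of "real m / real DIM('a)" \<xi>] by simp
  then show "AE \<xi>::'a in lborel. norm (1 / bessel_symbol m \<xi>) \<le> norm (2 ^ m * decay (real m / real DIM('a)) \<xi>)"
    by simp
qed measurable

text \<open>The share of the multiplier \<open>E\<close> that is carried by the derivative \<open>bs\<close>.\<close>

definition multiplier_component :: "nat \<Rightarrow> ('a::euclidean_space \<Rightarrow> complex) \<Rightarrow> 'a list \<Rightarrow> 'a \<Rightarrow> complex" where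
  "multiplier_component m E bs \<xi> = E \<xi> * cnj (symbol bs \<xi>) / of_real (bessel_symbol m \<xi>)"

text \<open>The extension of \<open>\<phi> \<mapsto> \<integral> E (F \<phi>)\<close> from Schwartz functions to \<open>H\<^sup>m\<close>.\<close>

definition multiplier_functional :: "nat \<Rightarrow> ('a::euclidean_space \<Rightarrow> complex) \<Rightarrow> ('a \<Rightarrow> complex) \<Rightarrow> complex" where
  "multiplier_functional m E \<phi> =
    (\<Sum>bs\<in>directions m. fourier_pairing (multiplier_component m E bs) (weak_partials bs \<phi>))"

lemma multiplier_component_sum:
  "(\<Sum>bs\<in>directions m. multiplier_component m E bs \<xi> * symbol bs \<xi>) = E \<xi>"
proof -
  have "(\<Sum>bs\<in>directions m. multiplier_component m E bs \<xi> * symbol bs \<xi>)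
      = (\<Sum>bs\<in>directions m. E \<xi> / of_real (bessel_symbol m \<xi>) * of_real ((norm (symbol bs \<xi>))\<^sup>2))"
    by (intro sum.cong refl) (simp add: multiplier_component_def complex_norm_square mult_ac del: of_real_power)
  also have "\<dots> = E \<xi> / of_real (bessel_symbol m \<xi>) * (\<Sum>bs\<in>directions m. of_real ((norm (symbol bs \<xi>))\<^sup>2))"
    by (rule sum_distrib_left[symmetric])
  also have "(\<Sum>bs\<in>directions m. of_real ((norm (symbol bs \<xi>))\<^sup>2)) = complex_of_real (bessel_symbol m \<xi>)"
    by (simp only: bessel_symbol_def of_real_sum)
  finally show ?thesis using bessel_symbol_ge_1[of m \<xi>] by simp
qed

lemma multiplier_component_L2:
  fixes E :: "'a::euclidean_space \<Rightarrow> complex"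
  assumes m: "real m > real DIM('a) / 2" and E: "E \<in> borel_measurable borel" "\<And>\<xi>. norm (E \<xi>) \<le> M"
    and bs: "bs \<in> directions m"
  shows "square_integrable_borel (multiplier_component m E bs)"
    and "L2_norm (multiplier_component m E bs) \<le> M * sqrt (LINT \<xi>|(lborel :: 'a measure). 1 / bessel_symbol m \<xi>)"
proof -
  note [measurable] = E(1)
  have M: "M \<ge> 0" using E(2)[of 0] norm_ge_zero order_trans by blast
  have wm [measurable]: "multiplier_component m E bs \<in> borel_measurable borel"
    unfolding multiplier_component_def[abs_def] by measurable
  have le: "(norm (multiplier_component m E bs \<xi>))\<^sup>2 \<le> M\<^sup>2 * (1 / bessel_symbol m \<xi>)" for \<xi>
  proof -
    define P where "P = bessel_symbol m \<xi>"
    have P: "P > 0" using bessel_symbol_ge_1[of m \<xi>] by (simp add: P_def)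
    have "(norm (multiplier_component m E bs \<xi>))\<^sup>2 = (norm (E \<xi>))\<^sup>2 * ((norm (symbol bs \<xi>))\<^sup>2 / P\<^sup>2)"
      using P by (simp add: multiplier_component_def norm_mult norm_divide power_mult_distrib power_divide P_def[symmetric])
    also have "\<dots> \<le> M\<^sup>2 * (P / P\<^sup>2)"
      using symbol_le_bessel_symbol[OF bs, of \<xi>]
      by (intro mult_mono divide_right_mono power_mono E) (auto simp: P_def)
    finally show ?thesis using P by (simp add: P_def power2_eq_square)
  qed
  have Pi: "integrable lborel (\<lambda>\<xi>::'a. M\<^sup>2 * (1 / bessel_symbol m \<xi>))"
    by (rule integrable_mult_right[OF integrable_inverse_bessel_symbol[OF m]])
  have w2: "integrable lborel (\<lambda>\<xi>. (norm (multiplier_component m E bs \<xi>))\<^sup>2)"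
  proof (rule Bochner_Integration.integrable_bound[OF Pi])
    show "AE \<xi> in lborel. norm ((norm (multiplier_component m E bs \<xi>))\<^sup>2) \<le> norm (M\<^sup>2 * (1 / bessel_symbol m \<xi>))"
      using order_trans[OF le abs_ge_self] by simp
  qed measurable
  then show ww: "square_integrable_borel (multiplier_component m E bs)"
    by (simp add: square_integrable_borel_def)
  have "(LINT \<xi>|lborel. (norm (multiplier_component m E bs \<xi>))\<^sup>2)
      \<le> (LINT \<xi>|lborel. M\<^sup>2 * (1 / bessel_symbol m (\<xi>::'a)))"
    by (rule integral_mono[OF w2 Pi le])
  also have "\<dots> = M\<^sup>2 * (LINT \<xi>|lborel. 1 / bessel_symbol m (\<xi>::'a))"
    by (rule integral_mult_right_zero)
  finally have "sqrt (LINT \<xi>|lborel. (norm (multiplier_component m E bs \<xi>))\<^sup>2)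
      \<le> sqrt (M\<^sup>2 * (LINT \<xi>|lborel. 1 / bessel_symbol m (\<xi>::'a)))"
    by (rule real_sqrt_le_mono)
  then show "L2_norm (multiplier_component m E bs) \<le> M * sqrt (LINT \<xi>|(lborel :: 'a measure). 1 / bessel_symbol m \<xi>)"
    unfolding square_integrable_borelD(2)[OF ww] using M by (simp add: real_sqrt_mult)
qed

lemma L2_norm_weak_partials_le_sobolev_norm:
  "bs \<in> directions m \<Longrightarrow> L2_norm (weak_partials bs \<phi>) \<le> sobolev_norm m \<phi>"
  unfolding sobolev_norm_def
  by (rule real_le_rsqrt) (rule member_le_sum, auto intro: finite_directions)

lemma sobolev_norm_nonneg: "0 \<le> sobolev_norm m \<phi>"
  unfolding sobolev_norm_def by (simp add: sum_nonneg)

definition multiplier_constant :: "nat \<Rightarrow> 'a::euclidean_space itself \<Rightarrow> real" where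
  "multiplier_constant m _ = real (card (directions m :: 'a list set)) *
     sqrt (LINT \<xi>|(lborel :: 'a measure). 1 / bessel_symbol m \<xi>)"

lemma multiplier_functional_bound:
  fixes E :: "'a::euclidean_space \<Rightarrow> complex"
  assumes m: "real m > real DIM('a) / 2" and E: "E \<in> borel_measurable borel" "\<And>\<xi>. norm (E \<xi>) \<le> M"
    and \<phi>: "\<phi> \<in> sobolev m"
  shows "norm (multiplier_functional m E \<phi>) \<le> M * multiplier_constant m TYPE('a) * sobolev_norm m \<phi>"
proof -
  define c where "c = sqrt (LINT \<xi>|(lborel :: 'a measure). 1 / bessel_symbol m \<xi>)"
  have "norm (multiplier_functional m E \<phi>)
      \<le> (\<Sum>bs\<in>(directions m :: 'a list set). (M * c) * sobolev_norm m \<phi>)"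
    unfolding multiplier_functional_def
  proof (rule sum_norm_le)
    fix bs :: "'a list" assume bs: "bs \<in> directions m"
    note L2 = multiplier_component_L2[OF m E bs]
    have "norm (fourier_pairing (multiplier_component m E bs) (weak_partials bs \<phi>))
        \<le> L2_norm (multiplier_component m E bs) * L2_norm (weak_partials bs \<phi>)"
      by (rule norm_fourier_pairing_le[OF L2(1) weak_partials_works(1)[OF \<phi> bs]])
    also have "\<dots> \<le> (M * c) * sobolev_norm m \<phi>"
      using L2(2) unfolding c_def
      by (rule mult_mono[OF _ L2_norm_weak_partials_le_sobolev_norm[OF bs]])
         (auto intro: order_trans[OF L2_norm_nonneg L2(2)] L2_norm_nonneg)
    finally show "norm (fourier_pairing (multiplier_component m E bs) (weak_partials bs \<phi>))
        \<le> (M * c) * sobolev_norm m \<phi>" .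
  qed
  then show ?thesis by (simp add: multiplier_constant_def c_def mult_ac)
qed

lemma multiplier_functional_linear:
  fixes E :: "'a::euclidean_space \<Rightarrow> complex"
  assumes m: "real m > real DIM('a) / 2" and E: "E \<in> borel_measurable borel" "\<And>\<xi>. norm (E \<xi>) \<le> M"
    and \<phi>: "\<phi> \<in> sobolev m" "\<psi> \<in> sobolev m"
  shows "multiplier_functional m E (\<lambda>x. c * \<phi> x + \<psi> x)
    = c * multiplier_functional m E \<phi> + multiplier_functional m E \<psi>"
proof -
  have "fourier_pairing (multiplier_component m E bs) (weak_partials bs (\<lambda>x. c * \<phi> x + \<psi> x))
      = c * fourier_pairing (multiplier_component m E bs) (weak_partials bs \<phi>)
        + fourier_pairing (multiplier_component m E bs) (weak_partials bs \<psi>)" if bs: "bs \<in> directions m" for bs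
    by (rule fourier_pairing_linear[OF multiplier_component_L2(1)[OF m E bs] weak_partials_works(1)[OF \<phi>(1) bs]
          weak_partials_works(1)[OF \<phi>(2) bs] weak_partials_linear[OF \<phi> bs]])
  then show ?thesis
    unfolding multiplier_functional_def by (simp add: sum.distrib sum_distrib_left)
qed

lemma multiplier_functional_schwartz:
  fixes E :: "'a::euclidean_space \<Rightarrow> complex"
  assumes m: "real m > real DIM('a) / 2" and E: "E \<in> borel_measurable borel" "\<And>\<xi>. norm (E \<xi>) \<le> M"
    and \<phi>: "\<phi> \<in> schwartz"
  shows "multiplier_functional m E \<phi> = (LINT \<xi>|lborel. E \<xi> * fourier \<phi> \<xi>)"
proof -
  let ?w = "multiplier_component m E"
  have key: "integrable lborel (\<lambda>\<xi>. ?w bs \<xi> * symbol bs \<xi> * fourier \<phi> \<xi>)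
      \<and> fourier_pairing (?w bs) (weak_partials bs \<phi>) = (LINT \<xi>|lborel. ?w bs \<xi> * symbol bs \<xi> * fourier \<phi> \<xi>)"
    if bs: "bs \<in> directions m" for bs
  proof -
    have B: "set bs \<subseteq> Basis" "set (rev bs) \<subseteq> Basis" using directions_Basis[OF bs] by auto
    have p: "partials (rev bs) \<phi> \<in> schwartz" by (rule schwartz_partials[OF \<phi> B(2)])
    note wp = weak_partials_AE[OF schwartz_square_integrable[OF p] schwartz_has_weak_partials[OF \<phi> B(1)]]
    note fp = fourier_pairing_schwartz[OF multiplier_component_L2(1)[OF m E bs] p wp]
    have "fourier (partials (rev bs) \<phi>) \<xi> = symbol bs \<xi> * fourier \<phi> \<xi>" for \<xi>
      using fourier_partials[OF \<phi> B(2)] by (simp add: symbol_rev)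
    then show ?thesis using fp by (simp add: mult.assoc)
  qed
  have "multiplier_functional m E \<phi> = (\<Sum>bs\<in>directions m. (LINT \<xi>|lborel. ?w bs \<xi> * symbol bs \<xi> * fourier \<phi> \<xi>))"
    unfolding multiplier_functional_def using key by (intro sum.cong) auto
  also have "\<dots> = (LINT \<xi>|lborel. (\<Sum>bs\<in>directions m. ?w bs \<xi> * symbol bs \<xi> * fourier \<phi> \<xi>))"
    using key by (intro Bochner_Integration.integral_sum[symmetric]) auto
  also have "\<dots> = (LINT \<xi>|lborel. E \<xi> * fourier \<phi> \<xi>)"
    by (simp only: sum_distrib_right[symmetric] multiplier_component_sum)
  finally show ?thesis .
qed

lemma multiplier_functional_in_sobolev_dual:
  fixes E :: "'a::euclidean_space \<Rightarrow> complex"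
  assumes m: "real m > real DIM('a) / 2" and E: "E \<in> borel_measurable borel" "\<And>\<xi>. norm (E \<xi>) \<le> M"
  shows "multiplier_functional m E \<in> sobolev_dual m"
  unfolding sobolev_dual_def linear_functional_on_def
proof (intro CollectI conjI ballI allI)
  note lin = multiplier_functional_linear[OF m E]
  have zero: "(\<lambda>x. 0) \<in> sobolev m" using schwartz_zero schwartz_subset_sobolev by blast
  fix \<phi> \<psi> :: "'a \<Rightarrow> complex" and c assume \<phi>: "\<phi> \<in> sobolev m"
  show "multiplier_functional m E (\<lambda>x. \<phi> x + \<psi> x) = multiplier_functional m E \<phi> + multiplier_functional m E \<psi>"
    if "\<psi> \<in> sobolev m"
    using lin[OF \<phi> that, of 1] by simp
  have "multiplier_functional m E (\<lambda>x. 0) = 0"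
    using lin[OF zero zero, of 1] by simp
  then show "multiplier_functional m E (\<lambda>x. c * \<phi> x) = c * multiplier_functional m E \<phi>"
    using lin[OF \<phi> zero, of c] by simp
next
  show "\<exists>C. \<forall>\<phi>\<in>sobolev m. norm (multiplier_functional m E \<phi>) \<le> C * sobolev_norm m \<phi>"
    using multiplier_functional_bound[OF m E] by blast
qed

lemma multiplier_functional_dual_norm_bounded:
  assumes m: "real m > real DIM('a::euclidean_space) / 2"
  obtains C where "\<And>E :: 'a \<Rightarrow> complex. E \<in> borel_measurable borel \<Longrightarrow> (\<And>\<xi>. norm (E \<xi>) \<le> M)
    \<Longrightarrow> sobolev_dual_norm m (multiplier_functional m E) \<le> C"
proof (cases "{\<phi> \<in> sobolev m. sobolev_norm m \<phi> \<noteq> 0} = ({} :: ('a \<Rightarrow> complex) set)")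
  case True
  show ?thesis
    \<comment> \<open>Over the empty set the supremum is an unspecified constant, the same for all \<open>E\<close>.\<close>
    by (rule that[of "Sup {}"]) (simp only: sobolev_dual_norm_def True image_empty order_refl)
next
  case False
  show ?thesis
  proof (rule that[of "M * multiplier_constant m TYPE('a)"])
    fix E :: "'a \<Rightarrow> complex" assume E: "E \<in> borel_measurable borel" "\<And>\<xi>. norm (E \<xi>) \<le> M"
    show "sobolev_dual_norm m (multiplier_functional m E) \<le> M * multiplier_constant m TYPE('a)"
      unfolding sobolev_dual_norm_def
    proof (rule cSUP_least[OF False])
      fix \<phi> :: "'a \<Rightarrow> complex" assume "\<phi> \<in> {\<phi> \<in> sobolev m. sobolev_norm m \<phi> \<noteq> 0}"
      then have \<phi>: "\<phi> \<in> sobolev m" "sobolev_norm m \<phi> > 0"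
        using sobolev_norm_nonneg[of m \<phi>] by auto
      show "norm (multiplier_functional m E \<phi>) / sobolev_norm m \<phi> \<le> M * multiplier_constant m TYPE('a)"
        using multiplier_functional_bound[OF m E \<phi>(1)] \<phi>(2) by (simp add: divide_le_eq)
    qed
  qed
qed

section \<open>The inverse Fourier transform of a bounded even multiplier\<close>

definition schwartz_total :: "nat \<Rightarrow> ('a::euclidean_space \<Rightarrow> complex) \<Rightarrow> real" where
  "schwartz_total n \<phi> = (\<Sum>k\<le>n. \<Sum>bs\<in>directions n. schwartz_seminorm k bs \<phi>)"

lemma schwartz_seminorm_le_total:
  assumes \<phi>: "\<phi> \<in> schwartz" and k: "k \<le> n" and bs: "bs \<in> directions n"
  shows "schwartz_seminorm k bs \<phi> \<le> schwartz_total n \<phi>"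
proof -
  have nn: "0 \<le> schwartz_seminorm k bs \<phi>" if "bs \<in> directions n" for k bs
    by (rule schwartz_seminorm_nonneg[OF \<phi> directions_Basis[OF that]])
  have "schwartz_seminorm k bs \<phi> \<le> (\<Sum>bs\<in>directions n. schwartz_seminorm k bs \<phi>)"
    by (rule member_le_sum[OF bs]) (auto intro: nn finite_directions)
  also have "\<dots> \<le> schwartz_total n \<phi>"
    unfolding schwartz_total_def using k
    by (intro member_le_sum[of k "{..n}" "\<lambda>k. \<Sum>bs\<in>directions n. schwartz_seminorm k bs \<phi>"]) (auto intro!: sum_nonneg nn)
  finally show ?thesis .
qed

lemma schwartz_L1_le:
  fixes \<phi> :: "'a::euclidean_space \<Rightarrow> complex"
  assumes \<phi>: "\<phi> \<in> schwartz"
  defines "n \<equiv> DIM('a)"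
  shows "(LINT x|lborel. norm (\<phi> x))
    \<le> 2 ^ n * (LINT x|(lborel :: 'a measure). decay 1 x) * (schwartz_seminorm 0 [] \<phi> + schwartz_seminorm (2 * n) [] \<phi>)"
proof -
  have d: "integrable lborel (decay 1 :: 'a \<Rightarrow> real)" by (intro integrable_decay) simp
  have "(LINT x|lborel. norm (\<phi> x))
      \<le> (LINT x|lborel. 2 ^ n * (schwartz_seminorm 0 [] \<phi> + schwartz_seminorm (2 * n) [] \<phi>) * decay 1 (x::'a))"
  proof (rule integral_mono)
    show "integrable lborel (\<lambda>x. norm (\<phi> x))" by (intro integrable_norm schwartz_integrable \<phi>)
    show "integrable lborel (\<lambda>x. 2 ^ n * (schwartz_seminorm 0 [] \<phi> + schwartz_seminorm (2 * n) [] \<phi>) * decay 1 (x::'a))"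
      by (intro integrable_mult_right d)
    show "norm (\<phi> x) \<le> 2 ^ n * (schwartz_seminorm 0 [] \<phi> + schwartz_seminorm (2 * n) [] \<phi>) * decay 1 x" for x
      unfolding n_def by (rule schwartz_decay[OF \<phi>])
  qed
  also have "\<dots> = 2 ^ n * (LINT x|(lborel :: 'a measure). decay 1 x) * (schwartz_seminorm 0 [] \<phi> + schwartz_seminorm (2 * n) [] \<phi>)"
    by simp
  finally show ?thesis .
qed

lemma schwartz_L1_continuous:
  obtains C where "C \<ge> 0" "\<And>\<phi> :: 'a::euclidean_space \<Rightarrow> complex. \<And>bs. \<phi> \<in> schwartz \<Longrightarrow> bs \<in> directions (2 * DIM('a))
    \<Longrightarrow> (LINT x|lborel. norm (partials bs \<phi> x)) \<le> C * schwartz_total (2 * DIM('a)) \<phi>"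
proof
  define D where "D = (LINT x|(lborel :: 'a measure). decay 1 x)"
  have D: "D \<ge> 0" unfolding D_def by (intro Bochner_Integration.integral_nonneg) (simp add: decay_pos less_imp_le)
  then show "0 \<le> 2 ^ DIM('a) * D * 2" by simp
  fix \<phi> :: "'a \<Rightarrow> complex" and bs :: "'a list"
  assume \<phi>: "\<phi> \<in> schwartz" and bs: "bs \<in> directions (2 * DIM('a))"
  have "(LINT x|lborel. norm (partials bs \<phi> x)) \<le> 2 ^ DIM('a) * D *
      (schwartz_seminorm 0 [] (partials bs \<phi>) + schwartz_seminorm (2 * DIM('a)) [] (partials bs \<phi>))"
    unfolding D_def by (rule schwartz_L1_le[OF schwartz_partials[OF \<phi> directions_Basis[OF bs]]])
  also have "\<dots> \<le> 2 ^ DIM('a) * D * (schwartz_total (2 * DIM('a)) \<phi> + schwartz_total (2 * DIM('a)) \<phi>)"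
    unfolding schwartz_seminorm_partials using D
    by (intro mult_left_mono add_mono schwartz_seminorm_le_total \<phi> bs) auto
  finally show "(LINT x|lborel. norm (partials bs \<phi> x)) \<le> 2 ^ DIM('a) * D * 2 * schwartz_total (2 * DIM('a)) \<phi>"
    by simp
qed

text \<open>The seminorms of \<open>F \<phi>\<close> that control its integral are themselves controlled by integrals of
  derivatives of \<open>\<phi>\<close>.\<close>

lemma fourier_L1_continuous:
  obtains C where "C \<ge> 0" "\<And>\<phi> :: 'a::euclidean_space \<Rightarrow> complex. \<phi> \<in> schwartz
    \<Longrightarrow> (LINT \<xi>|lborel. norm (fourier \<phi> \<xi>)) \<le> C * schwartz_total (2 * DIM('a)) \<phi>"
proof -
  define n where "n = 2 * DIM('a)"
  obtain C where C: "C \<ge> 0" "\<And>\<phi> :: 'a \<Rightarrow> complex. \<And>bs. \<phi> \<in> schwartz \<Longrightarrow> bs \<in> directions n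
    \<Longrightarrow> (LINT x|lborel. norm (partials bs \<phi> x)) \<le> C * schwartz_total n \<phi>"
    unfolding n_def using schwartz_L1_continuous by blast
  define D where "D = (LINT x|(lborel :: 'a measure). decay 1 x)"
  have D: "D \<ge> 0" unfolding D_def by (intro Bochner_Integration.integral_nonneg) (simp add: decay_pos less_imp_le)
  define B where "B k = real DIM('a) ^ k * (real DIM('a) * C)" for k
  have B0: "B k \<ge> 0" for k using C(1) by (simp add: B_def)
  have sem: "schwartz_seminorm k [] (fourier \<phi>) \<le> B k * schwartz_total n \<phi>" if \<phi>: "\<phi> \<in> schwartz" and k: "k \<le> n" for \<phi> :: "'a \<Rightarrow> complex" and k
    unfolding schwartz_seminorm_def partials.simps
  proof (rule cSUP_least)
    fix \<xi>
    have "norm \<xi> ^ k * norm (fourier \<phi> \<xi>)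
        \<le> real DIM('a) ^ k * (\<Sum>b\<in>Basis. (LINT x|lborel. norm (partials (replicate k b) \<phi> x)))"
      by (rule fourier_power_bound[OF \<phi>])
    also have "\<dots> \<le> real DIM('a) ^ k * (\<Sum>b\<in>(Basis :: 'a set). C * schwartz_total n \<phi>)"
      using k by (intro mult_left_mono sum_mono C \<phi>) (auto simp: directions_def)
    finally show "norm \<xi> ^ k * norm (fourier \<phi> \<xi>) \<le> B k * schwartz_total n \<phi>"
      by (simp add: B_def mult_ac)
  qed simp
  show ?thesis
  proof (rule that[of "2 ^ DIM('a) * D * (B 0 + B n)"])
    show "0 \<le> 2 ^ DIM('a) * D * (B 0 + B n)" using D B0 by simp
    fix \<phi> :: "'a \<Rightarrow> complex" assume \<phi>: "\<phi> \<in> schwartz"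
    have "(LINT \<xi>|lborel. norm (fourier \<phi> \<xi>)) \<le> 2 ^ DIM('a) * D *
        (schwartz_seminorm 0 [] (fourier \<phi>) + schwartz_seminorm (2 * DIM('a)) [] (fourier \<phi>))"
      unfolding D_def by (rule schwartz_L1_le[OF fourier_in_schwartz[OF \<phi>]])
    also have "\<dots> \<le> 2 ^ DIM('a) * D * (B 0 * schwartz_total n \<phi> + B n * schwartz_total n \<phi>)"
      unfolding n_def[symmetric] using D by (intro mult_left_mono add_mono sem \<phi>) auto
    finally show "(LINT \<xi>|lborel. norm (fourier \<phi> \<xi>))
        \<le> 2 ^ DIM('a) * D * (B 0 + B n) * schwartz_total (2 * DIM('a)) \<phi>"
      by (simp add: n_def algebra_simps)
  qed
qed

lemma distribution_of_schwartz:
  assumes E: "E \<in> borel_measurable borel" and \<phi>: "\<phi> \<in> schwartz"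
  shows "distribution_of E \<phi> = (LINT x|lborel. E x * \<phi> x)"
proof -
  note [measurable] = E schwartz_borel_measurable[OF \<phi>]
  show ?thesis unfolding distribution_of_def using \<phi> by (simp add: integral_completion)
qed

lemma bounded_pairing_L1:
  fixes E f :: "'a::euclidean_space \<Rightarrow> complex"
  assumes E: "E \<in> borel_measurable borel" "\<And>x. norm (E x) \<le> M" and f: "integrable lborel f"
  shows "integrable lborel (\<lambda>x. E x * f x)" "norm (LINT x|lborel. E x * f x) \<le> M * (LINT x|lborel. norm (f x))"
proof -
  show i: "integrable lborel (\<lambda>x. E x * f x)"
    using integrable_mult_bounded[OF f E] by (simp add: mult.commute)
  have "norm (LINT x|lborel. E x * f x) \<le> (LINT x|lborel. norm (E x * f x))"
    by (rule integral_norm_bound)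
  also have "\<dots> \<le> (LINT x|lborel. M * norm (f x))"
    using integrable_norm[OF i] integrable_norm[OF f]
    by (intro integral_mono) (auto simp: norm_mult intro!: mult_right_mono E)
  finally show "norm (LINT x|lborel. E x * f x) \<le> M * (LINT x|lborel. norm (f x))" by simp
qed

lemma distribution_of_bounded_tempered:
  fixes E :: "'a::euclidean_space \<Rightarrow> complex"
  assumes E: "E \<in> borel_measurable borel" "\<And>x. norm (E x) \<le> M"
  shows "distribution_of E \<in> tempered_distributions"
  unfolding tempered_distributions_def
proof (intro CollectI conjI)
  show "distribution_of E \<in> extensional schwartz" by (simp add: distribution_of_def)
  note i = bounded_pairing_L1(1)[OF E schwartz_integrable]
  show "linear_functional_on schwartz (distribution_of E)"
    unfolding linear_functional_on_def
    using i by (auto simp: distribution_of_schwartz[OF E(1)] schwartz_add schwartz_cmult distrib_left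
        mult.left_commute)
  have M: "M \<ge> 0" using E(2)[of 0] norm_ge_zero order_trans by blast
  obtain C where C: "C \<ge> 0" "\<And>\<phi> :: 'a \<Rightarrow> complex. \<And>bs. \<phi> \<in> schwartz \<Longrightarrow> bs \<in> directions (2 * DIM('a))
    \<Longrightarrow> (LINT x|lborel. norm (partials bs \<phi> x)) \<le> C * schwartz_total (2 * DIM('a)) \<phi>"
    using schwartz_L1_continuous by blast
  have "norm (distribution_of E \<phi>) \<le> (M * C) * schwartz_total (2 * DIM('a)) \<phi>" if \<phi>: "\<phi> \<in> schwartz" for \<phi> :: "'a \<Rightarrow> complex"
  proof -
    have "norm (distribution_of E \<phi>) \<le> M * (LINT x|lborel. norm (\<phi> x))"
      unfolding distribution_of_schwartz[OF E(1) \<phi>] by (rule bounded_pairing_L1(2)[OF E schwartz_integrable[OF \<phi>]])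
    also have "\<dots> \<le> M * (C * schwartz_total (2 * DIM('a)) \<phi>)"
      using C(2)[OF \<phi>, of "[]"] M by (intro mult_left_mono) (auto simp: directions_def)
    finally show ?thesis by simp
  qed
  then show "\<exists>C n. \<forall>\<phi>\<in>schwartz. norm (distribution_of E \<phi>) \<le> C * (\<Sum>k\<le>n. \<Sum>bs\<in>directions n. schwartz_seminorm k bs \<phi>)"
    unfolding schwartz_total_def by blast
qed

lemma fourier_linear:
  assumes "\<phi> \<in> schwartz" "\<psi> \<in> schwartz"
  shows "fourier (\<lambda>x. c * \<phi> x + \<psi> x) \<xi> = c * fourier \<phi> \<xi> + fourier \<psi> \<xi>"
  using integrable_times_character[OF schwartz_integrable[OF assms(1)]]
    integrable_times_character[OF schwartz_integrable[OF assms(2)]]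
  by (simp add: fourier_schwartz schwartz_linear assms distrib_right mult.assoc)

lemma fourier_distribution_inj: "inj_on fourier_distribution tempered_distributions"
proof (rule inj_onI)
  fix U V :: "('a \<Rightarrow> complex) \<Rightarrow> complex"
  assume UV: "U \<in> tempered_distributions" "V \<in> tempered_distributions"
    and eq: "fourier_distribution U = fourier_distribution V"
  show "U = V"
  proof (rule extensionalityI[of _ schwartz])
    show "U \<in> extensional schwartz" "V \<in> extensional schwartz"
      using UV by (auto simp: tempered_distributions_def)
    fix \<phi> :: "'a \<Rightarrow> complex" assume "\<phi> \<in> schwartz"
    then obtain \<psi> where \<psi>: "\<psi> \<in> schwartz" "\<phi> = fourier \<psi>" by (rule fourier_schwartz_surj)
    from fun_cong[OF eq, of \<psi>] show "U \<phi> = V \<phi>"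
      using \<psi> by (simp add: fourier_distribution_def)
  qed
qed

text \<open>The transform of \<open>U\<close> at \<open>\<phi>\<close> is \<open>\<integral> E (F F \<phi>)\<close>, and \<open>F F \<phi>\<close> is the reflection of \<open>\<phi>\<close>, which the evenness of
  \<open>E\<close> absorbs.\<close>

theorem inverse_fourier_distribution_even_multiplier:
  fixes E :: "'a::euclidean_space \<Rightarrow> complex"
  assumes E: "E \<in> borel_measurable borel" "\<And>x. norm (E x) \<le> M" and even: "\<And>x. E (- x) = E x"
    and U: "\<And>\<phi>. \<phi> \<in> schwartz \<Longrightarrow> U \<phi> = (LINT \<xi>|lborel. E \<xi> * fourier \<phi> \<xi>)"
  shows "inverse_fourier_distribution (distribution_of E) = restrict U schwartz"
proof -
  have M: "M \<ge> 0" using E(2)[of 0] norm_ge_zero order_trans by blast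
  have i: "integrable lborel (\<lambda>\<xi>. E \<xi> * fourier \<phi> \<xi>)" if "\<phi> \<in> schwartz" for \<phi>
    by (intro bounded_pairing_L1(1)[OF E] schwartz_integrable fourier_in_schwartz that)
  have temp: "restrict U schwartz \<in> tempered_distributions"
    unfolding tempered_distributions_def
  proof (intro CollectI conjI)
    have lin: "U (\<lambda>x. c * \<phi> x + \<psi> x) = c * U \<phi> + U \<psi>" if "\<phi> \<in> schwartz" "\<psi> \<in> schwartz" for c \<phi> \<psi>
      using i[OF that(1)] i[OF that(2)] that
      by (simp add: U schwartz_linear fourier_linear distrib_left mult.left_commute)
    have "U (\<lambda>x. 0) = 0" using lin[OF schwartz_zero schwartz_zero, of 1] by simp
    then show "linear_functional_on schwartz (restrict U schwartz)"
      unfolding linear_functional_on_def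
      using lin[where c=1] lin[OF _ schwartz_zero] by (auto simp: schwartz_add schwartz_cmult)
    obtain C where C: "C \<ge> 0" "\<And>\<phi> :: 'a \<Rightarrow> complex. \<phi> \<in> schwartz
      \<Longrightarrow> (LINT \<xi>|lborel. norm (fourier \<phi> \<xi>)) \<le> C * schwartz_total (2 * DIM('a)) \<phi>"
      using fourier_L1_continuous by blast
    have "norm (restrict U schwartz \<phi>) \<le> (M * C) * schwartz_total (2 * DIM('a)) \<phi>" if \<phi>: "\<phi> \<in> schwartz" for \<phi>
    proof -
      have "norm (U \<phi>) \<le> M * (LINT \<xi>|lborel. norm (fourier \<phi> \<xi>))"
        unfolding U[OF \<phi>] by (intro bounded_pairing_L1(2)[OF E] schwartz_integrable fourier_in_schwartz \<phi>)
      also have "\<dots> \<le> M * (C * schwartz_total (2 * DIM('a)) \<phi>)"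
        by (intro mult_left_mono C \<phi> M)
      finally show ?thesis using \<phi> by simp
    qed
    then show "\<exists>C n. \<forall>\<phi>\<in>schwartz. norm (restrict U schwartz \<phi>)
        \<le> C * (\<Sum>k\<le>n. \<Sum>bs\<in>directions n. schwartz_seminorm k bs \<phi>)"
      unfolding schwartz_total_def by blast
  qed simp
  have "fourier_distribution (restrict U schwartz) = distribution_of E"
  proof (rule extensionalityI[of _ schwartz])
    fix \<phi> :: "'a \<Rightarrow> complex" assume \<phi>: "\<phi> \<in> schwartz"
    have "fourier_distribution (restrict U schwartz) \<phi> = (LINT \<xi>|lborel. E \<xi> * fourier (fourier \<phi>) \<xi>)"
      using \<phi> by (simp add: fourier_distribution_def fourier_in_schwartz U)
    also have "\<dots> = (LINT \<xi>|lborel. E (0 + (-1) *\<^sub>R \<xi>) * \<phi> (0 + (-1) *\<^sub>R \<xi>))"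
      by (simp add: fourier_inversion_schwartz[OF \<phi>] even)
    also have "\<dots> = \<bar>-1\<bar> ^ DIM('a) *\<^sub>R (LINT \<xi>|lborel. E (0 + (-1) *\<^sub>R \<xi>) * \<phi> (0 + (-1) *\<^sub>R \<xi>))"
      by simp
    also have "\<dots> = (LINT \<xi>|lborel. E \<xi> * \<phi> \<xi>)"
      by (rule integral_lborel_affine[symmetric]) (auto intro: bounded_pairing_L1(1)[OF E] schwartz_integrable \<phi>)
    also have "\<dots> = distribution_of E \<phi>" by (rule distribution_of_schwartz[OF E(1) \<phi>, symmetric])
    finally show "fourier_distribution (restrict U schwartz) \<phi> = distribution_of E \<phi>" .
  qed (simp_all add: fourier_distribution_def distribution_of_def)
  then show ?thesis
    unfolding inverse_fourier_distribution_def
    using the_inv_into_f_f[OF fourier_distribution_inj temp] by simp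
qed

section \<open>The fractional diffusion equation\<close>

lemma integrable_abel_kernel:
  assumes "0 < \<alpha>" "t > 0"
  shows "integrable lborel (\<lambda>\<tau>. indicator {0..t} \<tau> * (t - \<tau>) powr (\<alpha> - 1) :: real)"
proof -
  have "integrable lborel (\<lambda>\<tau>. indicator {0..t} \<tau> * (\<tau> powr (1 - 1) * (t - \<tau>) powr (\<alpha> - 1)) :: real)"
    using Beta_interval[of 1 \<alpha> t] assms by (auto intro: integrable.intros)
  also have "?this \<longleftrightarrow> ?thesis"
  proof (rule integrable_cong_AE)
    have "AE \<tau> in lborel. \<tau> \<noteq> (0::real)" by (rule AE_lborel_singleton)
    then show "AE \<tau> in lborel. indicator {0..t} \<tau> * (\<tau> powr (1 - 1) * (t - \<tau>) powr (\<alpha> - 1))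
        = indicator {0..t} \<tau> * (t - \<tau>) powr (\<alpha> - 1)"
      by eventually_elim auto
  qed measurable
  finally show ?thesis .
qed

text \<open>Integrates the scalar equation for each frequency against \<open>\<Phi>\<close>.  Fubini applies because the kernel
  is integrable in \<open>\<tau>\<close>, the Mittag-Leffler factor is bounded, and \<open>\<Lambda> \<Phi>\<close> is integrable in \<open>\<xi>\<close>.\<close>

lemma volterra_superposition:
  fixes \<Phi> :: "'a::euclidean_space \<Rightarrow> complex" and \<Lambda> :: "'a \<Rightarrow> real"
  assumes \<alpha>: "0 < \<alpha>" "\<alpha> < 1" and t: "0 < t"
    and \<Phi>: "integrable lborel \<Phi>" and \<Lambda>: "\<Lambda> \<in> borel_measurable borel"
    and \<Lambda>\<Phi>: "integrable lborel (\<lambda>\<xi>. of_real (\<Lambda> \<xi>) * \<Phi> \<xi>)"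
    and bound: "\<And>\<xi> \<tau>. 0 \<le> \<tau> \<Longrightarrow> \<tau> \<le> t \<Longrightarrow> \<bar>mittag_leffler \<alpha> (\<Lambda> \<xi> * \<tau> powr \<alpha>)\<bar> \<le> M"
  defines "I \<equiv> \<lambda>\<tau>. indicator {0..t} \<tau> *\<^sub>R ((LINT \<xi>|lborel. of_real (mittag_leffler \<alpha> (\<Lambda> \<xi> * \<tau> powr \<alpha>)) *
      (of_real (\<Lambda> \<xi>) * \<Phi> \<xi>)) / of_real ((t - \<tau>) powr (1 - \<alpha>)))"
  shows "has_bochner_integral lborel I
    (of_real (Gamma \<alpha>) * (LINT \<xi>|lborel. of_real (mittag_leffler \<alpha> (\<Lambda> \<xi> * t powr \<alpha>) - 1) * \<Phi> \<xi>))"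
proof -
  have [measurable]: "mittag_leffler \<alpha> \<in> borel_measurable borel"
    by (rule borel_measurable_continuous_onI[OF continuous_mittag_leffler]) fact+
  note [measurable] = \<Lambda>
  have \<Phi>m [measurable]: "\<Phi> \<in> borel_measurable borel" using \<Phi> by auto
  define k where "k \<tau> = indicator {0..t} \<tau> * (t - \<tau>) powr (\<alpha> - 1)" for \<tau> :: real
  have k [measurable]: "k \<in> borel_measurable borel" unfolding k_def[abs_def] by measurable
  have ki: "integrable lborel k" unfolding k_def[abs_def] by (rule integrable_abel_kernel) fact+
  have k0: "k \<tau> \<ge> 0" for \<tau> by (simp add: k_def)
  define e where "e \<tau> \<xi> = mittag_leffler \<alpha> (\<Lambda> \<xi> * \<tau> powr \<alpha>)" for \<tau> \<xi>
  define G where "G \<tau> \<xi> = of_real (k \<tau> * e \<tau> \<xi>) * (of_real (\<Lambda> \<xi>) * \<Phi> \<xi>)" for \<tau> \<xi>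
  have G [measurable]: "(\<lambda>(\<tau>, \<xi>). G \<tau> \<xi>) \<in> borel_measurable (lborel \<Otimes>\<^sub>M lborel)"
    unfolding G_def e_def by measurable
  have M: "M \<ge> 0" using bound[of 0 0] t by simp
  have ke: "\<bar>k \<tau> * e \<tau> \<xi>\<bar> \<le> k \<tau> * M" for \<tau> \<xi>
  proof (cases "\<tau> \<in> {0..t}")
    case True
    then show ?thesis using bound[of \<tau> \<xi>] k0[of \<tau>] by (simp add: abs_mult e_def mult_left_mono)
  next
    case False
    then show ?thesis by (simp add: k_def)
  qed
  have Gle: "norm (G \<tau> \<xi>) \<le> k \<tau> * M * norm (of_real (\<Lambda> \<xi>) * \<Phi> \<xi>)" for \<tau> \<xi>
    unfolding G_def norm_mult[of "of_real (k \<tau> * e \<tau> \<xi>)"] norm_of_real by (intro mult_right_mono ke) simp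
  have Gi: "integrable lborel (G \<tau>)" for \<tau>
  proof (rule Bochner_Integration.integrable_bound)
    show "integrable lborel (\<lambda>\<xi>. k \<tau> * M * norm (of_real (\<Lambda> \<xi>) * \<Phi> \<xi>))"
      by (intro integrable_mult_right integrable_norm \<Lambda>\<Phi>)
    show "AE \<xi> in lborel. norm (G \<tau> \<xi>) \<le> norm (k \<tau> * M * norm (of_real (\<Lambda> \<xi>) * \<Phi> \<xi>))"
      using order_trans[OF Gle abs_ge_self] by simp
    show "G \<tau> \<in> borel_measurable lborel" unfolding G_def[abs_def] e_def by measurable
  qed
  have int: "integrable (lborel \<Otimes>\<^sub>M lborel) (\<lambda>(\<tau>, \<xi>). G \<tau> \<xi>)"
  proof (rule lborel_pair.Fubini_integrable[OF G])
    show "AE \<tau> in lborel. integrable lborel (\<lambda>\<xi>. case (\<tau>, \<xi>) of (\<tau>, \<xi>) \<Rightarrow> G \<tau> \<xi>)" using Gi by simp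
    show "integrable lborel (\<lambda>\<tau>. LINT \<xi>|lborel. norm (case (\<tau>, \<xi>) of (\<tau>, \<xi>) \<Rightarrow> G \<tau> \<xi>))"
    proof (rule Bochner_Integration.integrable_bound)
      let ?L = "LINT \<xi>|lborel. norm (of_real (\<Lambda> \<xi>) * \<Phi> \<xi>)"
      show "integrable lborel (\<lambda>\<tau>. k \<tau> * (M * ?L))" by (intro integrable_mult_left ki)
      show "AE \<tau> in lborel. norm (LINT \<xi>|lborel. norm (case (\<tau>, \<xi>) of (\<tau>, \<xi>) \<Rightarrow> G \<tau> \<xi>)) \<le> norm (k \<tau> * (M * ?L))"
      proof (intro AE_I2)
        fix \<tau> :: real
        have "(LINT \<xi>|lborel. norm (G \<tau> \<xi>)) \<le> (LINT \<xi>|lborel. k \<tau> * M * norm (of_real (\<Lambda> \<xi>) * \<Phi> \<xi>))"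
          by (intro integral_mono integrable_norm Gi integrable_mult_right \<Lambda>\<Phi> Gle)
        also have "\<dots> = k \<tau> * (M * ?L)" by simp
        finally have "(LINT \<xi>|lborel. norm (G \<tau> \<xi>)) \<le> k \<tau> * (M * ?L)" .
        moreover have "0 \<le> (LINT \<xi>|lborel. norm (G \<tau> \<xi>))" by simp
        ultimately show "norm (LINT \<xi>|lborel. norm (case (\<tau>, \<xi>) of (\<tau>, \<xi>) \<Rightarrow> G \<tau> \<xi>)) \<le> norm (k \<tau> * (M * ?L))"
          by simp
      qed
      show "(\<lambda>\<tau>. LINT \<xi>|lborel. norm (case (\<tau>, \<xi>) of (\<tau>, \<xi>) \<Rightarrow> G \<tau> \<xi>)) \<in> borel_measurable lborel"
        by (rule lborel.borel_measurable_lebesgue_integral) measurable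
    qed
  qed
  have I: "I \<tau> = (LINT \<xi>|lborel. G \<tau> \<xi>)" for \<tau>
  proof -
    \<comment> \<open>At \<open>\<tau> = t\<close> both sides are 0, by the conventions for powers of 0 and for division by 0.\<close>
    have kk: "k \<tau> = indicator {0..t} \<tau> * (1 / (t - \<tau>) powr (1 - \<alpha>))"
      using powr_minus_divide[of "t - \<tau>" "1 - \<alpha>"] by (simp add: k_def)
    have "(LINT \<xi>|lborel. G \<tau> \<xi>) = (LINT \<xi>|lborel. of_real (k \<tau>) * (of_real (e \<tau> \<xi>) * (of_real (\<Lambda> \<xi>) * \<Phi> \<xi>)))"
      by (simp add: G_def mult.assoc)
    also have "\<dots> = of_real (k \<tau>) * (LINT \<xi>|lborel. of_real (e \<tau> \<xi>) * (of_real (\<Lambda> \<xi>) * \<Phi> \<xi>))"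
      by (rule integral_mult_right_zero)
    finally show ?thesis
      unfolding kk I_def e_def by (simp add: indicator_def)
  qed
  have inner: "(LINT \<tau>|lborel. G \<tau> \<xi>) = of_real (Gamma \<alpha>) * (of_real (mittag_leffler \<alpha> (\<Lambda> \<xi> * t powr \<alpha>) - 1) * \<Phi> \<xi>)" for \<xi>
  proof -
    have h: "has_bochner_integral lborel (\<lambda>\<tau>. \<Lambda> \<xi> * e \<tau> \<xi> * k \<tau>)
        (Gamma \<alpha> * (mittag_leffler \<alpha> (\<Lambda> \<xi> * t powr \<alpha>) - 1))"
      using mittag_leffler_volterra[OF \<alpha> t, of "\<Lambda> \<xi>"] by (simp add: e_def k_def mult_ac)
    have "(LINT \<tau>|lborel. G \<tau> \<xi>) = (LINT \<tau>|lborel. of_real (\<Lambda> \<xi> * e \<tau> \<xi> * k \<tau>) * \<Phi> \<xi>)"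
      by (simp add: G_def mult_ac)
    also have "\<dots> = (LINT \<tau>|lborel. complex_of_real (\<Lambda> \<xi> * e \<tau> \<xi> * k \<tau>)) * \<Phi> \<xi>"
      by (rule integral_mult_left_zero)
    also have "(LINT \<tau>|lborel. complex_of_real (\<Lambda> \<xi> * e \<tau> \<xi> * k \<tau>))
        = of_real (LINT \<tau>|lborel. \<Lambda> \<xi> * e \<tau> \<xi> * k \<tau>)"
      by (rule integral_complex_of_real)
    finally show ?thesis by (simp add: has_bochner_integral_integral_eq[OF h])
  qed
  have "integrable lborel (\<lambda>\<tau>. LINT \<xi>|lborel. G \<tau> \<xi>)"
    by (rule lborel_pair.integrable_fst[OF int])
  moreover have "(LINT \<tau>|lborel. LINT \<xi>|lborel. G \<tau> \<xi>) = (LINT \<xi>|lborel. LINT \<tau>|lborel. G \<tau> \<xi>)"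
    using lborel_pair.Fubini_integral[OF int] by simp
  ultimately show ?thesis
    unfolding has_bochner_integral_iff I inner integral_mult_right_zero by simp
qed

theorem lemma2p5:
  fixes \<alpha> d a T :: real and m :: nat
  assumes "0 < \<alpha>" and "\<alpha> < 1" and "d > 0" and "a \<ge> 0" and "T > 0"
    and "real m > real DIM('a::euclidean_space) / 2"
  shows "\<exists>u :: real \<Rightarrow> ('a \<Rightarrow> complex) \<Rightarrow> complex.
    (\<forall>t\<in>{0..T}.
       let E = distribution_of (\<lambda>\<xi>. of_real
                 (mittag_leffler \<alpha> ((a - 4 * pi\<^sup>2 * d * (norm \<xi>)\<^sup>2) * t powr \<alpha>)))
       in E \<in> tempered_distributions \<and>
          restrict (u t) schwartz = inverse_fourier_distribution E) \<and>
    distributional_solution \<alpha> d a T m u"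
proof -
  note \<alpha> = assms(1,2)
  define \<Lambda> :: "'a \<Rightarrow> real" where "\<Lambda> \<xi> = a - 4 * pi\<^sup>2 * d * (norm \<xi>)\<^sup>2" for \<xi>
  define E :: "real \<Rightarrow> 'a \<Rightarrow> complex" where "E t \<xi> = of_real (mittag_leffler \<alpha> (\<Lambda> \<xi> * t powr \<alpha>))" for t \<xi>
  define M where "M = 1 + mittag_leffler2 \<alpha> 1 \<bar>a * T powr \<alpha>\<bar>"
  define u where "u t = multiplier_functional m (E t)" for t
  have [measurable]: "mittag_leffler \<alpha> \<in> borel_measurable borel"
    by (rule borel_measurable_continuous_onI[OF continuous_mittag_leffler]) fact+
  have \<Lambda>m [measurable]: "\<Lambda> \<in> borel_measurable borel" unfolding \<Lambda>_def[abs_def] by measurable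
  have bound: "\<bar>mittag_leffler \<alpha> (\<Lambda> \<xi> * t powr \<alpha>)\<bar> \<le> M" if "0 \<le> t" "t \<le> T" for \<xi> t
    unfolding M_def
  proof (rule mittag_leffler_bounded_above[OF \<alpha>])
    have "\<Lambda> \<xi> * t powr \<alpha> \<le> a * t powr \<alpha>"
      using assms(3) by (intro mult_right_mono) (auto simp: \<Lambda>_def)
    also have "\<dots> \<le> a * T powr \<alpha>"
      using that assms by (intro mult_left_mono powr_mono2) auto
    finally show "\<Lambda> \<xi> * t powr \<alpha> \<le> a * T powr \<alpha>" .
  qed
  have E: "E t \<in> borel_measurable borel" "\<And>\<xi>. norm (E t \<xi>) \<le> M" if "t \<in> {0..T}" for t
    using bound that by (auto simp: E_def)
       (unfold E_def[abs_def], measurable)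
  have u_schwartz: "u t \<phi> = (LINT \<xi>|lborel. E t \<xi> * fourier \<phi> \<xi>)" if "t \<in> {0..T}" "\<phi> \<in> schwartz" for t \<phi>
    unfolding u_def by (rule multiplier_functional_schwartz[OF assms(6) E that(2)]) (use that in auto)
  have transform: "distribution_of (E t) \<in> tempered_distributions
      \<and> restrict (u t) schwartz = inverse_fourier_distribution (distribution_of (E t))" if t: "t \<in> {0..T}" for t
  proof
    show "distribution_of (E t) \<in> tempered_distributions"
      by (rule distribution_of_bounded_tempered[OF E[OF t]])
    show "restrict (u t) schwartz = inverse_fourier_distribution (distribution_of (E t))"
      by (rule inverse_fourier_distribution_even_multiplier[symmetric, OF E[OF t] _ u_schwartz[OF t]])
         (auto simp: E_def \<Lambda>_def)
  qed
  have membership: "u \<in> weighted_Linf \<alpha> T m"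
    unfolding weighted_Linf_def
  proof (intro CollectI conjI ballI)
    show "u t \<in> sobolev_dual m" if "t \<in> {0..T}" for t
      unfolding u_def by (rule multiplier_functional_in_sobolev_dual[OF assms(6) E[OF that]])
    obtain C where C: "\<And>E :: 'a \<Rightarrow> complex. E \<in> borel_measurable borel \<Longrightarrow> (\<And>\<xi>. norm (E \<xi>) \<le> M)
        \<Longrightarrow> sobolev_dual_norm m (multiplier_functional m E) \<le> C"
      using multiplier_functional_dual_norm_bounded[OF assms(6)] by blast
    show "bdd_above ((\<lambda>t. t powr \<alpha> * sobolev_dual_norm m (u t)) ` {0..T})"
    proof (rule bdd_aboveI2)
      fix t assume t: "t \<in> {0..T}"
      have "sobolev_dual_norm m (u t) \<le> \<bar>C\<bar>"
        unfolding u_def using C[OF E[OF t]] by linarith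
      then have "t powr \<alpha> * sobolev_dual_norm m (u t) \<le> t powr \<alpha> * \<bar>C\<bar>" by (rule mult_left_mono) simp
      also have "\<dots> \<le> T powr \<alpha> * \<bar>C\<bar>"
        using t \<alpha> by (intro mult_right_mono powr_mono2) auto
      finally show "t powr \<alpha> * sobolev_dual_norm m (u t) \<le> T powr \<alpha> * \<bar>C\<bar>" .
    qed
  qed
  have equation: "set_integrable lebesgue {0..t} (\<lambda>\<tau>. (of_real d * u \<tau> (laplacian \<phi>) + of_real a * u \<tau> \<phi>)
          / of_real ((t - \<tau>) powr (1 - \<alpha>)))
      \<and> u t \<phi> = \<phi> 0 + of_real (1 / Gamma \<alpha>) * (LINT \<tau>:{0..t}|lebesgue.
          (of_real d * u \<tau> (laplacian \<phi>) + of_real a * u \<tau> \<phi>) / of_real ((t - \<tau>) powr (1 - \<alpha>)))"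
    if "\<phi> \<in> test_functions" and t: "t \<in> {0..T}" for \<phi> :: "'a \<Rightarrow> complex" and t
  proof -
    have \<phi>: "\<phi> \<in> schwartz" using that test_functions_subset_schwartz by blast
    note F\<phi> = fourier_in_schwartz[OF \<phi>]
    have L\<phi>: "laplacian \<phi> \<in> schwartz" by (rule laplacian_schwartz[OF \<phi>])
    have i: "integrable lborel (\<lambda>\<xi>. E \<tau> \<xi> * fourier \<psi> \<xi>)" if "\<tau> \<in> {0..T}" "\<psi> \<in> schwartz" for \<tau> \<psi>
      by (rule bounded_pairing_L1(1)[OF E[OF that(1)] schwartz_integrable[OF fourier_in_schwartz[OF that(2)]]])
    have \<phi>0: "\<phi> 0 = (LINT \<xi>|lborel. fourier \<phi> \<xi>)"
      using fourier_inversion_schwartz[OF \<phi>, of 0] by (simp add: fourier_schwartz[OF F\<phi>])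
    have symb: "of_real (\<Lambda> \<xi>) * fourier \<phi> \<xi> = of_real d * fourier (laplacian \<phi>) \<xi> + of_real a * fourier \<phi> \<xi>" for \<xi>
      unfolding fourier_laplacian[OF \<phi>] \<Lambda>_def by (simp add: algebra_simps)
    have num: "of_real d * u \<tau> (laplacian \<phi>) + of_real a * u \<tau> \<phi>
        = (LINT \<xi>|lborel. E \<tau> \<xi> * (of_real (\<Lambda> \<xi>) * fourier \<phi> \<xi>))" if "\<tau> \<in> {0..T}" for \<tau>
      unfolding symb using i[OF that \<phi>] i[OF that L\<phi>]
      by (simp add: u_schwartz[OF that \<phi>] u_schwartz[OF that L\<phi>] distrib_left mult.left_commute)
    define g where "g \<tau> = (of_real d * u \<tau> (laplacian \<phi>) + of_real a * u \<tau> \<phi>) / of_real ((t - \<tau>) powr (1 - \<alpha>))" for \<tau>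
    have "integrable lebesgue (\<lambda>\<tau>. indicator {0..t} \<tau> *\<^sub>R g \<tau>)
        \<and> u t \<phi> = \<phi> 0 + of_real (1 / Gamma \<alpha>) * (LINT \<tau>|lebesgue. indicator {0..t} \<tau> *\<^sub>R g \<tau>)"
    \<comment> \<open>At \<open>t = 0\<close> the interval is a null set and the multiplier is constantly 1, so the equation is
      Fourier inversion at the origin.\<close>
    proof (cases "t = 0")
      case True
      have AE0: "AE \<tau> in lebesgue. indicator {0..t} \<tau> *\<^sub>R g \<tau> = 0"
      proof (rule AE_completion)
        have "AE \<tau> in lborel. \<tau> \<noteq> (0::real)" by (rule AE_lborel_singleton)
        then show "AE \<tau> in lborel. indicator {0..t} \<tau> *\<^sub>R g \<tau> = 0"
          by eventually_elim (simp add: True)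
      qed
      have ms: "(\<lambda>\<tau>. indicator {0..t} \<tau> *\<^sub>R g \<tau>) \<in> borel_measurable lebesgue"
      proof -
        have "(\<lambda>\<tau>. indicator {0..t} \<tau> *\<^sub>R g \<tau>) = (\<lambda>\<tau>. indicator {0} \<tau> *\<^sub>R g 0)"
          using True by (auto simp: fun_eq_iff indicator_def)
        moreover have "(\<lambda>\<tau>::real. indicator {0} \<tau> *\<^sub>R g 0) \<in> borel_measurable lebesgue"
          by (rule measurable_completion) measurable
        ultimately show ?thesis by simp
      qed
      have "u t \<phi> = \<phi> 0"
        using u_schwartz[OF t \<phi>] True by (simp add: E_def mittag_leffler_0 \<phi>0)
      moreover have "integrable lebesgue (\<lambda>\<tau>. indicator {0..t} \<tau> *\<^sub>R g \<tau>)"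
        using AE0 ms by (subst integrable_cong_AE[of _ _ "\<lambda>_. 0"]) auto
      moreover have "(LINT \<tau>|lebesgue. indicator {0..t} \<tau> *\<^sub>R g \<tau>) = 0"
        using AE0 by (rule integral_eq_zero_AE)
      ultimately show ?thesis by simp
    next
      case False
      then have t0: "0 < t" using t by simp
      have "integrable lborel (\<lambda>\<xi>. of_real d * fourier (laplacian \<phi>) \<xi> + of_real a * fourier \<phi> \<xi>)"
        by (intro Bochner_Integration.integrable_add integrable_mult_right schwartz_integrable fourier_in_schwartz \<phi> L\<phi>)
      then have "has_bochner_integral lborel (\<lambda>\<tau>. indicator {0..t} \<tau> *\<^sub>R ((LINT \<xi>|lborel.
          of_real (mittag_leffler \<alpha> (\<Lambda> \<xi> * \<tau> powr \<alpha>)) * (of_real (\<Lambda> \<xi>) * fourier \<phi> \<xi>)) / of_real ((t - \<tau>) powr (1 - \<alpha>))))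
        (of_real (Gamma \<alpha>) * (LINT \<xi>|lborel. of_real (mittag_leffler \<alpha> (\<Lambda> \<xi> * t powr \<alpha>) - 1) * fourier \<phi> \<xi>))"
        using t by (intro volterra_superposition[OF \<alpha> t0 schwartz_integrable[OF F\<phi>] \<Lambda>m _ bound]) (auto simp: symb)
      also have "(\<lambda>\<tau>. indicator {0..t} \<tau> *\<^sub>R ((LINT \<xi>|lborel.
          of_real (mittag_leffler \<alpha> (\<Lambda> \<xi> * \<tau> powr \<alpha>)) * (of_real (\<Lambda> \<xi>) * fourier \<phi> \<xi>)) / of_real ((t - \<tau>) powr (1 - \<alpha>))))
        = (\<lambda>\<tau>. indicator {0..t} \<tau> *\<^sub>R g \<tau>)"
        using num t by (auto simp: fun_eq_iff indicator_def g_def E_def)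
      also have "(LINT \<xi>|lborel. of_real (mittag_leffler \<alpha> (\<Lambda> \<xi> * t powr \<alpha>) - 1) * fourier \<phi> \<xi>) = u t \<phi> - \<phi> 0"
      proof -
        have "(LINT \<xi>|lborel. of_real (mittag_leffler \<alpha> (\<Lambda> \<xi> * t powr \<alpha>) - 1) * fourier \<phi> \<xi>)
            = (LINT \<xi>|lborel. E t \<xi> * fourier \<phi> \<xi> - fourier \<phi> \<xi>)"
          by (simp add: E_def left_diff_distrib)
        also have "\<dots> = (LINT \<xi>|lborel. E t \<xi> * fourier \<phi> \<xi>) - (LINT \<xi>|lborel. fourier \<phi> \<xi>)"
          by (intro Bochner_Integration.integral_diff i t \<phi> schwartz_integrable F\<phi>)
        finally show ?thesis by (simp add: u_schwartz[OF t \<phi>] \<phi>0)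
      qed
      finally have h: "has_bochner_integral lborel (\<lambda>\<tau>. indicator {0..t} \<tau> *\<^sub>R g \<tau>) (of_real (Gamma \<alpha>) * (u t \<phi> - \<phi> 0))" .
      then have gm: "(\<lambda>\<tau>. indicator {0..t} \<tau> *\<^sub>R g \<tau>) \<in> borel_measurable lborel"
        by (auto simp: has_bochner_integral_iff)
      have "Gamma \<alpha> > 0" using \<alpha> by (intro Gamma_real_pos)
      then show ?thesis
        using h unfolding has_bochner_integral_iff
        by (simp add: integrable_completion[OF gm] integral_completion[OF gm])
    qed
    then show ?thesis by (simp add: g_def set_integrable_def set_lebesgue_integral_def)
  qed
  show ?thesis
  proof (intro exI[of _ u] conjI ballI)
    fix t assume "t \<in> {0..T}"
    from transform[OF this]
    show "let E = distribution_of (\<lambda>\<xi>. of_real (mittag_leffler \<alpha> ((a - 4 * pi\<^sup>2 * d * (norm \<xi>)\<^sup>2) * t powr \<alpha>)))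
       in E \<in> tempered_distributions \<and> restrict (u t) schwartz = inverse_fourier_distribution E"
      unfolding Let_def E_def[abs_def] \<Lambda>_def .
  next
    show "distributional_solution \<alpha> d a T m u"
      unfolding distributional_solution_def Let_def using membership equation by blast
  qed
qed

end
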